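(* There exists a constant $\varepsilon_1>0$ such that if $(u,d)\in C^\infty(\mathbb{R}^4\setminus\{0\},\mathbb{R}^4\times\mathbb{S}^3)$ is a solution of the steady simplified Ericksen-Leslie system in $\mathbb{R}^4\setminus\{0\}$ satisfying $$|u(x)|\le\frac{C}{|x|},\qquad |\nabla d(x)|<\frac{\varepsilon_1}{|x|}\qquad\text{for all }x\in\mathbb{R}^4\setminus\{0\},$$ for some constant $C>0$, then $u\equiv 0$ and $d$ is a constant map.
   Context: The steady simplified Ericksen-Leslie system for $u$ with values in $\mathbb{R}^n$, a scalar pressure $p$, and $d$ with values in $\mathbb{S}^{n-1}\subset\mathbb{R}^n$ (here $n=4$) is $$-\Delta u+u\cdot\nabla u+\nabla p=-\operatorname{div}(\nabla d\odot\nabla d),\qquad \operatorname{div}u=0,\qquad \Delta d+|\nabla d|^2d=u\cdot\nabla d,$$ where $(\nabla d\odot\nabla d)_{ij}=\partial_{x_i}d\cdot\partial_{x_j}d$. Saying that $(u,d)$ is a solution means that the system holds for some smooth pressure $p$ on $\mathbb{R}^4\setminus\{0\}$. The constant $\varepsilon_1$ is chosen before, hence independently of, $C$. *)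

theory Defs
  imports "HOL-Analysis.Analysis"
begin

(* Functions on an open set Omega of R^n are total functions on real^'n; only their values on
   Omega matter, since every operator below depends only on the germ of the function at the
   point.  All of them are meant for functions that are differentiable there. *)

definition partial_derivative ::
    "'n \<Rightarrow> (real ^ 'n \<Rightarrow> 'b::real_normed_vector) \<Rightarrow> real ^ 'n \<Rightarrow> 'b"
  where "partial_derivative i f x = frechet_derivative f (at x) (axis i 1)"

(* Differentiability is required explicitly at every stage because frechet_derivative is an
   unspecified value at points where the derivative does not exist. *)

primrec Ck_on :: "nat \<Rightarrow> (real ^ 'n) set \<Rightarrow> (real ^ 'n \<Rightarrow> 'b::real_normed_vector) \<Rightarrow> bool"
  where
    "Ck_on 0 \<Omega> f \<longleftrightarrow> continuous_on \<Omega> f"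
  | "Ck_on (Suc k) \<Omega> f \<longleftrightarrow>
       (\<forall>x\<in>\<Omega>. f differentiable (at x)) \<and> (\<forall>i. Ck_on k \<Omega> (partial_derivative i f))"

definition smooth_on :: "(real ^ 'n) set \<Rightarrow> (real ^ 'n \<Rightarrow> 'b::real_normed_vector) \<Rightarrow> bool"
  where "smooth_on \<Omega> f \<longleftrightarrow> (\<forall>k. Ck_on k \<Omega> f)"

(* The i-th entry of grad f x is the i-th partial derivative of f.  For vector-valued f, the
   norm of grad f x in 'b ^ 'n is the Frobenius norm: its square is the sum over i of the
   squared norms of the partial derivatives. *)

definition grad :: "(real ^ 'n \<Rightarrow> 'b::real_normed_vector) \<Rightarrow> real ^ 'n \<Rightarrow> 'b ^ 'n"
  where "grad f x = (\<chi> i. partial_derivative i f x)"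

definition divergence :: "(real ^ 'n \<Rightarrow> real ^ 'n) \<Rightarrow> real ^ 'n \<Rightarrow> real"
  where "divergence u x = (\<Sum>i\<in>UNIV. partial_derivative i (\<lambda>y. u y $ i) x)"

(* Row-wise divergence; below it is applied only to a symmetric matrix field. *)

definition matrix_divergence :: "(real ^ 'n \<Rightarrow> real ^ 'n ^ 'n) \<Rightarrow> real ^ 'n \<Rightarrow> real ^ 'n"
  where "matrix_divergence A x = (\<chi> i. divergence (\<lambda>y. A y $ i) x)"

definition laplacian :: "(real ^ 'n \<Rightarrow> 'b::real_normed_vector) \<Rightarrow> real ^ 'n \<Rightarrow> 'b"
  where "laplacian f x = (\<Sum>i\<in>UNIV. partial_derivative i (partial_derivative i f) x)"

(* u . nabla f *)

definition advection ::
    "(real ^ 'n \<Rightarrow> real ^ 'n) \<Rightarrow> (real ^ 'n \<Rightarrow> 'b::real_normed_vector) \<Rightarrow> real ^ 'n \<Rightarrow> 'b"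
  where "advection u f x = (\<Sum>i\<in>UNIV. (u x $ i) *\<^sub>R partial_derivative i f x)"

(* nabla d \<odot> nabla d *)

definition ericksen_tensor ::
    "(real ^ 'n \<Rightarrow> 'b::real_inner) \<Rightarrow> real ^ 'n \<Rightarrow> real ^ 'n ^ 'n"
  where "ericksen_tensor d x =
    (\<chi> i j. partial_derivative i d x \<bullet> partial_derivative j d x)"

definition ericksen_leslie_on ::
    "(real ^ 'n) set \<Rightarrow> (real ^ 'n \<Rightarrow> real ^ 'n) \<Rightarrow> (real ^ 'n \<Rightarrow> real) \<Rightarrow>
     (real ^ 'n \<Rightarrow> real ^ 'n) \<Rightarrow> bool"
  where "ericksen_leslie_on \<Omega> u p d \<longleftrightarrow>
    (\<forall>x\<in>\<Omega>.
       - laplacian u x + advection u u x + grad p x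
           = - matrix_divergence (ericksen_tensor d) x \<and>
       divergence u x = 0 \<and>
       laplacian d x + (norm (grad d x))\<^sup>2 *\<^sub>R d x = advection u d x)"

(* A map into the unit sphere is smooth iff it is smooth as a map into the ambient space. *)

definition smooth_ericksen_leslie_solution_on ::
    "(real ^ 'n) set \<Rightarrow> (real ^ 'n \<Rightarrow> real ^ 'n) \<Rightarrow> (real ^ 'n \<Rightarrow> real ^ 'n) \<Rightarrow> bool"
  where "smooth_ericksen_leslie_solution_on \<Omega> u d \<longleftrightarrow>
    smooth_on \<Omega> u \<and> smooth_on \<Omega> d \<and> d ` \<Omega> \<subseteq> sphere 0 1 \<and>
    (\<exists>p. smooth_on \<Omega> p \<and> ericksen_leslie_on \<Omega> u p d)"

end

(* A solution is controlled through the flux of its energy.  Multiplying the momentum equation by u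
   and using that u . grad d is orthogonal to d gives, for W = |u|^2 and the head
   Q = |u|^2/2 + |grad d|^2/2 + p,
     Lap W / 2 - u . grad Q = |grad u|^2 + |u . grad d|^2.
   In dimension four the integral of |grad u|^2 is scale invariant, so over an annulus it equals a
   difference of boundary terms at two radii that stay bounded; Hardy's inequality then makes
   W/|x|^2 integrable on the whole space, the boundary terms tend to zero along both ends, and W = 0.

   The only boundary term that is not bounded by inspection is the one with the pressure, since no
   derivative estimates for u are available.  At unit scale one has to bound the integral of p g,
   where g = u . grad eta has compact support and, as the flux of u through spheres vanishes, mean zero.
   Write g as the Laplacian of a truncated Newtonian potential h of g plus a convolution of g with a
   smooth kernel.  Tested with grad h the viscous term drops out because div u = 0, leaving
   (u (x) u + grad d (.) grad d) : Hess h, which is controlled by the L^2 norm of Lap h; in the smooth part all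
   derivatives fall on the kernel.

   Once u = 0, d is a harmonic map, and Bochner's formula together with |grad d| <= 1/(2|x|) puts
   W = |grad d|^2 under the same Liouville argument. *)

theory Submission
  imports Defs "HOL-Real_Asymp.Real_Asymp"
begin

section \<open>Partial derivatives and functions of class \<open>C\<^sup>k\<close>\<close>

text \<open>Every term of the energy balance is scale invariant and |x||u| is bounded but not small,
  so neither a choice of radii nor absorption closes the argument. What closes it is a bound of each
  boundary term by kappa + M(kappa) times the integral of W/|x|^2 over one annulus, for every kappa
  > 0: with kappa = 1 it yields integrability, hence annular integrals tending to zero, and only
  afterwards is kappa sent to zero. The additive kappa comes from the pressure: it is also driven by
  the director stress, which need not vanish with u, so pressure times u is linear in u while the
  annular integral is quadratic. Weighted Young inequalities pay for the difference. As the Hessian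
  is only measured in L^2, an integration by parts replaces singular integral theory. The constants:
  x/|x|^2 has divergence 2/|x|^2 in dimension four, the radial derivative of W consumes 1 of this 2,
  and \<open>liouville\<close> tolerates 3/2. Bochner's formula consumes a further eps_1^2 = 1/4,
  which fits into the remaining 1/2.\<close>

abbreviation pd :: "'n \<Rightarrow> (real ^ 'n \<Rightarrow> real) \<Rightarrow> real ^ 'n \<Rightarrow> real"
  where "pd \<equiv> partial_derivative"

lemma pd_eqI:
  assumes "(f has_derivative f') (at x)"
  shows "partial_derivative i f x = f' (axis i 1)"
  using frechet_derivative_at[OF assms] by (simp add: partial_derivative_def)

lemma has_derivative_pd:
  fixes f :: "real ^ 'n \<Rightarrow> real"
  assumes "f differentiable (at x)"
  shows "(f has_derivative (\<lambda>v. \<Sum>i\<in>UNIV. v $ i * pd i f x)) (at x)"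
proof -
  have D: "(f has_derivative frechet_derivative f (at x)) (at x)"
    using assms by (simp add: frechet_derivative_works)
  then interpret bounded_linear "frechet_derivative f (at x)"
    by (rule has_derivative_bounded_linear)
  have "frechet_derivative f (at x) v = (\<Sum>i\<in>UNIV. v $ i * pd i f x)" for v
  proof -
    have "frechet_derivative f (at x) v
        = frechet_derivative f (at x) (\<Sum>i\<in>UNIV. v $ i *\<^sub>R axis i 1)"
      by (simp add: basis_expansion flip: scalar_mult_eq_scaleR)
    also have "\<dots> = (\<Sum>i\<in>UNIV. v $ i * pd i f x)"
      by (simp add: sum scaleR partial_derivative_def)
    finally show ?thesis .
  qed
  then have "frechet_derivative f (at x) = (\<lambda>v. \<Sum>i\<in>UNIV. v $ i * pd i f x)"
    by (rule ext)
  with D show ?thesis by simp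
qed

lemma pd_const [simp]: "partial_derivative i (\<lambda>_. c) x = 0"
  by (subst pd_eqI) (rule has_derivative_const, simp)

lemma pd_add:
  assumes "f differentiable (at x)" "g differentiable (at x)"
  shows "partial_derivative i (\<lambda>x. f x + g x) x = partial_derivative i f x + partial_derivative i g x"
  by (subst pd_eqI[OF has_derivative_add[OF assms[unfolded frechet_derivative_works]]])
     (simp add: partial_derivative_def)

lemma pd_diff:
  assumes "f differentiable (at x)" "g differentiable (at x)"
  shows "partial_derivative i (\<lambda>x. f x - g x) x = partial_derivative i f x - partial_derivative i g x"
  by (subst pd_eqI[OF has_derivative_diff[OF assms[unfolded frechet_derivative_works]]])
     (simp add: partial_derivative_def)

lemma pd_sum:
  assumes "\<And>k. k \<in> I \<Longrightarrow> f k differentiable (at x)"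
  shows "partial_derivative i (\<lambda>x. \<Sum>k\<in>I. f k x) x = (\<Sum>k\<in>I. partial_derivative i (f k) x)"
  by (subst pd_eqI[OF has_derivative_sum[OF assms[unfolded frechet_derivative_works]]])
     (simp_all add: partial_derivative_def)

lemma pd_mult:
  fixes f g :: "real ^ 'n \<Rightarrow> real"
  assumes "f differentiable (at x)" "g differentiable (at x)"
  shows "pd i (\<lambda>x. f x * g x) x = f x * pd i g x + pd i f x * g x"
  by (subst pd_eqI[OF has_derivative_mult[OF assms[unfolded frechet_derivative_works]]])
     (simp add: partial_derivative_def)

lemma pd_cmult:
  fixes f :: "real ^ 'n \<Rightarrow> real"
  assumes "f differentiable (at x)"
  shows "pd i (\<lambda>x. c * f x) x = c * pd i f x"
  by (subst pd_mult) (use assms in simp_all)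

lemma pd_bounded_linear:
  assumes "bounded_linear L" "f differentiable (at x)"
  shows "partial_derivative i (\<lambda>x. L (f x)) x = L (partial_derivative i f x)"
  by (subst pd_eqI[OF bounded_linear.has_derivative[OF assms(1) assms(2)[unfolded frechet_derivative_works]]])
     (simp add: partial_derivative_def)

lemma pd_chain:
  fixes f :: "real ^ 'n \<Rightarrow> real"
  assumes "f differentiable (at x)" "(F has_real_derivative F') (at (f x))"
  shows "pd i (\<lambda>x. F (f x)) x = F' * pd i f x"
proof -
  have "((F \<circ> f) has_derivative ((*) F' \<circ> frechet_derivative f (at x))) (at x)"
    by (rule diff_chain_at) (use assms in \<open>simp_all add: frechet_derivative_works has_field_derivative_def\<close>)
  then show ?thesis by (subst pd_eqI) (auto simp: o_def partial_derivative_def)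
qed

lemma differentiable_chain_real:
  fixes f :: "real ^ 'n \<Rightarrow> real"
  assumes "f differentiable (at x)" "(F has_real_derivative F') (at (f x))"
  shows "(\<lambda>x. F (f x)) differentiable (at x)"
proof -
  have "F differentiable at (f x)"
    using assms(2) by (meson differentiable_def has_field_derivative_def)
  then show ?thesis
    using differentiable_chain_at[OF assms(1)] by (simp add: o_def)
qed

lemma differentiable_cong_open:
  assumes "open S" "x \<in> S" "\<And>y. y \<in> S \<Longrightarrow> f y = g y"
  shows "f differentiable (at x) \<longleftrightarrow> g differentiable (at x)"
  unfolding differentiable_def
  using has_derivative_transform_within_open[of f _ x UNIV S g]
    has_derivative_transform_within_open[of g _ x UNIV S f] assms by auto

lemma pd_cong_open:
  assumes "open S" "x \<in> S" "\<And>y. y \<in> S \<Longrightarrow> f y = g y"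
  shows "partial_derivative i f x = partial_derivative i g x"
proof -
  have "(f has_derivative D) (at x) \<longleftrightarrow> (g has_derivative D) (at x)" for D
    using has_derivative_transform_within_open[of f _ x UNIV S g]
      has_derivative_transform_within_open[of g _ x UNIV S f] assms by auto
  then show ?thesis by (simp add: partial_derivative_def frechet_derivative_def)
qed

lemma Ck_on_cong:
  assumes "open S" "\<And>y. y \<in> S \<Longrightarrow> f y = g y"
  shows "Ck_on k S f \<longleftrightarrow> Ck_on k S g"
  using assms(2)
proof (induction k arbitrary: f g)
  case 0
  then show ?case by (simp cong: continuous_on_cong)
next
  case (Suc k)
  have "Ck_on k S (partial_derivative i f) \<longleftrightarrow> Ck_on k S (partial_derivative i g)" for i
    by (intro Suc.IH pd_cong_open[OF assms(1)]) (use Suc.prems in auto)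
  moreover have "f differentiable (at x) \<longleftrightarrow> g differentiable (at x)" if "x \<in> S" for x
    using differentiable_cong_open[OF assms(1) that] Suc.prems by blast
  ultimately show ?case by simp
qed

lemma Ck_on_Suc_D: "Ck_on (Suc k) S f \<Longrightarrow> Ck_on k S f"
proof (induction k arbitrary: f)
  case 0
  then show ?case
    by (auto intro!: continuous_at_imp_continuous_on differentiable_imp_continuous_within)
qed simp

lemma Ck_on_le: "Ck_on k S f \<Longrightarrow> m \<le> k \<Longrightarrow> Ck_on m S f"
proof (induction k)
  case (Suc k)
  then show ?case using Ck_on_Suc_D by (cases "m = Suc k") (auto simp del: Ck_on.simps simp: le_Suc_eq)
qed simp

lemma Ck_on_subset: "Ck_on k S f \<Longrightarrow> T \<subseteq> S \<Longrightarrow> Ck_on k T f"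
  by (induction k arbitrary: f) (auto intro: continuous_on_subset)

lemma Ck_on_Un:
  assumes "open S" "open T" "Ck_on k S f" "Ck_on k T f"
  shows "Ck_on k (S \<union> T) f"
  using assms(3,4) by (induction k arbitrary: f) (auto intro: continuous_on_open_Un assms(1,2))

lemma Ck_on_continuous: "Ck_on k S f \<Longrightarrow> continuous_on S f"
  using Ck_on_le[of k S f 0] by simp

lemma Ck_on_differentiable: "Ck_on k S f \<Longrightarrow> 0 < k \<Longrightarrow> x \<in> S \<Longrightarrow> f differentiable (at x)"
  by (cases k) auto

lemma Ck_on_pd: "Ck_on (Suc k) S f \<Longrightarrow> Ck_on k S (partial_derivative i f)"
  by simp

lemma Ck_on_const [simp]: "Ck_on k S (\<lambda>_ :: real ^ 'b. c)"
proof (induction k arbitrary: c)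
  case (Suc k)
  have "partial_derivative i (\<lambda>_. c) = (\<lambda>_. 0)" for i :: 'b by (rule ext) simp
  with Suc show ?case by simp
qed simp

lemma Ck_on_add:
  assumes "open S"
  shows "Ck_on k S f \<Longrightarrow> Ck_on k S g \<Longrightarrow> Ck_on k S (\<lambda>x. f x + g x)"
proof (induction k arbitrary: f g)
  case (Suc k)
  have "Ck_on k S (partial_derivative i (\<lambda>x. f x + g x))" for i
    by (subst Ck_on_cong[OF assms, where g = "\<lambda>x. partial_derivative i f x + partial_derivative i g x"])
       (use Suc in \<open>auto intro!: pd_add\<close>)
  with Suc.prems show ?case by simp
qed (auto intro: continuous_intros)

lemma Ck_on_mult:
  fixes f g :: "real ^ 'n \<Rightarrow> real"
  assumes "open S"
  shows "Ck_on k S f \<Longrightarrow> Ck_on k S g \<Longrightarrow> Ck_on k S (\<lambda>x. f x * g x)"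
proof (induction k arbitrary: f g)
  case (Suc k)
  have "Ck_on k S (pd i (\<lambda>x. f x * g x))" for i
    by (subst Ck_on_cong[OF assms, where g = "\<lambda>x. f x * pd i g x + pd i f x * g x"])
       (use Suc.prems Ck_on_Suc_D in \<open>auto intro!: pd_mult Ck_on_add[OF assms] Suc.IH\<close>)
  with Suc.prems show ?case by simp
qed (auto intro: continuous_intros)

lemma Ck_on_diff:
  fixes f g :: "real ^ 'n \<Rightarrow> real"
  assumes "open S" "Ck_on k S f" "Ck_on k S g"
  shows "Ck_on k S (\<lambda>x. f x - g x)"
  using Ck_on_add[OF assms(1,2) Ck_on_mult[OF assms(1) Ck_on_const[of _ _ "-1"] assms(3)]] by simp

lemma Ck_on_sum:
  fixes f :: "'k \<Rightarrow> real ^ 'n \<Rightarrow> real"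
  assumes "open S" "\<And>k. k \<in> I \<Longrightarrow> Ck_on n S (f k)"
  shows "Ck_on n S (\<lambda>x. \<Sum>k\<in>I. f k x)"
  using assms(2) by (induction I rule: infinite_finite_induct) (auto intro: Ck_on_add[OF assms(1)])

lemma Ck_on_power2:
  fixes f :: "real ^ 'n \<Rightarrow> real"
  shows "open S \<Longrightarrow> Ck_on k S f \<Longrightarrow> Ck_on k S (\<lambda>x. (f x)\<^sup>2)"
  unfolding power2_eq_square by (rule Ck_on_mult)

lemma Ck_on_bounded_linear:
  assumes "open S" "bounded_linear L"
  shows "Ck_on k S f \<Longrightarrow> Ck_on k S (\<lambda>x. L (f x))"
proof (induction k arbitrary: f)
  case (Suc k)
  have "Ck_on k S (partial_derivative i (\<lambda>x. L (f x)))" for i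
    by (subst Ck_on_cong[OF assms(1), where g = "\<lambda>x. L (partial_derivative i f x)"])
       (use Suc in \<open>auto intro!: pd_bounded_linear assms\<close>)
  moreover have "(\<lambda>x. L (f x)) differentiable (at x)" if "x \<in> S" for x
    using Suc.prems that bounded_linear.has_derivative[OF assms(2)] unfolding differentiable_def Ck_on.simps
    by blast
  ultimately show ?case by simp
qed (auto intro: bounded_linear.continuous_on assms)

lemma Ck_on_coord [simp]: "Ck_on k S (\<lambda>x :: real ^ 'n. x $ i)"
proof (cases k)
  case (Suc m)
  have *: "((\<lambda>x. x $ i) has_derivative (\<lambda>v. v $ i)) (at x)" for x :: "real ^ 'n"
    by (rule bounded_linear_imp_has_derivative[OF bounded_linear_vec_nth])
  have "pd j (\<lambda>x. x $ i) = (\<lambda>_. if i = j then 1 else 0)" for j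
    by (rule ext) (simp add: pd_eqI[OF *] axis_def)
  then have "Ck_on m S (pd j (\<lambda>x. x $ i))" for j by simp
  moreover have "(\<lambda>x. x $ i) differentiable at x" for x :: "real ^ 'n"
    using * by (auto simp: differentiable_def)
  ultimately show ?thesis using Suc by simp
qed (auto intro: continuous_intros)

lemma pd_coord: "pd j (\<lambda>x. x $ i) x = (if i = j then 1 else 0)"
proof -
  have *: "((\<lambda>x. x $ i) has_derivative (\<lambda>v. v $ i)) (at x)"
    by (rule bounded_linear_imp_has_derivative[OF bounded_linear_vec_nth])
  show ?thesis by (simp add: pd_eqI[OF *] axis_def)
qed

lemma Ck_on_inverse:
  fixes f :: "real ^ 'n \<Rightarrow> real"
  assumes "open S" "\<And>x. x \<in> S \<Longrightarrow> f x \<noteq> 0"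
  shows "Ck_on k S f \<Longrightarrow> Ck_on k S (\<lambda>x. inverse (f x))"
proof (induction k)
  case (Suc k)
  have D: "(inverse has_real_derivative - (inverse (f x) * inverse (f x))) (at (f x))" if "x \<in> S" for x
    using DERIV_inverse[OF assms(2)[OF that], where s = UNIV] by (simp add: power2_eq_square)
  have d: "f differentiable at x" if "x \<in> S" for x
    using Suc.prems that by simp
  have "Ck_on k S (pd i (\<lambda>x. inverse (f x)))" for i
  proof (subst Ck_on_cong[OF assms(1)])
    show "pd i (\<lambda>x. inverse (f x)) x = (- 1) * (inverse (f x) * inverse (f x)) * pd i f x" if "x \<in> S" for x
      using pd_chain[OF d D, OF that that] by simp
    have "Ck_on k S (\<lambda>x. inverse (f x))" using Suc Ck_on_Suc_D by blast
    then show "Ck_on k S (\<lambda>x. (- 1) * (inverse (f x) * inverse (f x)) * pd i f x)"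
      using Suc.prems by (intro Ck_on_mult[OF assms(1)]) auto
  qed
  moreover have "(\<lambda>x. inverse (f x)) differentiable (at x)" if "x \<in> S" for x
    using differentiable_chain_real[OF d D, OF that that] .
  ultimately show ?case by simp
qed (use assms in \<open>auto intro: continuous_intros\<close>)

text \<open>Cutoffs of finite smoothness are built from these truncated powers:
  \<open>pospow m\<close> is of class C^(m-1), and unlike flat exponentials it has explicit
  derivatives of the same kind.\<close>

definition pospow :: "nat \<Rightarrow> real \<Rightarrow> real"
  where "pospow m t = (max 0 t) ^ m"

text \<open>The exponent starts at two because the positive part itself has a corner at 0. There the
  difference quotient is the next lower truncated power, which tends to 0.\<close>

lemma pospow_deriv: "(pospow (Suc (Suc m)) has_real_derivative real (Suc (Suc m)) * pospow (Suc m) t) (at t)"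
proof (cases "t = 0")
  case True
  have "(pospow (Suc m) \<longlongrightarrow> pospow (Suc m) 0) (at 0)"
    unfolding pospow_def by (intro tendsto_intros)
  moreover have "pospow (Suc (Suc m)) h / h = pospow (Suc m) h" for h
    by (auto simp: pospow_def max_def)
  ultimately have "((\<lambda>h. (pospow (Suc (Suc m)) h) / h) \<longlongrightarrow> 0) (at 0)"
    by (auto simp add: pospow_def[of "Suc _" 0] intro: Lim_transform_eventually always_eventually)
  then show ?thesis using True by (simp add: has_field_derivative_iff pospow_def)
next
  case False
  then consider "t > 0" | "t < 0" by linarith
  then show ?thesis
  proof cases
    case 1
    have "((\<lambda>t. t ^ Suc (Suc m)) has_real_derivative real (Suc (Suc m)) * pospow (Suc m) t) (at t)"
      using 1 DERIV_pow[of "Suc (Suc m)" t UNIV] by (simp add: pospow_def)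
    then show ?thesis
      by (rule has_field_derivative_transform_within_open[where S = "{0<..}"])
         (use 1 in \<open>auto simp: pospow_def\<close>)
  next
    case 2
    have "((\<lambda>t. 0) has_real_derivative real (Suc (Suc m)) * pospow (Suc m) t) (at t)"
      using 2 by (auto intro!: derivative_eq_intros simp: pospow_def)
    then show ?thesis
      by (rule has_field_derivative_transform_within_open[where S = "{..<0}"])
         (use 2 in \<open>auto simp: pospow_def\<close>)
  qed
qed

lemma Ck_on_pospow:
  fixes f :: "real ^ 'n \<Rightarrow> real"
  assumes "open S" "Ck_on k S f"
  shows "k < m \<Longrightarrow> Ck_on k S (\<lambda>x. pospow m (f x))"
  using assms(2)
proof (induction k arbitrary: m)
  case 0
  then have "continuous_on S f" by simp
  then show ?case 
    unfolding pospow_def Ck_on.simps by (rule continuous_on_power[OF continuous_on_max[OF continuous_on_const]])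
next
  case (Suc k)
  define n where "n = m - 2"
  have m: "m = Suc (Suc n)"
    using \<open>Suc k < m\<close> by (simp add: n_def)
  have d: "f differentiable at x" if "x \<in> S" for x
    using Suc.prems that by simp
  have "Ck_on k S (pd i (\<lambda>x. pospow m (f x)))" for i
  proof (subst Ck_on_cong[OF assms(1)])
    show "pd i (\<lambda>x. pospow m (f x)) x = real m * pospow (Suc n) (f x) * pd i f x" if "x \<in> S" for x
      using pd_chain[OF d pospow_deriv, OF that] m by simp
    have "Ck_on k S (\<lambda>x. pospow (Suc n) (f x))" 
      by (rule Suc.IH) (use Suc.prems m in \<open>auto simp del: Ck_on.simps intro: Ck_on_Suc_D\<close>)
    then show "Ck_on k S (\<lambda>x. real m * pospow (Suc n) (f x) * pd i f x)"
      using Suc.prems by (intro Ck_on_mult[OF assms(1)]) auto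
  qed
  moreover have "(\<lambda>x. pospow m (f x)) differentiable (at x)" if "x \<in> S" for x
    using differentiable_chain_real[OF d pospow_deriv, OF that] m by simp
  ultimately show ?case by simp
qed

text \<open>Both mixed partial derivatives equal the limit of the second difference quotient.\<close>

lemma second_difference:
  fixes f :: "real ^ 'n \<Rightarrow> real"
  assumes f: "Ck_on (Suc (Suc 0)) (ball x e) f" and h: "0 < h" "2 * h < e"
  obtains s t where "0 < s" "s < h" "0 < t" "t < h"
    "f (x + h *\<^sub>R axis i 1 + h *\<^sub>R axis j 1) - f (x + h *\<^sub>R axis i 1) - f (x + h *\<^sub>R axis j 1) + f x
      = h\<^sup>2 * pd j (pd i f) (x + s *\<^sub>R axis i 1 + t *\<^sub>R axis j 1)"
proof -
  have in_ball: "x + s *\<^sub>R axis i 1 + t *\<^sub>R axis j 1 \<in> ball x e" if "0 \<le> s" "s \<le> h" "0 \<le> t" "t \<le> h" for s t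
  proof -
    have "norm (s *\<^sub>R axis i 1 + t *\<^sub>R axis j (1::real)) \<le> s + t"
      using that norm_triangle_ineq[of "s *\<^sub>R axis i 1" "t *\<^sub>R axis j (1::real)"] by simp
    then have "norm (s *\<^sub>R axis i 1 + t *\<^sub>R axis j (1::real)) < e"
      using that h by linarith
    then show ?thesis
      by (metis add.assoc add_diff_cancel_left' dist_commute dist_norm mem_ball)
  qed
  have line: "((\<lambda>r. g (y + r *\<^sub>R axis k 1)) has_real_derivative pd k g (y + r *\<^sub>R axis k 1)) (at r)"
    if "g differentiable (at (y + r *\<^sub>R axis k 1))" for g :: "real ^ 'n \<Rightarrow> real" and y k r
  proof -
    have "(g has_derivative (\<lambda>v. \<Sum>i\<in>UNIV. v $ i * pd i g (y + r *\<^sub>R axis k 1))) (at (y + r *\<^sub>R axis k 1))"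
      using has_derivative_pd[OF that] .
    then have "((\<lambda>r. g (y + r *\<^sub>R axis k 1)) has_derivative
        (\<lambda>t. \<Sum>i\<in>UNIV. (t *\<^sub>R axis k 1) $ i * pd i g (y + r *\<^sub>R axis k 1))) (at r)"
      by (rule has_derivative_compose[rotated]) (auto intro!: derivative_eq_intros)
    moreover have "(\<Sum>i\<in>UNIV. (t *\<^sub>R axis k 1) $ i * pd i g (y + r *\<^sub>R axis k 1)) = t * pd k g (y + r *\<^sub>R axis k 1)" for t :: real
    proof -
      have "(\<Sum>i\<in>UNIV. (t *\<^sub>R axis k 1) $ i * pd i g (y + r *\<^sub>R axis k 1))
          = (\<Sum>i\<in>UNIV. if k = i then t * pd k g (y + r *\<^sub>R axis k 1) else 0)"
        by (rule sum.cong) (auto simp: axis_def)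
      then show ?thesis by simp
    qed
    ultimately show ?thesis by (simp add: has_field_derivative_def mult.commute[of _ "pd k g _"])
  qed
  have df: "f differentiable (at y)" "pd i f differentiable (at y)" if "y \<in> ball x e" for y
    using f that by auto
  \<comment> \<open>The second difference is the increment of the j-difference \<open>\<phi>\<close>
    in direction i. The mean value theorem in i, then in j, turns it into one mixed
    derivative.\<close>
  define \<phi> where "\<phi> s = f (x + h *\<^sub>R axis j 1 + s *\<^sub>R axis i 1) - f (x + s *\<^sub>R axis i 1)" for s
  have "\<exists>s>0. s < h \<and> \<phi> h - \<phi> 0
      = (h - 0) * (pd i f (x + h *\<^sub>R axis j 1 + s *\<^sub>R axis i 1) - pd i f (x + s *\<^sub>R axis i 1))"
    unfolding \<phi>_def
    by (rule MVT2[OF h(1)], intro derivative_intros line df)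
       (use in_ball[of _ h] in_ball[of _ 0] h in \<open>auto simp: add.commute add.left_commute\<close>)
  then obtain s where s: "0 < s" "s < h" "\<phi> h - \<phi> 0
      = h * (pd i f (x + h *\<^sub>R axis j 1 + s *\<^sub>R axis i 1) - pd i f (x + s *\<^sub>R axis i 1))"
    by auto
  have "\<exists>t>0. t < h \<and> pd i f (x + s *\<^sub>R axis i 1 + h *\<^sub>R axis j 1) - pd i f (x + s *\<^sub>R axis i 1 + 0 *\<^sub>R axis j 1)
      = (h - 0) * pd j (pd i f) (x + s *\<^sub>R axis i 1 + t *\<^sub>R axis j 1)"
    by (rule MVT2[OF h(1)], intro line df) (use in_ball s in auto)
  then obtain t where t: "0 < t" "t < h"
    "pd i f (x + s *\<^sub>R axis i 1 + h *\<^sub>R axis j 1) - pd i f (x + s *\<^sub>R axis i 1)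
      = h * pd j (pd i f) (x + s *\<^sub>R axis i 1 + t *\<^sub>R axis j 1)" by auto
  have comm: "x + a *\<^sub>R axis j 1 + b *\<^sub>R axis i 1 = x + b *\<^sub>R axis i 1 + a *\<^sub>R axis j 1" for a b
    by simp
  have "\<phi> h - \<phi> 0 = h * (h * pd j (pd i f) (x + s *\<^sub>R axis i 1 + t *\<^sub>R axis j 1))"
    using s(3) t(3) unfolding comm by metis
  then show thesis
    by (intro that[OF s(1,2) t(1,2)]) (simp add: \<phi>_def comm power2_eq_square)
qed

lemma pd_commute:
  fixes f :: "real ^ 'n \<Rightarrow> real"
  assumes "open S" "Ck_on (Suc (Suc 0)) S f" "x \<in> S"
  shows "pd i (pd j f) x = pd j (pd i f) x"
proof (rule ccontr)
  assume ne: "pd i (pd j f) x \<noteq> pd j (pd i f) x"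
  define \<delta> where "\<delta> = \<bar>pd i (pd j f) x - pd j (pd i f) x\<bar> / 2"
  have \<delta>: "\<delta> > 0" using ne by (simp add: \<delta>_def)
  obtain e where e: "e > 0" "ball x e \<subseteq> S" using assms(1,3) openE by blast
  have f: "Ck_on (Suc (Suc 0)) (ball x e) f" using assms(2) e(2) Ck_on_subset by blast
  have "continuous_on (ball x e) (pd i (pd j f))" "continuous_on (ball x e) (pd j (pd i f))"
    using f by simp_all
  then have c: "isCont (pd i (pd j f)) x" "isCont (pd j (pd i f)) x"
    using e(1) by (auto simp: continuous_on_eq_continuous_at)
  obtain d1 where d1: "d1 > 0" "\<And>y. dist y x < d1 \<Longrightarrow> dist (pd i (pd j f) y) (pd i (pd j f) x) < \<delta>"
    using c(1) \<delta> unfolding continuous_at_eps_delta by blast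
  obtain d2 where d2: "d2 > 0" "\<And>y. dist y x < d2 \<Longrightarrow> dist (pd j (pd i f) y) (pd j (pd i f) x) < \<delta>"
    using c(2) \<delta> unfolding continuous_at_eps_delta by blast
  \<comment> \<open>The sampled points lie within 2h of x, so a third of the smallest radius keeps
    them inside all three balls.\<close>
  define h where "h = min e (min d1 d2) / 3"
  have h: "0 < h" "2 * h < e" "2 * h < d1" "2 * h < d2"
    using e(1) d1(1) d2(1) by (auto simp: h_def)
  have near: "dist (x + s *\<^sub>R axis a 1 + t *\<^sub>R axis b 1) x < 2 * h" if "0 < s" "s < h" "0 < t" "t < h"
    for s t :: real and a b
  proof -
    have "norm (s *\<^sub>R axis a 1 + t *\<^sub>R axis b (1::real)) \<le> s + t"
      using that norm_triangle_ineq[of "s *\<^sub>R axis a 1" "t *\<^sub>R axis b (1::real)"] by simp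
    then show ?thesis using that h by (simp add: dist_norm add.assoc)
  qed
  obtain s t where st: "0 < s" "s < h" "0 < t" "t < h"
    "f (x + h *\<^sub>R axis i 1 + h *\<^sub>R axis j 1) - f (x + h *\<^sub>R axis i 1) - f (x + h *\<^sub>R axis j 1) + f x
      = h\<^sup>2 * pd j (pd i f) (x + s *\<^sub>R axis i 1 + t *\<^sub>R axis j 1)"
    using second_difference[OF f h(1,2)] .
  obtain s' t' where st': "0 < s'" "s' < h" "0 < t'" "t' < h"
    "f (x + h *\<^sub>R axis j 1 + h *\<^sub>R axis i 1) - f (x + h *\<^sub>R axis j 1) - f (x + h *\<^sub>R axis i 1) + f x
      = h\<^sup>2 * pd i (pd j f) (x + s' *\<^sub>R axis j 1 + t' *\<^sub>R axis i 1)"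
    using second_difference[OF f h(1,2)] .
  have "h\<^sup>2 * pd j (pd i f) (x + s *\<^sub>R axis i 1 + t *\<^sub>R axis j 1)
      = h\<^sup>2 * pd i (pd j f) (x + s' *\<^sub>R axis j 1 + t' *\<^sub>R axis i 1)"
    using st(5) st'(5) by (simp add: algebra_simps)
  then have eq: "pd j (pd i f) (x + s *\<^sub>R axis i 1 + t *\<^sub>R axis j 1)
      = pd i (pd j f) (x + s' *\<^sub>R axis j 1 + t' *\<^sub>R axis i 1)"
    using h(1) by simp
  have "dist (pd j (pd i f) (x + s *\<^sub>R axis i 1 + t *\<^sub>R axis j 1)) (pd j (pd i f) x) < \<delta>"
    by (rule d2(2)[OF order.strict_trans[OF near[OF st(1-4)] h(4)]])
  moreover have "dist (pd i (pd j f) (x + s' *\<^sub>R axis j 1 + t' *\<^sub>R axis i 1)) (pd i (pd j f) x) < \<delta>"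
    by (rule d1(2)[OF order.strict_trans[OF near[OF st'(1-4)] h(3)]])
  ultimately have "dist (pd i (pd j f) x) (pd j (pd i f) x) < 2 * \<delta>"
    unfolding eq dist_real_def by linarith
  then show False by (simp add: \<delta>_def dist_real_def)
qed

section \<open>Integration by parts and convolution\<close>

text \<open>Continuity is asked on S only, so integrands that are singular or unspecified at the
  origin qualify once a cutoff annihilates them there.\<close>

lemma integrable_compact_support:
  fixes f :: "'a::euclidean_space \<Rightarrow> real"
  assumes "compact S" "continuous_on S f" "\<And>x. x \<notin> S \<Longrightarrow> f x = 0"
  shows "integrable lborel f"
proof -
  have "(\<lambda>x. indicator S x *\<^sub>R f x) = f"
    using assms(3) by (auto simp: indicator_def fun_eq_iff)
  then show ?thesis using borel_integrable_compact[OF assms(1,2)] by simp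
qed

lemma lborel_integral_affine:
  fixes f :: "'a::euclidean_space \<Rightarrow> real"
  assumes [measurable]: "f \<in> borel_measurable borel" and c: "c \<noteq> 0"
  shows "(LBINT x. f x) = \<bar>c\<bar> ^ DIM('a) * (LBINT x. f (t + c *\<^sub>R x))"
  by (subst lborel_affine[OF c, of t]) (simp add: integral_density integral_distr c)

lemma lborel_integrable_affine:
  fixes f :: "'a::euclidean_space \<Rightarrow> real"
  assumes f: "integrable lborel f" and c: "c \<noteq> 0"
  shows "integrable lborel (\<lambda>x. f (t + c *\<^sub>R x))"
proof -
  have [measurable]: "f \<in> borel_measurable borel" using f by simp
  have "integrable (density (distr lborel borel (\<lambda>x. t + c *\<^sub>R x)) (\<lambda>_. \<bar>c\<bar>^DIM('a))) f"
    using f by (subst (asm) lborel_affine[OF c, of t])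
  then show ?thesis using c
    by (simp add: integrable_density integrable_distr_eq)
qed

lemma lborel_integral_translate:
  fixes f :: "'a::euclidean_space \<Rightarrow> real"
  assumes "f \<in> borel_measurable borel"
  shows "(LBINT x. f (x + t)) = (LBINT x. f x)"
  using lborel_integral_affine[OF assms, of 1 t] by (simp add: add.commute)

lemma lborel_integral_reflect:
  fixes f :: "'a::euclidean_space \<Rightarrow> real"
  assumes "f \<in> borel_measurable borel"
  shows "(LBINT x. f (t - x)) = (LBINT x. f x)"
  using lborel_integral_affine[OF assms, of "-1" t] by simp

lemma pd_eq_0:
  assumes "closed S" "\<And>x. x \<notin> S \<Longrightarrow> f x = 0" "x \<notin> S"
  shows "partial_derivative i f x = 0"
  using pd_cong_open[of "- S" x f "\<lambda>_. 0"] assms by (simp add: open_Compl)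

text \<open>The open sets \<open>\<Omega>\<close> and \<open>- S\<close> cover the space, and f is
  zero on the second. Cut-off fields thus become smooth across the origin.\<close>

lemma Ck_on_extend:
  assumes "open \<Omega>" "closed S" "S \<subseteq> \<Omega>" "\<And>x. x \<notin> S \<Longrightarrow> f x = 0" "Ck_on k \<Omega> f"
  shows "Ck_on k UNIV f"
proof -
  have "Ck_on k (- S) f"
    by (subst Ck_on_cong[where g = "\<lambda>_. 0"]) (use assms in \<open>auto simp: open_Compl\<close>)
  then have "Ck_on k (\<Omega> \<union> - S) f"
    using Ck_on_Un assms by (blast intro: open_Compl)
  moreover have "\<Omega> \<union> - S = UNIV" using assms(3) by blast
  ultimately show ?thesis by simp
qed

lemma line_derivative:
  fixes g :: "real ^ 'n \<Rightarrow> real"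
  assumes "g differentiable (at (y + r *\<^sub>R w))"
  shows "((\<lambda>r. g (y + r *\<^sub>R w)) has_real_derivative (\<Sum>i\<in>UNIV. w $ i * pd i g (y + r *\<^sub>R w))) (at r)"
proof -
  have "((\<lambda>r. g (y + r *\<^sub>R w)) has_derivative
      (\<lambda>t. \<Sum>i\<in>UNIV. (t *\<^sub>R w) $ i * pd i g (y + r *\<^sub>R w))) (at r)"
  proof -
    have "((\<lambda>r. y + r *\<^sub>R w) has_derivative (\<lambda>t. t *\<^sub>R w)) (at r)"
      by (auto intro!: derivative_eq_intros)
    from has_derivative_compose[OF this has_derivative_pd[OF assms]] show ?thesis .
  qed
  moreover have "(\<lambda>t. \<Sum>i\<in>UNIV. (t *\<^sub>R w) $ i * pd i g (y + r *\<^sub>R w))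
      = (*) (\<Sum>i\<in>UNIV. w $ i * pd i g (y + r *\<^sub>R w))"
    by (rule ext) (simp add: sum_distrib_left sum_distrib_right mult_ac)
  ultimately show ?thesis by (simp add: has_field_derivative_def)
qed

lemma sum_axis: "(\<Sum>i\<in>UNIV. (axis k 1 :: real ^ 'n) $ i * f i) = f k"
proof -
  have "(\<Sum>i\<in>UNIV. (axis k 1 :: real ^ 'n) $ i * f i) = (\<Sum>i\<in>UNIV. if k = i then f k else 0)"
    by (rule sum.cong) (auto simp: axis_def)
  then show ?thesis by simp
qed

lemma bounded_outside_compact:
  fixes f :: "'a::topological_space \<Rightarrow> real"
  assumes "compact S" "continuous_on S f" "\<And>x. x \<notin> S \<Longrightarrow> f x = 0"
  obtains M where "M > 0" "\<And>x. \<bar>f x\<bar> \<le> M"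
proof -
  have "bounded (f ` S)"
    using assms(1,2) compact_continuous_image compact_imp_bounded by blast
  then obtain M where M: "M > 0" "\<And>x. x \<in> S \<Longrightarrow> \<bar>f x\<bar> \<le> M"
    by (force simp: bounded_pos)
  show thesis
    by (rule that[of M]) (use M assms(3) in \<open>force+\<close>)
qed

text \<open>Difference quotients have integral zero by translation invariance, and they converge
  boundedly to the derivative.\<close>

lemma integral_pd_UNIV:
  fixes f :: "real ^ 'n \<Rightarrow> real"
  assumes f: "Ck_on (Suc 0) UNIV f" and S: "compact S" "\<And>x. x \<notin> S \<Longrightarrow> f x = 0"
  shows "(LBINT x. pd i f x) = 0"
proof -
  have df: "f differentiable (at x)" for x using f by simp
  have cf: "continuous_on UNIV f" using Ck_on_continuous[OF f] .
  have cp: "continuous_on UNIV (pd i f)" using f by simp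
  have [measurable]: "f \<in> borel_measurable borel" "pd i f \<in> borel_measurable borel"
    using cf cp by (simp_all add: borel_measurable_continuous_onI)
  have p0: "pd i f x = 0" if "x \<notin> S" for x
    by (rule pd_eq_0[OF compact_imp_closed[OF S(1)] _ that]) (rule S(2))
  obtain M where M: "M > 0" "\<And>x. \<bar>pd i f x\<bar> \<le> M"
    using bounded_outside_compact[OF S(1) continuous_on_subset[OF cp] p0] by blast
  obtain R where R: "R > 0" "\<And>x. x \<in> S \<Longrightarrow> norm x \<le> R"
    using compact_imp_bounded[OF S(1)] by (auto simp: bounded_pos)
  have int_f: "integrable lborel f"
    by (rule integrable_compact_support[OF S(1) continuous_on_subset[OF cf] S(2)]) auto
  define e :: "real ^ 'n" where "e = axis i 1"
  define r where "r n = 1 / real (Suc n)" for n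
  have r: "0 < r n" "r n \<le> 1" for n by (auto simp: r_def)
  define q where "q n x = (f (x + r n *\<^sub>R e) - f x) / r n" for n x
  have int_t: "integrable lborel (\<lambda>x. f (x + t))" for t
    using lborel_integrable_affine[OF int_f, of 1 t] by (simp add: add.commute)
  have q0: "(LBINT x. q n x) = 0" for n
    unfolding q_def using int_f int_t lborel_integral_translate[of f "r n *\<^sub>R e"] by simp
  \<comment> \<open>Steps are at most 1, so all quotients live in the ball of radius R + 1, where
    the mean value theorem bounds them by M.\<close>
  have bound: "\<bar>q n x\<bar> \<le> M * indicator (cball 0 (R + 1)) x" for n x
  proof (cases "x \<in> cball 0 (R + 1)")
    case True
    have "\<exists>t>0. t < r n \<and> f (x + r n *\<^sub>R e) - f (x + 0 *\<^sub>R e)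
        = (r n - 0) * (\<Sum>k\<in>UNIV. e $ k * pd k f (x + t *\<^sub>R e))"
      by (rule MVT2[OF r(1)], rule line_derivative[OF df])
    then obtain t where "f (x + r n *\<^sub>R e) - f x = r n * pd i f (x + t *\<^sub>R e)"
      by (auto simp: e_def sum_axis)
    then have "q n x = pd i f (x + t *\<^sub>R e)" using r(1)[of n] by (simp add: q_def)
    then show ?thesis using M(2) True by simp
  next
    case False
    then have "norm x > R + 1" by simp
    moreover have "norm (r n *\<^sub>R e) \<le> 1" using r[of n] by (simp add: e_def)
    ultimately have "norm (x + r n *\<^sub>R e) > R"
      using norm_triangle_ineq2[of x "- (r n *\<^sub>R e)"] by simp
    then have "x + r n *\<^sub>R e \<notin> S" "x \<notin> S" using R \<open>norm x > R + 1\<close> by force+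
    then show ?thesis using S(2) False by (simp add: q_def)
  qed
  have lim: "(\<lambda>n. q n x) \<longlonglongrightarrow> pd i f x" for x
  proof -
    have "((\<lambda>s. f (x + s *\<^sub>R e)) has_real_derivative pd i f x) (at 0)"
      using line_derivative[of f x 0 e] df by (simp add: e_def sum_axis)
    then have "((\<lambda>h. (f (x + h *\<^sub>R e) - f x) / h) \<longlongrightarrow> pd i f x) (at 0)"
      by (simp add: has_field_derivative_iff)
    moreover have "filterlim r (at 0) sequentially"
      unfolding filterlim_at r_def using LIMSEQ_inverse_real_of_nat
      by (auto simp: inverse_eq_divide)
    ultimately show ?thesis unfolding q_def by (rule filterlim_compose)
  qed
  have "(\<lambda>n. LBINT x. q n x) \<longlonglongrightarrow> (LBINT x. pd i f x)"
  proof (rule integral_dominated_convergence[where w = "\<lambda>x. M * indicator (cball 0 (R + 1)) x"])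
    show "integrable lborel (\<lambda>x. M * indicator (cball (0 :: real ^ 'n) (R + 1)) x)"
      by (intro integrable_mult_right integrable_real_indicator)
         (use emeasure_bounded_finite[OF bounded_cball] in \<open>auto simp: less_top\<close>)
  qed (use bound lim in \<open>auto simp: q_def\<close>)
  then show ?thesis using q0 LIMSEQ_unique[of "\<lambda>n. 0::real"] by fastforce
qed

lemma integral_pd_eq_0:
  fixes f :: "real ^ 'n \<Rightarrow> real"
  assumes "open \<Omega>" "Ck_on (Suc 0) \<Omega> f" "compact S" "S \<subseteq> \<Omega>" "\<And>x. x \<notin> S \<Longrightarrow> f x = 0"
  shows "(LBINT x. pd i f x) = 0"
  using integral_pd_UNIV[OF Ck_on_extend[OF assms(1) compact_imp_closed[OF assms(3)] assms(4,5,2)] assms(3,5)]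
  by blast

lemma integral_by_parts:
  fixes f g :: "real ^ 'n \<Rightarrow> real"
  assumes \<Omega>: "open \<Omega>" and f: "Ck_on (Suc 0) \<Omega> f" and g: "Ck_on (Suc 0) \<Omega> g"
    and S: "compact S" "S \<subseteq> \<Omega>" "\<And>x. x \<notin> S \<Longrightarrow> g x = 0"
  shows "(LBINT x. pd i f x * g x) = - (LBINT x. f x * pd i g x)"
proof -
  have g0: "pd i g x = 0" if "x \<notin> S" for x
    by (rule pd_eq_0[OF compact_imp_closed[OF S(1)] _ that]) (rule S(3))
  \<comment> \<open>Off \<open>\<Omega>\<close> the factor f need not be differentiable; the
    identity survives since g vanishes on the open complement of S.\<close>
  have "pd i (\<lambda>x. f x * g x) x = f x * pd i g x + pd i f x * g x" for x
  proof (cases "x \<in> \<Omega>")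
    case True
    then show ?thesis using f g by (intro pd_mult) auto
  next
    case False
    then have "x \<notin> S" using S(2) by blast
    then show ?thesis
      using g0 S(3) pd_eq_0[OF compact_imp_closed[OF S(1)], of "\<lambda>x. f x * g x"] by simp
  qed
  moreover have "(LBINT x. pd i (\<lambda>x. f x * g x) x) = 0"
    by (rule integral_pd_eq_0[OF \<Omega> Ck_on_mult[OF \<Omega> f g] S(1,2)]) (simp add: S(3))
  moreover have "continuous_on S f" "continuous_on S g" "continuous_on S (pd i f)" "continuous_on S (pd i g)"
    using f g S(2) Ck_on_continuous Ck_on_subset by (blast, blast, auto intro: continuous_on_subset)
  then have "integrable lborel (\<lambda>x. f x * pd i g x)" "integrable lborel (\<lambda>x. pd i f x * g x)"
    by (auto intro!: integrable_compact_support[OF S(1)] continuous_on_mult simp: S(3) g0)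
  ultimately show ?thesis by simp
qed

section \<open>Convolution with a continuous density of compact support\<close>

definition conv :: "(real ^ 'n \<Rightarrow> real) \<Rightarrow> (real ^ 'n \<Rightarrow> real) \<Rightarrow> real ^ 'n \<Rightarrow> real"
  where "conv K g x = (LBINT y. K (x - y) * g y)"

lemma conv_integrable:
  fixes K g :: "real ^ 'n \<Rightarrow> real"
  assumes "continuous_on UNIV K" "continuous_on UNIV g" "compact S" "\<And>x. x \<notin> S \<Longrightarrow> g x = 0"
  shows "integrable lborel (\<lambda>y. K (x - y) * g y)"
  by (rule integrable_compact_support[OF assms(3)])
     (auto simp: assms(4) intro!: continuous_intros continuous_on_compose2[OF assms(1)]
       continuous_on_subset[OF assms(2)])

text \<open>A fixed compact box, independent of x, is what continuity and differentiation under the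
  integral sign require.\<close>

lemma conv_eq_integral_cbox:
  fixes K g :: "real ^ 'n \<Rightarrow> real"
  assumes "continuous_on UNIV K" "continuous_on UNIV g" "S \<subseteq> cbox a b" "\<And>x. x \<notin> S \<Longrightarrow> g x = 0"
  shows "conv K g x = integral (cbox a b) (\<lambda>y. K (x - y) * g y)"
proof -
  have g0: "g x = 0" if "x \<notin> cbox a b" for x using that assms(3,4) by blast
  have "conv K g x = integral UNIV (\<lambda>y. K (x - y) * g y)"
    unfolding conv_def
    using conv_integrable[OF assms(1,2) compact_cbox g0] by (intro integral_lborel[symmetric])
  also have "\<dots> = integral UNIV (\<lambda>y. if y \<in> cbox a b then K (x - y) * g y else 0)"
    by (intro integral_cong) (use g0 in auto)
  also have "\<dots> = integral (cbox a b) (\<lambda>y. K (x - y) * g y)"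
    by (rule integral_restrict_UNIV)
  finally show ?thesis .
qed

lemma continuous_on_conv:
  fixes K g :: "real ^ 'n \<Rightarrow> real"
  assumes "continuous_on UNIV K" "continuous_on UNIV g" "compact S" "\<And>x. x \<notin> S \<Longrightarrow> g x = 0"
  shows "continuous_on UNIV (conv K g)"
proof -
  obtain a b where ab: "S \<subseteq> cbox a b" using bounded_subset_cbox_symmetric[OF compact_imp_bounded[OF assms(3)]] by metis
  have "continuous_on UNIV (\<lambda>x. integral (cbox a b) (\<lambda>y. K (x - y) * g y))"
    by (rule integral_continuous_on_param)
       (auto simp: case_prod_unfold intro!: continuous_intros continuous_on_compose2[OF assms(1)]
         continuous_on_compose2[OF assms(2)])
  then show ?thesis using conv_eq_integral_cbox[OF assms(1,2) ab assms(4)] by presburger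
qed

lemma conv_has_derivative:
  fixes K g :: "real ^ 'n \<Rightarrow> real"
  assumes K: "Ck_on (Suc 0) UNIV K" and g: "continuous_on UNIV g" "compact S" "\<And>x. x \<notin> S \<Longrightarrow> g x = 0"
  shows "(conv K g has_derivative (\<lambda>v. \<Sum>i\<in>UNIV. v $ i * conv (pd i K) g x)) (at x)"
proof -
  obtain a b where ab: "S \<subseteq> cbox a b"
    using bounded_subset_cbox_symmetric[OF compact_imp_bounded[OF g(2)]] by metis
  have cK: "continuous_on UNIV K" using Ck_on_continuous[OF K] .
  have cp: "continuous_on UNIV (pd i K)" for i using K by simp
  \<comment> \<open>The gradient is packaged as a bounded linear map, the form in which
    \<open>leibniz_rule\<close> takes the derivative.\<close>
  define D where "D z = blinfun_inner_left (grad K z)" for z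
  have cD: "continuous_on UNIV D"
    unfolding D_def grad_def
    by (intro bounded_linear.continuous_on[OF bounded_linear_blinfun_inner_left] continuous_on_vec_lambda cp)
  have D: "blinfun_apply (D z) v = (\<Sum>i\<in>UNIV. v $ i * pd i K z)" for z v
    by (simp add: D_def grad_def inner_vec_def)
  have "((\<lambda>x. integral (cbox a b) (\<lambda>y. K (x - y) * g y)) has_derivative
      integral (cbox a b) (\<lambda>y. g y *\<^sub>R D (x - y))) (at x within UNIV)"
  proof (rule leibniz_rule)
    fix x y
    have "((\<lambda>x. K (x - y)) has_derivative (\<lambda>v. \<Sum>i\<in>UNIV. v $ i * pd i K (x - y))) (at x)"
      by (rule has_derivative_compose[of "\<lambda>x. x - y", OF _ has_derivative_pd])
         (use K in \<open>auto intro!: derivative_eq_intros\<close>)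
    then have "((\<lambda>x. K (x - y) * g y) has_derivative (\<lambda>v. (\<Sum>i\<in>UNIV. v $ i * pd i K (x - y)) * g y)) (at x)"
      by (rule has_derivative_mult_left)
    moreover have "blinfun_apply (g y *\<^sub>R D (x - y)) = (\<lambda>v. (\<Sum>i\<in>UNIV. v $ i * pd i K (x - y)) * g y)"
      by (rule ext) (simp add: D blinfun.scaleR_left mult.commute)
    ultimately show "((\<lambda>x. K (x - y) * g y) has_derivative blinfun_apply (g y *\<^sub>R D (x - y))) (at x within UNIV)"
      by simp
  next
    fix x
    show "(\<lambda>y. K (x - y) * g y) integrable_on cbox a b"
      by (intro integrable_continuous continuous_intros continuous_on_compose2[OF cK]
          continuous_on_subset[OF g(1)]) auto
  next
    show "continuous_on (UNIV \<times> cbox a b) (\<lambda>(x, y). g y *\<^sub>R D (x - y))"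
      by (auto simp: case_prod_unfold intro!: continuous_intros continuous_on_compose2[OF cD]
         continuous_on_compose2[OF g(1)])
  qed auto
  moreover have "blinfun_apply (integral (cbox a b) (\<lambda>y. g y *\<^sub>R D (x - y)))
      = (\<lambda>v. \<Sum>i\<in>UNIV. v $ i * conv (pd i K) g x)"
  proof
    fix v
    have io: "(\<lambda>y. g y *\<^sub>R D (x - y)) integrable_on cbox a b"
      by (intro integrable_continuous continuous_intros continuous_on_compose2[OF cD]
          continuous_on_subset[OF g(1)]) auto
    have ip: "(\<lambda>y. pd i K (x - y) * g y) integrable_on cbox a b" for i
      by (intro integrable_continuous continuous_intros continuous_on_compose2[OF cp]
          continuous_on_subset[OF g(1)]) auto
    have "blinfun_apply (integral (cbox a b) (\<lambda>y. g y *\<^sub>R D (x - y))) v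
        = integral (cbox a b) ((\<lambda>L. blinfun_apply L v) \<circ> (\<lambda>y. g y *\<^sub>R D (x - y)))"
      by (rule integral_linear[OF io, symmetric]) (rule blinfun.bounded_linear_left)
    also have "\<dots> = integral (cbox a b) (\<lambda>y. \<Sum>i\<in>UNIV. v $ i * (pd i K (x - y) * g y))"
      by (rule integral_cong) (simp add: D blinfun.scaleR_left sum_distrib_left mult_ac)
    also have "\<dots> = (\<Sum>i\<in>UNIV. v $ i * integral (cbox a b) (\<lambda>y. pd i K (x - y) * g y))"
      by (subst integral_sum) (auto intro!: integrable_on_mult_right ip simp: integral_mult_right)
    finally show "blinfun_apply (integral (cbox a b) (\<lambda>y. g y *\<^sub>R D (x - y))) v
        = (\<Sum>i\<in>UNIV. v $ i * conv (pd i K) g x)"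
      using conv_eq_integral_cbox[OF cp g(1) ab g(3)] by presburger
  qed
  moreover have "conv K g = (\<lambda>x. integral (cbox a b) (\<lambda>y. K (x - y) * g y))"
    using conv_eq_integral_cbox[OF cK g(1) ab g(3)] by blast
  ultimately show ?thesis by simp
qed

lemma pd_conv:
  fixes K g :: "real ^ 'n \<Rightarrow> real"
  assumes "Ck_on (Suc 0) UNIV K" "continuous_on UNIV g" "compact S" "\<And>x. x \<notin> S \<Longrightarrow> g x = 0"
  shows "pd i (conv K g) = conv (pd i K) g"
proof
  show "pd i (conv K g) x = conv (pd i K) g x" for x
    using pd_eqI[OF conv_has_derivative[OF assms], where i = i and x = x] by (simp add: sum_axis)
qed

lemma Ck_on_conv:
  fixes K g :: "real ^ 'n \<Rightarrow> real"
  assumes "continuous_on UNIV g" "compact S" "\<And>x. x \<notin> S \<Longrightarrow> g x = 0"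
  shows "Ck_on k UNIV K \<Longrightarrow> Ck_on k UNIV (conv K g)"
proof (induction k arbitrary: K)
  case 0
  then show ?case using continuous_on_conv assms by auto
next
  case (Suc k)
  then have K1: "Ck_on (Suc 0) UNIV K" using Ck_on_le by blast
  have "Ck_on k UNIV (pd i (conv K g))" for i
    using Suc pd_conv[OF K1 assms] by simp
  moreover have "conv K g differentiable (at x)" for x
    using conv_has_derivative[OF K1 assms] differentiable_def by blast
  ultimately show ?case by simp
qed

lemma integral_mult_conv:
  fixes a b c :: "real ^ 'n \<Rightarrow> real"
  assumes "continuous_on UNIV a" "continuous_on UNIV b" "continuous_on UNIV c"
    and B: "compact B" "\<And>x. x \<notin> B \<Longrightarrow> b x = 0" and C: "compact C" "\<And>x. x \<notin> C \<Longrightarrow> c x = 0"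
  shows "(LBINT y. a y * conv b c y) = (LBINT x. (LBINT y. a y * b (y - x)) * c x)"
proof -
  \<comment> \<open>The integrand lives where y - x is in B and x in C, that is, on the compact set
    of pairs (v, u + v). This is why \<open>a\<close> may have unbounded support.\<close>
  define S where "S = (\<lambda>(y, x). (x, y)) ` (\<lambda>(u, v). (u + v, v)) ` (B \<times> C)"
  define f where "f x y = a y * b (y - x) * c x" for x y
  have "compact S"
    unfolding S_def using B(1) C(1)
    by (intro compact_continuous_image compact_Times) (auto simp: case_prod_unfold intro!: continuous_intros)
  moreover have "continuous_on S (\<lambda>(x, y). f x y)"
    unfolding f_def
    by (auto simp: case_prod_unfold intro!: continuous_intros continuous_on_compose2[OF assms(1)]
       continuous_on_compose2[OF assms(2)] continuous_on_compose2[OF assms(3)])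
  moreover have "(\<lambda>(x, y). f x y) z = 0" if "z \<notin> S" for z
  proof (cases z)
    case (Pair x y)
    have "\<not> (y - x \<in> B \<and> x \<in> C)"
    proof
      assume "y - x \<in> B \<and> x \<in> C"
      then have "(x, y) \<in> S" unfolding S_def image_image by (rule_tac x = "(y - x, x)" in image_eqI) auto
      then show False using that Pair by simp
    qed
    then show ?thesis using B(2) C(2) Pair by (auto simp: f_def)
  qed
  ultimately have "integrable lborel (\<lambda>(x, y). f x y)"
    by (rule integrable_compact_support)
  then have "integrable (lborel \<Otimes>\<^sub>M lborel) (\<lambda>(x, y). f x y)"
    by (simp add: lborel_prod)
  then have "(LBINT y. (LBINT x. f x y)) = (LBINT x. (LBINT y. f x y))"
    by (rule lborel_pair.Fubini_integral)
  then show ?thesis by (simp add: f_def conv_def mult.assoc flip: integral_mult_left_zero integral_mult_right_zero)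
qed

section \<open>A truncated Newtonian kernel in dimension four\<close>

text \<open>One form covers translation, dilation and reflection; the visible \<open>0 +\<close> in
  later rescaled functions serves to match it.\<close>

lemma pd_affine:
  fixes f :: "real ^ 'n \<Rightarrow> real"
  assumes "f differentiable (at (a + c *\<^sub>R x))"
  shows "(\<lambda>x. f (a + c *\<^sub>R x)) differentiable (at x)"
    and "pd i (\<lambda>x. f (a + c *\<^sub>R x)) x = c * pd i f (a + c *\<^sub>R x)"
proof -
  have "((\<lambda>x. a + c *\<^sub>R x) has_derivative (\<lambda>v. c *\<^sub>R v)) (at x)"
    by (auto intro!: derivative_eq_intros)
  from has_derivative_compose[OF this has_derivative_pd[OF assms]]
  have D: "((\<lambda>x. f (a + c *\<^sub>R x)) has_derivative (\<lambda>v. \<Sum>i\<in>UNIV. (c *\<^sub>R v) $ i * pd i f (a + c *\<^sub>R x))) (at x)" .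
  then show "(\<lambda>x. f (a + c *\<^sub>R x)) differentiable (at x)" by (auto simp: differentiable_def)
  show "pd i (\<lambda>x. f (a + c *\<^sub>R x)) x = c * pd i f (a + c *\<^sub>R x)"
    using pd_eqI[OF D, of i] by (simp add: mult.assoc sum_axis flip: sum_distrib_left)
qed

lemma Ck_on_affine:
  fixes f :: "real ^ 'n \<Rightarrow> real"
  assumes "open S" "\<And>x. x \<in> S \<Longrightarrow> a + c *\<^sub>R x \<in> T"
  shows "Ck_on k T f \<Longrightarrow> Ck_on k S (\<lambda>x. f (a + c *\<^sub>R x))"
proof (induction k arbitrary: f)
  case 0
  then show ?case
    using assms(2) by (auto intro!: continuous_on_compose2[of T f] continuous_intros)
next
  case (Suc k)
  have d: "f differentiable (at (a + c *\<^sub>R x))" if "x \<in> S" for x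
    using Suc.prems assms(2)[OF that] by simp
  have "Ck_on k S (pd i (\<lambda>x. f (a + c *\<^sub>R x)))" for i
    by (subst Ck_on_cong[OF assms(1), where g = "\<lambda>x. c * pd i f (a + c *\<^sub>R x)"])
       (use Suc d in \<open>auto intro!: pd_affine Ck_on_mult[OF assms(1)]\<close>)
  then show ?case using pd_affine(1)[OF d] by simp
qed

lemma laplacian_affine:
  fixes f :: "real ^ 'n \<Rightarrow> real"
  assumes "open T" "Ck_on 2 T f" "a + c *\<^sub>R x \<in> T"
  shows "laplacian (\<lambda>x. f (a + c *\<^sub>R x)) x = c\<^sup>2 * laplacian f (a + c *\<^sub>R x)"
proof -
  define S where "S = (\<lambda>x. a + c *\<^sub>R x) -` T"
  have S: "open S" "x \<in> S"
    using assms(1,3) by (auto simp: S_def intro!: open_vimage continuous_intros)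
  have d: "f differentiable (at y)" "pd i f differentiable (at y)" if "y \<in> T" for y i
    using assms(2) that by (simp_all add: numeral_eq_Suc)
  have "pd i (pd i (\<lambda>x. f (a + c *\<^sub>R x))) x = c\<^sup>2 * pd i (pd i f) (a + c *\<^sub>R x)" for i
  proof -
    have "pd i (pd i (\<lambda>x. f (a + c *\<^sub>R x))) x = pd i (\<lambda>x. c * pd i f (a + c *\<^sub>R x)) x"
      by (rule pd_cong_open[OF S]) (auto simp: S_def intro!: pd_affine d)
    also have "\<dots> = c * pd i (\<lambda>x. pd i f (a + c *\<^sub>R x)) x"
      by (rule pd_cmult, rule pd_affine, rule d, rule assms)
    also have "\<dots> = c\<^sup>2 * pd i (pd i f) (a + c *\<^sub>R x)"
      by (subst pd_affine, rule d, rule assms) (simp add: power2_eq_square)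
    finally show ?thesis .
  qed
  then show ?thesis by (simp add: laplacian_def sum_distrib_left)
qed

text \<open>The set in U where f is nonzero is open by continuity and negligible by the vanishing
  integral, hence empty.\<close>

lemma integral_0_imp_0:
  fixes f :: "'a::euclidean_space \<Rightarrow> real"
  assumes "integrable lborel f" "\<And>x. 0 \<le> f x" "(LBINT x. f x) = 0"
    and "open U" "continuous_on U f" "x \<in> U"
  shows "f x = 0"
proof -
  have "AE x in lborel. f x = 0"
    using integral_nonneg_eq_0_iff_AE[OF assms(1)] assms(2,3) by simp
  then obtain N where N: "{x. f x \<noteq> 0} \<subseteq> N" "N \<in> null_sets lborel"
    by (auto simp: eventually_ae_filter)
  have "negligible N"
    using null_sets_completionI[OF N(2)] by (simp add: negligible_iff_null_sets)
  then have "negligible {x. f x \<noteq> 0}"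
    using N(1) negligible_subset by blast
  then have "negligible (U \<inter> f -` (- {0}))"
    by (rule negligible_subset) auto
  moreover have "open (U \<inter> f -` (- {0}))"
    using assms(4,5) by (simp add: continuous_on_open_vimage open_Compl Int_commute)
  ultimately have "U \<inter> f -` (- {0}) = {}"
    using open_not_negligible by blast
  then show ?thesis using assms(6) by blast
qed

lemma laplacian_cong_open:
  assumes "open S" "x \<in> S" "\<And>y. y \<in> S \<Longrightarrow> f y = g y"
  shows "laplacian f x = laplacian g x"
  unfolding laplacian_def
  by (intro sum.cong refl pd_cong_open[OF assms(1,2)] pd_cong_open[OF assms(1)]) (use assms(3) in auto)

lemma Ck_on_laplacian:
  fixes f :: "real ^ 'n \<Rightarrow> real"
  assumes "open S" "Ck_on (Suc (Suc k)) S f"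
  shows "Ck_on k S (laplacian f)"
proof -
  have "Ck_on k S (\<lambda>x. \<Sum>i\<in>UNIV. pd i (pd i f) x)"
    by (rule Ck_on_sum[OF assms(1)]) (use assms(2) in simp)
  then show ?thesis unfolding laplacian_def .
qed

lemma Ck_on_inner_self [simp]: "Ck_on k S (\<lambda>x :: real ^ 'n. x \<bullet> x)"
proof -
  have "Ck_on k UNIV (\<lambda>x :: real ^ 'n. \<Sum>i\<in>UNIV. x $ i * x $ i)"
    by (intro Ck_on_sum Ck_on_mult) auto
  then show ?thesis by (auto simp: inner_vec_def intro: Ck_on_subset)
qed

lemma differentiable_inner_self: "(\<lambda>x :: real ^ 'n. x \<bullet> x) differentiable (at x)"
  using Ck_on_differentiable[OF Ck_on_inner_self[of 1 UNIV]] by simp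

lemma pd_inner_self: "pd i (\<lambda>x. x \<bullet> x) x = 2 * x $ i"
proof -
  have "((\<lambda>x. x \<bullet> x) has_derivative (\<lambda>v. x \<bullet> v + v \<bullet> x)) (at x)"
    by (auto intro!: derivative_eq_intros)
  from pd_eqI[OF this, of i] show ?thesis
    by (simp add: inner_axis inner_axis')
qed

lemma pd_radial:
  assumes "(F has_real_derivative F') (at (x \<bullet> x))"
  shows "pd i (\<lambda>x. F (x \<bullet> x)) x = 2 * x $ i * F'"
  using pd_chain[OF differentiable_inner_self assms, of i] by (simp add: pd_inner_self)

text \<open>Radial functions are written in t = |x|^2 rather than |x|, which is polynomial in the
  coordinates and smooth at the origin.\<close>

lemma laplacian_radial:
  fixes x :: "real ^ 'n"
  assumes T: "open T" "x \<bullet> x \<in> T"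
    and F: "\<And>t. t \<in> T \<Longrightarrow> (F has_real_derivative F1 t) (at t)"
    and F1: "(F1 has_real_derivative F2) (at (x \<bullet> x))"
  shows "laplacian (\<lambda>x. F (x \<bullet> x)) x = 4 * (x \<bullet> x) * F2 + 2 * real CARD('n) * F1 (x \<bullet> x)"
proof -
  define S where "S = {x :: real ^ 'n. x \<bullet> x \<in> T}"
  have "S = (\<lambda>x. x \<bullet> x) -` T" by (auto simp: S_def)
  then have S: "open S" "x \<in> S"
    using T by (auto intro!: open_vimage continuous_intros)
  have "pd i (pd i (\<lambda>x. F (x \<bullet> x))) x = 4 * (x $ i)\<^sup>2 * F2 + 2 * F1 (x \<bullet> x)" for i
  proof -
    have "pd i (pd i (\<lambda>x. F (x \<bullet> x))) x = pd i (\<lambda>x. 2 * x $ i * F1 (x \<bullet> x)) x"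
      by (rule pd_cong_open[OF S]) (auto simp: S_def intro!: pd_radial F)
    also have "\<dots> = 2 * x $ i * pd i (\<lambda>x. F1 (x \<bullet> x)) x + pd i (\<lambda>x. 2 * x $ i) x * F1 (x \<bullet> x)"
      by (rule pd_mult)
         (use Ck_on_differentiable[OF Ck_on_mult[OF open_UNIV Ck_on_const Ck_on_coord], of 1 x 2 i]
           differentiable_chain_real[OF differentiable_inner_self F1] in auto)
    also have "pd i (\<lambda>x. 2 * x $ i) x = 2"
      by (subst pd_cmult) (use Ck_on_differentiable[OF Ck_on_coord, of 1 x] in \<open>auto simp: pd_coord\<close>)
    also have "pd i (\<lambda>x. F1 (x \<bullet> x)) x = 2 * x $ i * F2"
      by (rule pd_radial[OF F1])
    finally show ?thesis by (simp add: power2_eq_square)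
  qed
  then show ?thesis
    by (simp add: laplacian_def sum.distrib inner_vec_def power2_eq_square flip: sum_distrib_left sum_distrib_right)
qed

text \<open>The inner truncated power starts acting at t = 1, and the outer one reaches zero when (t
  - 1)^5 = 1, at t = 2. Exponent 5 gives class C^4.\<close>

definition plateau :: "real \<Rightarrow> real"
  where "plateau t = pospow 5 (1 - pospow 5 (t - 1))"

lemma plateau_simps: "t \<le> 1 \<Longrightarrow> plateau t = 1" "2 \<le> t \<Longrightarrow> plateau t = 0" "0 \<le> plateau t" "plateau t \<le> 1"
proof -
  show "t \<le> 1 \<Longrightarrow> plateau t = 1" by (simp add: plateau_def pospow_def)
  show "2 \<le> t \<Longrightarrow> plateau t = 0"
  proof -
    assume "2 \<le> t"
    then have "1 \<le> (t - 1) ^ 5" by (intro one_le_power) simp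
    with \<open>2 \<le> t\<close> show ?thesis by (simp add: plateau_def pospow_def)
  qed
  show "0 \<le> plateau t" by (simp add: plateau_def pospow_def)
  show "plateau t \<le> 1"
    unfolding plateau_def pospow_def by (intro power_le_one) (auto simp: max_def)
qed

lemma plateau_antimono: "s \<le> t \<Longrightarrow> plateau t \<le> plateau s"
  unfolding plateau_def pospow_def
  by (intro power_mono max.mono diff_left_mono) auto

lemma Ck_on_plateau:
  fixes f :: "real ^ 'n \<Rightarrow> real"
  assumes "open S" "Ck_on 4 S f"
  shows "Ck_on 4 S (\<lambda>x. plateau (f x))"
  unfolding plateau_def
  by (intro Ck_on_pospow Ck_on_diff Ck_on_const assms) auto

text \<open>Inside the ball of squared radius \<open>e\<close> the fundamental solution \<open>1 / t\<close>, \<open>t = |x|\<^sup>2\<close>, is replaced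
  by its Taylor polynomial of order four at \<open>t = e\<close>: this keeps the kernel \<open>C\<^sup>4\<close> and makes its
  Laplacian explicit.\<close>

definition newton :: "real \<Rightarrow> real ^ 4 \<Rightarrow> real"
  where "newton e x = plateau (16 * (x \<bullet> x)) *
    (if x = 0 then 5 / e else inverse (x \<bullet> x) * (1 - pospow 5 (1 - inverse e * (x \<bullet> x))))"

text \<open>Minus the Laplacian of \<open>newton e\<close> near the origin. With P(t) =
  \<open>pospow 5 (1 - t / e)\<close> and F = (1 - P)/t, the dimension four operator 4tF'' + 8F'
  collapses to -4P'', whence 80 = 4 * 5 * 4.\<close>

definition bump :: "real \<Rightarrow> real ^ 4 \<Rightarrow> real"
  where "bump e x = 80 / e\<^sup>2 * pospow 3 (1 - inverse e * (x \<bullet> x))"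

text \<open>A finite geometric sum, (1 - s^5)/(1 - s) with s = 1 - |x|^2/e, removes the singularity.
  At the origin s = 1 gives the value 5/e prescribed in \<open>newton\<close>.\<close>

lemma newton_inner:
  assumes "0 < e" "x \<bullet> x < e"
  shows "newton e x = plateau (16 * (x \<bullet> x)) * inverse e *
    (1 + (1 - inverse e * (x \<bullet> x)) + (1 - inverse e * (x \<bullet> x))^2 + (1 - inverse e * (x \<bullet> x))^3 + (1 - inverse e * (x \<bullet> x))^4)"
proof (cases "x = 0")
  case True
  then show ?thesis by (simp add: newton_def divide_inverse)
next
  case False
  define t where "t = 1 - inverse e * (x \<bullet> x)"
  have t: "0 < t" using assms by (simp add: t_def field_simps)
  have s: "x \<bullet> x = e * (1 - t)" using assms by (simp add: t_def field_simps)
  have "x \<bullet> x \<noteq> 0" using False by simp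
  then have "1 - t \<noteq> 0" using s by auto
  have "inverse (x \<bullet> x) * (1 - pospow 5 t) = inverse e * (inverse (1 - t) * (1 - t ^ 5))"
    using t by (simp add: s pospow_def max_def)
  also have "1 - t ^ 5 = (1 - t) * (1 + t + t^2 + t^3 + t^4)"
    by (simp add: algebra_simps power_numeral_reduce)
  finally show ?thesis using False \<open>1 - t \<noteq> 0\<close> unfolding newton_def t_def[symmetric] by simp
qed

text \<open>Two overlapping descriptions are glued: the polynomial one inside squared radius e, and
  the one with the inverse of |x|^2 away from the origin.\<close>

lemma Ck_on_newton:
  assumes "0 < e"
  shows "Ck_on 4 UNIV (newton e)"
proof -
  define A where "A = {x :: real ^ 4. x \<bullet> x < e}"
  have "open A" unfolding A_def by (intro open_Collect_less continuous_intros)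
  have c: "Ck_on 4 S (\<lambda>x. plateau (16 * (x \<bullet> x)))" if "open S" for S :: "(real ^ 4) set"
    using that by (intro Ck_on_plateau Ck_on_mult) auto
  have "Ck_on 4 A (newton e)"
    by (subst Ck_on_cong[OF \<open>open A\<close> newton_inner[OF assms]])
       (auto simp: A_def[symmetric] \<open>open A\<close> power_numeral_reduce intro!: c Ck_on_mult Ck_on_add Ck_on_diff, simp add: A_def)
  moreover have "Ck_on 4 (- {0}) (newton e)"
  proof (subst Ck_on_cong)
    show "newton e x = plateau (16 * (x \<bullet> x)) * (inverse (x \<bullet> x) * (1 - pospow 5 (1 - inverse e * (x \<bullet> x))))"
      if "x \<in> - {0}" for x using that by (simp add: newton_def)
    show "Ck_on 4 (- {0}) (\<lambda>x :: real ^ 4. plateau (16 * (x \<bullet> x)) * (inverse (x \<bullet> x) * (1 - pospow 5 (1 - inverse e * (x \<bullet> x)))))"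
      by (intro c Ck_on_mult Ck_on_diff Ck_on_pospow Ck_on_inverse[OF _ _ Ck_on_inner_self] Ck_on_const) auto
  qed auto
  ultimately have "Ck_on 4 (A \<union> - {0}) (newton e)"
    by (intro Ck_on_Un \<open>open A\<close>) auto
  moreover have "A \<union> - {0} = UNIV" using assms by (auto simp: A_def)
  ultimately show ?thesis by simp
qed

lemma continuous_eq_off_0:
  fixes f g :: "real ^ 'n \<Rightarrow> real"
  assumes "continuous_on UNIV f" "continuous_on UNIV g" "0 < r" "\<And>x. x \<noteq> 0 \<Longrightarrow> x \<bullet> x < r \<Longrightarrow> f x = g x"
  shows "f 0 = g 0"
proof -
  have "(f \<longlongrightarrow> f 0) (at 0)" "(g \<longlongrightarrow> g 0) (at 0)"
    using assms(1,2) by (auto simp: continuous_on_eq_continuous_at isCont_def)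
  moreover have "\<forall>\<^sub>F x in at 0. f x = g x"
  proof -
    have "open {x :: real ^ 'n. x \<bullet> x < r}" by (intro open_Collect_less continuous_intros)
    then have "\<forall>\<^sub>F x in at 0. x \<in> {x :: real ^ 'n. x \<bullet> x < r}"
      using assms(3) by (intro eventually_at_in_open') auto
    moreover have "\<forall>\<^sub>F x :: real ^ 'n in at 0. x \<noteq> 0" by (simp add: eventually_at_filter)
    ultimately show ?thesis by eventually_elim (use assms(4) in auto)
  qed
  ultimately have "(g \<longlongrightarrow> f 0) (at 0)" using Lim_transform_eventually by blast
  then show ?thesis using \<open>(g \<longlongrightarrow> g 0) (at 0)\<close> tendsto_unique[OF at_neq_bot] by blast
qed

lemma continuous_on_bump: "continuous_on UNIV (bump e)"
proof -
  have "Ck_on 1 UNIV (\<lambda>x :: real ^ 4. 80 / e\<^sup>2 * pospow 3 (1 - inverse e * (x \<bullet> x)))"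
    by (intro Ck_on_mult Ck_on_pospow Ck_on_diff) auto
  then show ?thesis unfolding bump_def by (rule Ck_on_continuous)
qed

lemma laplacian_newton_inner:
  assumes "0 < e" "x \<bullet> x < 1 / 16"
  shows "laplacian (newton e) x = - bump e x"
proof -
  have neq: "laplacian (newton e) x = - bump e x" if x: "x \<noteq> 0" "x \<bullet> x < 1 / 16" for x
  proof -
    define S where "S = {x :: real ^ 4. x \<noteq> 0 \<and> x \<bullet> x < 1 / 16}"
    have S: "open S" "x \<in> S"
      using x unfolding S_def by (auto intro!: open_Collect_conj open_Collect_neq open_Collect_less continuous_intros)
    define F where "F t = inverse t * (1 - pospow 5 (1 - inverse e * t))" for t
    define F1 where "F1 t = inverse t * (5 * inverse e * pospow 4 (1 - inverse e * t))
      - inverse t ^ 2 * (1 - pospow 5 (1 - inverse e * t))" for t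
    have P: "((\<lambda>t. pospow (Suc (Suc m)) (1 - inverse e * t)) has_real_derivative
        - inverse e * (real (Suc (Suc m)) * pospow (Suc m) (1 - inverse e * t))) (at t)" for m t
      by (rule DERIV_chain2[OF pospow_deriv, THEN DERIV_cong]) (auto intro!: derivative_eq_intros)
    have P5: "((\<lambda>t. pospow 5 (1 - inverse e * t)) has_real_derivative
        - inverse e * (5 * pospow 4 (1 - inverse e * t))) (at t)" for t
      using P[of 3] by (simp add: numeral_eq_Suc)
    have P4: "((\<lambda>t. pospow 4 (1 - inverse e * t)) has_real_derivative
        - inverse e * (4 * pospow 3 (1 - inverse e * t))) (at t)" for t
      using P[of 2] by (simp add: numeral_eq_Suc)
    have "laplacian (newton e) x = laplacian (\<lambda>x. F (x \<bullet> x)) x"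
      by (rule laplacian_cong_open[OF S]) (auto simp: S_def newton_def F_def plateau_simps)
    also have "\<dots> = 4 * (x \<bullet> x) * (inverse (x \<bullet> x) * (- 20 * inverse e ^ 2 * pospow 3 (1 - inverse e * (x \<bullet> x)))
        - 2 * inverse (x \<bullet> x) ^ 2 * (5 * inverse e * pospow 4 (1 - inverse e * (x \<bullet> x)))
        + 2 * inverse (x \<bullet> x) ^ 3 * (1 - pospow 5 (1 - inverse e * (x \<bullet> x)))) + 2 * real CARD(4) * F1 (x \<bullet> x)"
    proof (rule laplacian_radial[of "{0<..}"])
      fix t :: real assume "t \<in> {0<..}"
      then show "(F has_real_derivative F1 t) (at t)"
        unfolding F_def F1_def
        by (auto intro!: derivative_eq_intros P5 simp: power2_eq_square)
    next
      have "x \<bullet> x \<noteq> 0" using x by simp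
      show "(F1 has_real_derivative (inverse (x \<bullet> x) * (- 20 * inverse e ^ 2 * pospow 3 (1 - inverse e * (x \<bullet> x)))
        - 2 * inverse (x \<bullet> x) ^ 2 * (5 * inverse e * pospow 4 (1 - inverse e * (x \<bullet> x)))
        + 2 * inverse (x \<bullet> x) ^ 3 * (1 - pospow 5 (1 - inverse e * (x \<bullet> x))))) (at (x \<bullet> x))"
        unfolding F1_def
        by ((rule derivative_eq_intros P5 P4 refl \<open>x \<bullet> x \<noteq> 0\<close>)+, simp add: algebra_simps power2_eq_square power3_eq_cube)
    qed (use x in auto)
    also have "\<dots> = - bump e x"
      using x assms(1) by (simp add: F1_def bump_def field_simps power2_eq_square power3_eq_cube)
    finally show ?thesis .
  qed
  show ?thesis
  proof (cases "x = 0")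
    case True
    \<comment> \<open>The radial computation uses 1/t and misses the origin; there the identity
      follows from continuity of both sides.\<close>
    have "Ck_on 2 UNIV (laplacian (newton e))"
      by (rule Ck_on_laplacian) (use Ck_on_newton[OF assms(1)] in \<open>simp_all add: numeral_eq_Suc\<close>)
    then have "laplacian (newton e) 0 = - bump e 0"
      using continuous_eq_off_0[of "laplacian (newton e)" "\<lambda>x. - bump e x" "1 / 16"]
      by (simp add: Ck_on_continuous continuous_on_minus continuous_on_bump neq)
    with True show ?thesis by simp
  qed (use neq assms in simp)
qed

lemma bump_eq_0: "0 < e \<Longrightarrow> e \<le> x \<bullet> x \<Longrightarrow> bump e x = 0"
  by (simp add: bump_def pospow_def max_def field_simps)

lemma bump_nonneg: "0 \<le> bump e x"
  by (simp add: bump_def pospow_def)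

text \<open>The part of the Laplacian of \<open>newton e\<close> caused by the cutoff, living where
  1/16 <= |x|^2 <= 1/8. The reference value 1/32 keeps the smoothing at the origin clear of this
  zone, so the function can serve every smaller e.\<close>

definition far :: "real ^ 4 \<Rightarrow> real"
  where "far x = laplacian (newton (1 / 32)) x + bump (1 / 32) x"

text \<open>Once |x|^2 > 1/32 the smoothing at the origin has stopped for both parameters, so the
  two kernels agree there; all dependence on e sits in \<open>bump\<close>.\<close>

lemma laplacian_newton:
  assumes "0 < e" "e \<le> 1 / 32"
  shows "laplacian (newton e) x = far x - bump e x"
proof (cases "x \<bullet> x < 1 / 16")
  case True
  then show ?thesis using laplacian_newton_inner assms by (simp add: far_def)
next
  case False
  define S where "S = {x :: real ^ 4. 1 / 32 < x \<bullet> x}"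
  have S: "open S" "x \<in> S"
    using False unfolding S_def by (auto intro!: open_Collect_less continuous_intros)
  have "laplacian (newton e) x = laplacian (newton (1 / 32)) x"
  proof (rule laplacian_cong_open[OF S])
    fix y assume "y \<in> S"
    then have y: "1 / 32 < y \<bullet> y" by (simp add: S_def)
    then have "1 - inverse e * (y \<bullet> y) \<le> 0" "1 - inverse (1 / 32) * (y \<bullet> y) \<le> 0"
      using assms by (auto simp: field_simps)
    then show "newton e y = newton (1 / 32) y" by (auto simp: newton_def pospow_def max_def)
  qed
  then show ?thesis using False assms by (simp add: far_def bump_eq_0)
qed

lemma newton_eq_0: "1 / 8 \<le> x \<bullet> x \<Longrightarrow> newton e x = 0"
  by (simp add: newton_def plateau_simps)

lemma not_in_half_ball: "x \<notin> cball (0 :: real ^ 4) (1 / 2) \<Longrightarrow> 1 / 4 < x \<bullet> x"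
proof -
  assume "x \<notin> cball (0 :: real ^ 4) (1 / 2)"
  then have "(1 / 2)\<^sup>2 < (norm x)\<^sup>2" by (intro power_strict_mono) auto
  then show ?thesis unfolding power2_norm_eq_inner by (simp add: power_divide)
qed

lemma newton_support: "x \<notin> cball 0 (1 / 2) \<Longrightarrow> newton e x = 0"
  using not_in_half_ball[of x] by (intro newton_eq_0) auto

lemma laplacian_support:
  assumes "closed S" "\<And>x. x \<notin> S \<Longrightarrow> f x = 0" "x \<notin> S"
  shows "laplacian f x = 0"
  unfolding laplacian_def
  by (intro sum.neutral ballI pd_eq_0[OF assms(1) _ assms(3)]) (rule pd_eq_0[OF assms(1,2)])

lemma bump_support: "0 < e \<Longrightarrow> e \<le> 1 / 32 \<Longrightarrow> x \<notin> cball 0 (1 / 2) \<Longrightarrow> bump e x = 0"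
  using not_in_half_ball[of x] by (intro bump_eq_0) auto

lemma far_support: "x \<notin> cball 0 (1 / 2) \<Longrightarrow> far x = 0"
  unfolding far_def
  by (subst laplacian_support[of "cball 0 (1 / 2)"]) (auto simp: newton_support bump_support)

lemma Ck_on_far: "Ck_on 2 UNIV far"
proof -
  have "Ck_on 2 UNIV (\<lambda>x. laplacian (newton (1 / 32)) x + 80 / (1 / 32)\<^sup>2 * pospow 3 (1 - inverse (1 / 32) * (x \<bullet> x)))"
    by (intro Ck_on_add Ck_on_laplacian Ck_on_mult Ck_on_pospow Ck_on_diff)
       (use Ck_on_newton[of "1 / 32"] in \<open>auto simp: numeral_eq_Suc\<close>)
  then show ?thesis unfolding far_def[abs_def] bump_def .
qed

lemma laplacian_even:
  fixes f :: "real ^ 'n \<Rightarrow> real"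
  assumes "Ck_on 2 UNIV f" "\<And>x. f (- x) = f x"
  shows "laplacian f (- x) = laplacian f x"
  using laplacian_affine[OF open_UNIV assms(1), of 0 "- 1" x] assms(2) by simp

text \<open>Evenness lets the convolution with \<open>far\<close> be transferred from the flux to
  the pressure.\<close>

lemma far_even: "far (- x) = far x"
  unfolding far_def
  by (subst laplacian_even) (use Ck_on_le[OF Ck_on_newton] in \<open>auto simp: newton_def bump_def\<close>)

text \<open>The constant c in -Lap(1/|x|^2) = c delta, that is, 4 pi^2 in dimension four.\<close>

definition mass :: real
  where "mass = (LBINT x. far x)"

lemma integrable_far: "integrable lborel far"
  by (rule integrable_compact_support[OF compact_cball[of 0 "1 / 2"] continuous_on_subset[OF Ck_on_continuous[OF Ck_on_far]] far_support]) auto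

lemma integrable_bump: "0 < e \<Longrightarrow> e \<le> 1 / 32 \<Longrightarrow> integrable lborel (bump e)"
  by (rule integrable_compact_support[OF compact_cball[of 0 "1 / 2"] continuous_on_subset[OF continuous_on_bump] bump_support]) auto

lemma integral_laplacian_eq_0:
  fixes f :: "real ^ 'n \<Rightarrow> real"
  assumes "Ck_on 2 UNIV f" "compact S" "\<And>x. x \<notin> S \<Longrightarrow> f x = 0"
  shows "(LBINT x. laplacian f x) = 0"
proof -
  have C1: "Ck_on (Suc 0) UNIV (pd i f)" for i using assms(1) by (simp add: numeral_eq_Suc)
  have 0: "pd i f x = 0" if "x \<notin> S" for x i
    by (rule pd_eq_0[OF compact_imp_closed[OF assms(2)] _ that]) (rule assms(3))
  have 00: "pd i (pd i f) x = 0" if "x \<notin> S" for x i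
    by (rule pd_eq_0[OF compact_imp_closed[OF assms(2)] _ that]) (rule 0)
  have "integrable lborel (pd i (pd i f))" for i
    by (rule integrable_compact_support[OF assms(2) _ 00])
       (use C1 in \<open>auto intro: continuous_on_subset\<close>)
  then have "(LBINT x. laplacian f x) = (\<Sum>i\<in>UNIV. LBINT x. pd i (pd i f) x)"
    unfolding laplacian_def by (intro Bochner_Integration.integral_sum) auto
  also have "\<dots> = 0"
    by (intro sum.neutral ballI integral_pd_UNIV[OF C1 assms(2) 0])
  finally show ?thesis .
qed

text \<open>A compactly supported function has a Laplacian of integral zero, so
  \<open>bump e\<close> and \<open>far\<close> have equal integrals. Divided by \<open>mass\<close>,
  the bumps form an approximate identity.\<close>

lemma integral_bump:
  assumes "0 < e" "e \<le> 1 / 32"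
  shows "(LBINT x. bump e x) = mass"
proof -
  have "(LBINT x. laplacian (newton e) x) = 0"
    by (rule integral_laplacian_eq_0[OF Ck_on_le[OF Ck_on_newton] compact_cball[of 0 "1 / 2"] newton_support]) (use assms in auto)
  then show ?thesis
    unfolding laplacian_newton[OF assms] mass_def using integrable_far integrable_bump[OF assms] by simp
qed

lemma mass_pos: "0 < mass"
proof -
  have "mass \<noteq> 0"
  proof
    assume "mass = 0"
    then have "bump (1 / 32) 0 = 0"
      using integral_bump[of "1 / 32"] integrable_bump[of "1 / 32"] bump_nonneg continuous_on_bump
      by (intro integral_0_imp_0[of "bump (1 / 32)" UNIV]) auto
    then show False by (simp add: bump_def pospow_def)
  qed
  moreover have "0 \<le> mass"
    using integral_bump[of "1 / 32"] bump_nonneg by (metis integral_nonneg_AE AE_I2 divide_pos_pos order_refl zero_less_numeral zero_less_one)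
  ultimately show ?thesis by simp
qed

text \<open>Two integrations by parts move the mixed derivatives onto the pure ones; third
  derivatives appear in between, hence C^3. This is the L^2 case of the Calderon-Zygmund estimate,
  with constant 1.\<close>

lemma integral_hessian:
  fixes h :: "real ^ 'n \<Rightarrow> real"
  assumes h: "Ck_on 3 UNIV h" and S: "compact S" "\<And>x. x \<notin> S \<Longrightarrow> h x = 0"
  shows "(\<Sum>i\<in>UNIV. \<Sum>j\<in>UNIV. LBINT x. (pd i (pd j h) x)\<^sup>2) = (LBINT x. (laplacian h x)\<^sup>2)"
proof -
  have C: "Ck_on 2 UNIV (pd j h)" "Ck_on 1 UNIV (pd i (pd j h))" "Ck_on 2 UNIV h" for i j
    using h Ck_on_Suc_D[of 2 UNIV h] by (simp_all add: numeral_eq_Suc)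
  have 1: "pd j h x = 0" if "x \<notin> S" for x j
    by (rule pd_eq_0[OF compact_imp_closed[OF S(1)] _ that]) (rule S(2))
  have 2: "pd i (pd j h) x = 0" if "x \<notin> S" for x i j
    by (rule pd_eq_0[OF compact_imp_closed[OF S(1)] _ that]) (rule 1)
  have int: "integrable lborel (\<lambda>x. pd i (pd i h) x * pd j (pd j h) x)" for i j
    by (rule integrable_compact_support[OF S(1)])
       (auto simp: 2 intro!: continuous_on_mult continuous_on_subset[OF Ck_on_continuous[OF C(2)]])
  have "(LBINT x. (pd i (pd j h) x)\<^sup>2) = (LBINT x. pd i (pd i h) x * pd j (pd j h) x)" for i j
  proof -
    have c: "pd i (pd j h) = pd j (pd i h)" for i j
      by (rule ext, rule pd_commute[OF open_UNIV]) (use C(3) in \<open>simp_all add: numeral_eq_Suc\<close>)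
    have "pd i (pd i (pd j h)) = pd i (pd j (pd i h))" using c by simp
    also have "\<dots> = pd j (pd i (pd i h))"
      by (rule ext, rule pd_commute[OF open_UNIV]) (use C(1) in \<open>simp_all add: numeral_eq_Suc\<close>)
    finally have com: "pd i (pd i (pd j h)) = pd j (pd i (pd i h))" .
    have "(LBINT x. (pd i (pd j h) x)\<^sup>2) = (LBINT x. pd i (pd j h) x * pd i (pd j h) x)"
      by (simp add: power2_eq_square)
    also have "\<dots> = - (LBINT x. pd j h x * pd i (pd i (pd j h)) x)"
      by (rule integral_by_parts[OF open_UNIV _ _ S(1) subset_UNIV 2])
         (use C Ck_on_Suc_D[of 1 UNIV "pd j h"] in \<open>simp_all add: numeral_eq_Suc\<close>)
    also have "\<dots> = - (LBINT x. pd j h x * pd j (pd i (pd i h)) x)"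
      by (simp add: com)
    also have "\<dots> = (LBINT x. pd j (pd j h) x * pd i (pd i h) x)"
      by (rule integral_by_parts[OF open_UNIV _ _ S(1) subset_UNIV 2, symmetric])
         (use C Ck_on_Suc_D[of 1 UNIV "pd j h"] in \<open>simp_all add: numeral_eq_Suc\<close>)
    finally show ?thesis by (simp add: mult.commute)
  qed
  then have "(\<Sum>i\<in>UNIV. \<Sum>j\<in>UNIV. LBINT x. (pd i (pd j h) x)\<^sup>2)
      = (LBINT x. (\<Sum>i\<in>UNIV. \<Sum>j\<in>UNIV. pd i (pd i h) x * pd j (pd j h) x))"
    using int by (simp add: Bochner_Integration.integral_sum Bochner_Integration.integrable_sum)
  also have "\<dots> = (LBINT x. (laplacian h x)\<^sup>2)"
    by (simp add: laplacian_def power2_eq_square sum_product)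
  finally show ?thesis .
qed

section \<open>The pressure at unit scale\<close>

text \<open>The parameters are squared radii, in keeping with radial functions of |x|^2.\<close>

definition shell :: "real \<Rightarrow> real \<Rightarrow> (real ^ 'n) set"
  where "shell a b = {x. a \<le> x \<bullet> x \<and> x \<bullet> x \<le> b}"

lemma compact_shell [simp]: "compact (shell a b)"
proof -
  have "closed (shell a b)"
    unfolding shell_def by (intro closed_Collect_conj closed_Collect_le continuous_intros)
  moreover have "norm x \<le> sqrt b" if "x \<in> shell a b" for x
    using that by (auto simp: shell_def norm_eq_sqrt_inner)
  then have "bounded (shell a b)" unfolding bounded_iff by blast
  ultimately show ?thesis by (simp add: compact_eq_bounded_closed)
qed

lemma closed_shell [simp]: "closed (shell a b)"
  by (simp add: compact_imp_closed)

lemma integrable_indicator_shell: "integrable lborel (indicator (shell a b :: (real ^ 'n) set) :: _ \<Rightarrow> real)"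
  by (intro integrable_real_indicator)
     (use emeasure_bounded_finite[OF compact_imp_bounded[OF compact_shell]] in \<open>auto simp: less_top\<close>)

lemma shell_subset: "0 < a \<Longrightarrow> shell a b \<subseteq> - {0}"
  by (auto simp: shell_def)

lemma open_punctured [simp]: "open (- {0 :: real ^ 'n})"
  by (simp add: open_Compl)

lemma integrable_shell_quotient:
  fixes W :: "real ^ 'n \<Rightarrow> real"
  assumes "continuous_on (- {0}) W" "0 < a"
  shows "integrable lborel (\<lambda>x. indicator (shell a b) x * (W x / (x \<bullet> x)))"
proof -
  have "continuous_on (shell a b) (\<lambda>x. W x / (x \<bullet> x))"
    using shell_subset[OF assms(2)] by (intro continuous_intros continuous_on_subset[OF assms(1)]) auto
  from borel_integrable_compact[OF compact_shell this] show ?thesis by simp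
qed

lemma not_shellD: "x \<notin> shell a b \<Longrightarrow> x \<bullet> x < a \<or> b < x \<bullet> x"
  by (auto simp: shell_def)

definition eta :: "real ^ 4 \<Rightarrow> real"
  where "eta x = plateau (x \<bullet> x)"

lemma Ck_on_eta: "Ck_on 4 S eta"
proof -
  have "Ck_on 4 UNIV (\<lambda>x :: real ^ 4. plateau (x \<bullet> x))" by (intro Ck_on_plateau) auto
  then show ?thesis unfolding eta_def by (rule Ck_on_subset) simp
qed

lemma eta_simps: "x \<bullet> x \<le> 1 \<Longrightarrow> eta x = 1" "2 \<le> x \<bullet> x \<Longrightarrow> eta x = 0" "0 \<le> eta x" "eta x \<le> 1"
  by (auto simp: eta_def plateau_simps)

lemma eta_locally_const:
  assumes "x \<notin> shell 1 2"
  obtains T c where "open T" "x \<in> T" "\<And>y. y \<in> T \<Longrightarrow> eta y = c" "T \<inter> shell 1 2 = {}"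
proof -
  consider "x \<bullet> x < 1" | "2 < x \<bullet> x" using not_shellD[OF assms] by blast
  then show thesis
  proof cases
    case 1
    show thesis
      by (rule that[of "{x. x \<bullet> x < 1}" 1])
         (use 1 in \<open>auto simp: eta_simps shell_def intro!: open_Collect_less continuous_intros\<close>)
  next
    case 2
    show thesis
      by (rule that[of "{x. 2 < x \<bullet> x}" 0])
         (use 2 in \<open>auto simp: eta_simps shell_def intro!: open_Collect_less continuous_intros\<close>)
  qed
qed

lemma pd_eta_eq_0: "x \<notin> shell 1 2 \<Longrightarrow> pd i eta x = 0"
  by (erule eta_locally_const, subst pd_cong_open[where g = "\<lambda>_. c" for c]) auto

lemma laplacian_const [simp]: "laplacian (\<lambda>_ :: real ^ 'n. c :: real) x = 0"
proof -
  have "pd i (\<lambda>_. c) = (\<lambda>_ :: real ^ 'n. 0)" for i by (rule ext) simp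
  then show ?thesis by (simp add: laplacian_def)
qed

lemma laplacian_eta_eq_0: "x \<notin> shell 1 2 \<Longrightarrow> laplacian eta x = 0"
  by (erule eta_locally_const, subst laplacian_cong_open[where g = "\<lambda>_. c" for c]) auto

lemma eta_bounded:
  obtains E where "0 < E" "\<And>i x. \<bar>pd i eta x\<bar> \<le> E" "\<And>x. \<bar>laplacian eta x\<bar> \<le> E"
proof -
  have "continuous_on (shell 1 2) (\<lambda>x. \<bar>laplacian eta x\<bar> + (\<Sum>i\<in>UNIV. \<bar>pd i eta x\<bar>))"
  proof -
    have "Ck_on (Suc (Suc 2)) UNIV eta" using Ck_on_eta by simp
    then have "continuous_on UNIV (laplacian eta)" "continuous_on UNIV (pd i eta)" for i
      using Ck_on_laplacian[OF open_UNIV] Ck_on_pd Ck_on_continuous by blast+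
    then show ?thesis
      by (intro continuous_on_add continuous_on_sum continuous_on_rabs) (blast intro: continuous_on_subset)+
  qed
  from bounded_outside_compact[OF compact_shell this]
  obtain M where M: "0 < M" "\<And>x. \<bar>\<bar>laplacian eta x\<bar> + (\<Sum>i\<in>UNIV. \<bar>pd i eta x\<bar>)\<bar> \<le> M"
    by (auto simp: pd_eta_eq_0 laplacian_eta_eq_0)
  have "\<bar>pd i eta x\<bar> \<le> (\<Sum>i\<in>UNIV. \<bar>pd i eta x\<bar>)" for i x
    by (rule member_le_sum) auto
  moreover have "0 \<le> (\<Sum>i\<in>UNIV. \<bar>pd i eta x\<bar>)" for x by (simp add: sum_nonneg)
  moreover have "\<bar>laplacian eta x\<bar> + (\<Sum>i\<in>UNIV. \<bar>pd i eta x\<bar>) \<le> M" for x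
    using M(2)[of x] by linarith
  ultimately show thesis
    using M(1) by (intro that[of M]) (meson add_increasing add_increasing2 abs_ge_zero order_trans order_refl)+
qed

text \<open>The rational bound 3/2 for sqrt 2 fits the kernel radius 1/2: convolving something on
  this shell gives support in 1/2 <= |x| <= 2, which is \<open>shell (1 / 4) 4\<close>.\<close>

lemma shell_1_2_norm: "x \<in> shell 1 2 \<Longrightarrow> 1 \<le> norm x \<and> norm x \<le> 3 / 2"
proof -
  assume "x \<in> shell 1 2"
  then have "1\<^sup>2 \<le> (norm x)\<^sup>2" "(norm x)\<^sup>2 \<le> (3 / 2)\<^sup>2"
    by (auto simp: shell_def power2_norm_eq_inner power2_eq_square[of "3/2 :: real"])
  then show ?thesis by (auto intro: power2_le_imp_le)
qed

lemma shell_memI: "1 / 2 \<le> norm x \<Longrightarrow> norm x \<le> 2 \<Longrightarrow> x \<in> shell (1 / 4) 4"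
  using power_mono[of "1 / 2" "norm x" 2] power_mono[of "norm x" 2 2]
  by (simp add: shell_def power2_norm_eq_inner power_divide)

lemma shell_bounds: "x \<in> shell (a\<^sup>2) b \<Longrightarrow> 0 \<le> a \<Longrightarrow> a \<le> norm x"
  by (rule power2_le_imp_le) (simp_all add: shell_def power2_norm_eq_inner)

section \<open>Support, Laplacian and size of convolutions\<close>

lemma conv_eq_0:
  assumes "\<And>z. r < norm z \<Longrightarrow> K z = 0" "\<And>y. g y \<noteq> 0 \<Longrightarrow> r < norm (x - y)"
  shows "conv K g x = 0"
proof -
  have "K (x - y) * g y = 0" for y using assms by (cases "g y = 0") auto
  then show ?thesis unfolding conv_def by (simp only:) simp
qed

lemma conv_diff:
  fixes K L g :: "real ^ 'n \<Rightarrow> real"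
  assumes "continuous_on UNIV K" "continuous_on UNIV L" "continuous_on UNIV g" "compact S" "\<And>x. x \<notin> S \<Longrightarrow> g x = 0"
  shows "conv (\<lambda>x. K x - L x) g x = conv K g x - conv L g x"
  using conv_integrable[OF assms(1,3-5)] conv_integrable[OF assms(2,3-5)]
  by (simp add: conv_def left_diff_distrib)

lemma laplacian_conv:
  fixes K g :: "real ^ 'n \<Rightarrow> real"
  assumes "Ck_on 2 UNIV K" "continuous_on UNIV g" "compact S" "\<And>x. x \<notin> S \<Longrightarrow> g x = 0"
  shows "laplacian (conv K g) x = conv (laplacian K) g x"
proof -
  have "Ck_on (Suc 0) UNIV K" "Ck_on (Suc 0) UNIV (pd i K)" for i
    using assms(1) Ck_on_le[of 2 UNIV K "Suc 0"] by (simp_all add: numeral_eq_Suc)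
  then have *: "pd i (pd i (conv K g)) x = conv (pd i (pd i K)) g x" for i
    using pd_conv[OF _ assms(2-4)] by metis
  have "continuous_on UNIV (pd i (pd i K))" for i using assms(1) by (simp add: numeral_eq_Suc)
  then have "integrable lborel (\<lambda>y. pd i (pd i K) (x - y) * g y)" for i
    by (rule conv_integrable[OF _ assms(2-4)])
  then have "(\<Sum>i\<in>UNIV. conv (pd i (pd i K)) g x) = conv (laplacian K) g x"
    unfolding conv_def laplacian_def sum_distrib_right by (intro Bochner_Integration.integral_sum[symmetric]) auto
  with * show ?thesis by (simp add: laplacian_def)
qed

lemma abs_conv_le:
  fixes K g :: "real ^ 'n \<Rightarrow> real"
  assumes "continuous_on UNIV K" "continuous_on UNIV g" "compact S" "\<And>x. x \<notin> S \<Longrightarrow> g x = 0"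
  shows "\<bar>conv K g x\<bar> \<le> conv (\<lambda>x. \<bar>K x\<bar>) (\<lambda>x. \<bar>g x\<bar>) x"
  unfolding conv_def by (rule order_trans[OF integral_abs_bound]) (simp add: abs_mult)

text \<open>Young's inequality, with the \<open>L\<^sup>2\<close> norm interpolated between \<open>L\<^sup>1\<close> and \<open>L\<^sup>\<infinity>\<close>.\<close>

lemma conv_square_bound:
  fixes K g :: "real ^ 'n \<Rightarrow> real"
  assumes K: "continuous_on UNIV K" "compact B" "\<And>x. x \<notin> B \<Longrightarrow> K x = 0"
    and g: "continuous_on UNIV g" "compact S" "\<And>x. x \<notin> S \<Longrightarrow> g x = 0" and G: "\<And>x. \<bar>g x\<bar> \<le> G"
    and sq: "compact T" "\<And>x. x \<notin> T \<Longrightarrow> conv K g x = 0"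
  shows "(LBINT x. (conv K g x)\<^sup>2) \<le> G * (LBINT x. \<bar>K x\<bar>)\<^sup>2 * (LBINT x. \<bar>g x\<bar>)"
proof -
  let ?K = "\<lambda>x. \<bar>K x\<bar>" and ?g = "\<lambda>x. \<bar>g x\<bar>"
  let ?L = "LBINT x. \<bar>K x\<bar>"
  have cK: "continuous_on UNIV ?K" and cg: "continuous_on UNIV ?g"
    using K(1) g(1) by (auto intro: continuous_intros)
  have iK: "integrable lborel K"
    by (rule integrable_compact_support[OF K(2) continuous_on_subset[OF K(1)] K(3)]) auto
  have cc: "continuous_on UNIV (conv K g)" by (rule continuous_on_conv[OF K(1) g])
  have G0: "0 \<le> G" using G[of 0] by linarith
  have L0: "0 \<le> ?L" by simp
  have iKx: "integrable lborel (\<lambda>y. \<bar>K (x - y)\<bar>)" for x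
    using lborel_integrable_affine[OF iK, of "-1" x] by (simp add: integrable_abs)
  have sup: "\<bar>conv K g x\<bar> \<le> G * ?L" for x
  proof -
    have "\<bar>conv K g x\<bar> \<le> (LBINT y. \<bar>K (x - y)\<bar> * \<bar>g y\<bar>)"
      using abs_conv_le[OF K(1) g] by (simp add: conv_def)
    also have "\<dots> \<le> (LBINT y. \<bar>K (x - y)\<bar> * G)"
      by (intro integral_mono conv_integrable[OF cK cg g(2)] integrable_mult_left iKx mult_left_mono G)
         (auto simp: g(3))
    also have "\<dots> = ?L * G"
      using lborel_integral_reflect[of ?K x] K(1) cK by (simp add: borel_measurable_continuous_onI)
    finally show ?thesis by (simp add: mult.commute)
  qed
  have icc: "integrable lborel (\<lambda>x. \<bar>conv K g x\<bar>)" "integrable lborel (\<lambda>x. (conv K g x)\<^sup>2)"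
    by (rule integrable_compact_support[OF sq(1)]; use sq(2) cc in \<open>auto intro!: continuous_intros intro: continuous_on_subset\<close>)+
  have "integrable lborel (\<lambda>x. indicator T x *\<^sub>R conv ?K ?g x)"
    by (intro borel_integrable_compact sq(1) continuous_on_subset[OF continuous_on_conv[OF cK cg g(2)]])
       (auto simp: g(3))
  then have iT: "integrable lborel (\<lambda>x. 1 * conv ?K ?g x * indicator T x)"
    by (simp add: mult.commute)
  \<comment> \<open>The factor 1 is the test function \<open>a\<close> of
    \<open>integral_mult_conv\<close>. The indicator reflects that \<open>conv K g\<close> vanishes
    off T while its majorant need not.\<close>
  have "(LBINT x. \<bar>conv K g x\<bar>) \<le> (LBINT x. 1 * conv ?K ?g x * indicator T x)"
  proof (rule integral_mono[OF icc(1) iT])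
    show "\<bar>conv K g x\<bar> \<le> 1 * conv ?K ?g x * indicator T x" for x
      using abs_conv_le[OF K(1) g, of x] sq(2)[of x] by (cases "x \<in> T") auto
  qed
  also have "\<dots> \<le> (LBINT x. 1 * conv ?K ?g x)"
  proof (rule integral_mono[OF iT])
    define S' where "S' = (\<lambda>(u, v). u + v) ` (B \<times> S)"
    have "compact S'" unfolding S'_def
      by (intro compact_continuous_image compact_Times K g) (auto simp: case_prod_unfold intro!: continuous_intros)
    moreover have "conv ?K ?g x = 0" if "x \<notin> S'" for x
    proof -
      have "\<bar>K (x - y)\<bar> * \<bar>g y\<bar> = 0" for y
      proof (rule ccontr)
        assume "\<bar>K (x - y)\<bar> * \<bar>g y\<bar> \<noteq> 0"
        then have "x - y \<in> B" "y \<in> S" using K(3) g(3) by force+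
        then have "x \<in> S'" unfolding S'_def by (rule_tac x = "(x - y, y)" in image_eqI) auto
        then show False using that by simp
      qed
      then show ?thesis unfolding conv_def by (simp only:) simp
    qed
    ultimately have "integrable lborel (conv ?K ?g)"
      by (intro integrable_compact_support[of S'] continuous_on_subset[OF continuous_on_conv[OF cK cg g(2)]])
         (auto simp: g(3))
    then show "integrable lborel (\<lambda>x. 1 * conv ?K ?g x)" by simp
    show "1 * conv ?K ?g x * indicator T x \<le> 1 * conv ?K ?g x" for x
      using abs_conv_le[OF K(1) g, of x] by (auto simp: indicator_def)
  qed
  also have "\<dots> = (LBINT x. (LBINT y. 1 * \<bar>K (y - x)\<bar>) * \<bar>g x\<bar>)"
    by (rule integral_mult_conv[OF _ cK cg K(2) _ g(2)]) (auto simp: K(3) g(3))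
  also have "\<dots> = ?L * (LBINT x. \<bar>g x\<bar>)"
    using lborel_integral_translate[of ?K "- x" for x] cK
    by (simp add: borel_measurable_continuous_onI)
  finally have L1: "(LBINT x. \<bar>conv K g x\<bar>) \<le> ?L * (LBINT x. \<bar>g x\<bar>)" .
  have "(LBINT x. (conv K g x)\<^sup>2) \<le> (LBINT x. G * ?L * \<bar>conv K g x\<bar>)"
  proof (intro integral_mono icc integrable_mult_right)
    show "(conv K g x)\<^sup>2 \<le> G * ?L * \<bar>conv K g x\<bar>" for x
      using mult_right_mono[OF sup[of x] abs_ge_zero[of "conv K g x"]] by (simp add: power2_eq_square)
  qed
  also have "\<dots> = G * ?L * (LBINT x. \<bar>conv K g x\<bar>)" by simp
  also have "\<dots> \<le> G * ?L * (?L * (LBINT x. \<bar>g x\<bar>))"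
    by (intro mult_left_mono L1 mult_nonneg_nonneg G0 L0)
  finally show ?thesis by (simp add: power2_eq_square mult_ac)
qed

text \<open>A linear Stokes system whose force is the divergence of S; later S is u (x) u plus the
  director stress. Both bounds are invariant under the natural scaling, and the pressure is known
  only through its gradient.\<close>

locale stokes_field =
  fixes C :: real and U :: "4 \<Rightarrow> real ^ 4 \<Rightarrow> real" and S :: "4 \<Rightarrow> 4 \<Rightarrow> real ^ 4 \<Rightarrow> real" and p :: "real ^ 4 \<Rightarrow> real"
  assumes smooth_U: "smooth_on (- {0}) (U i)"
    and smooth_S: "smooth_on (- {0}) (S i j)"
    and smooth_p: "smooth_on (- {0}) p"
    and U_le: "x \<noteq> 0 \<Longrightarrow> \<bar>U i x\<bar> \<le> C / norm x"
    and S_le: "x \<noteq> 0 \<Longrightarrow> \<bar>S i j x\<bar> \<le> C / (norm x)\<^sup>2"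
    and div_U: "x \<noteq> 0 \<Longrightarrow> (\<Sum>i\<in>UNIV. pd i (U i) x) = 0"
    and pd_p: "x \<noteq> 0 \<Longrightarrow> pd i p x = laplacian (U i) x - (\<Sum>j\<in>UNIV. pd j (S i j) x)"
begin

lemma Ck_U: "Ck_on k (- {0}) (U i)" and Ck_S: "Ck_on k (- {0}) (S i j)" and Ck_p: "Ck_on k (- {0}) p"
  using smooth_U smooth_S smooth_p by (auto simp: smooth_on_def)

lemma C_nonneg: "0 \<le> C"
proof -
  have "0 \<le> C / norm (axis 1 1 :: real ^ 4)"
    by (rule order_trans[OF abs_ge_zero U_le]) (simp add: axis_eq_0_iff)
  then show ?thesis by simp
qed

lemma weak_div_free:
  assumes "Ck_on 1 (- {0}) \<psi>" "compact T" "T \<subseteq> - {0}" "\<And>x. x \<notin> T \<Longrightarrow> \<psi> x = 0"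
  shows "(\<Sum>i\<in>UNIV. LBINT x. U i x * pd i \<psi> x) = 0"
proof -
  have \<psi>: "Ck_on (Suc 0) (- {0}) \<psi>" using assms(1) by simp
  have int: "integrable lborel (\<lambda>x. pd i (U i) x * \<psi> x)" for i
    by (rule integrable_compact_support[OF assms(2)])
       (use Ck_U[of 1 i] Ck_on_continuous[OF \<psi>] assms(3,4) in \<open>auto intro!: continuous_on_mult intro: continuous_on_subset\<close>)
  have "(\<Sum>i\<in>UNIV. LBINT x. U i x * pd i \<psi> x) = (\<Sum>i\<in>UNIV. - (LBINT x. pd i (U i) x * \<psi> x))"
    by (intro sum.cong refl) (simp add: integral_by_parts[OF open_punctured Ck_U \<psi> assms(2-4)])
  also have "\<dots> = - (LBINT x. (\<Sum>i\<in>UNIV. pd i (U i) x * \<psi> x))"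
    by (subst Bochner_Integration.integral_sum) (auto simp: sum_negf int)
  finally have eq: "(\<Sum>i\<in>UNIV. LBINT x. U i x * pd i \<psi> x) = - (LBINT x. (\<Sum>i\<in>UNIV. pd i (U i) x * \<psi> x))" .
  have "(\<Sum>i\<in>UNIV. pd i (U i) x * \<psi> x) = 0" for x
  proof (cases "x \<in> T")
    case True
    then show ?thesis using div_U[of x] assms(3) by (auto simp flip: sum_distrib_right)
  qed (simp add: assms(4))
  with eq show ?thesis by simp
qed

text \<open>All derivatives go onto the test function, because only pointwise bounds of U and S are
  at hand.\<close>

lemma weak_pressure:
  assumes "Ck_on 2 (- {0}) \<psi>" "compact T" "T \<subseteq> - {0}" "\<And>x. x \<notin> T \<Longrightarrow> \<psi> x = 0"
  shows "(LBINT x. p x * pd k \<psi> x)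
    = - (LBINT x. U k x * laplacian \<psi> x) - (\<Sum>j\<in>UNIV. LBINT x. S k j x * pd j \<psi> x)"
proof -
  have \<psi>: "Ck_on (Suc 0) (- {0}) \<psi>" "Ck_on (Suc 0) (- {0}) (pd j \<psi>)" for j
    using assms(1) Ck_on_le[of 2 _ \<psi> "Suc 0"] by (simp_all add: numeral_eq_Suc)
  have \<psi>0: "pd j \<psi> x = 0" if "x \<notin> T" for x j
    by (rule pd_eq_0[OF compact_imp_closed[OF assms(2)] _ that]) (rule assms(4))
  have \<psi>00: "pd j (pd j \<psi>) x = 0" if "x \<notin> T" for x j
    by (rule pd_eq_0[OF compact_imp_closed[OF assms(2)] _ that]) (rule \<psi>0)
  have U1: "Ck_on (Suc 0) (- {0}) (pd j (U k))" for j
    using Ck_U[of 2 k] by (simp add: numeral_eq_Suc)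
  have cont: "continuous_on T \<psi>" "continuous_on T (pd j (pd j (U k)))" "continuous_on T (pd j (S k j))"
    "continuous_on T (U k)" "continuous_on T (pd j (pd j \<psi>))" for j
    by (rule continuous_on_subset[OF _ assms(3)], rule Ck_on_continuous[where k = 0],
        use \<psi> U1 Ck_S[of 1 k j] Ck_U[of 0 k] Ck_on_continuous[OF \<psi>(1)] in auto)+
  have i1: "integrable lborel (\<lambda>x. pd j (pd j (U k)) x * \<psi> x)" "integrable lborel (\<lambda>x. pd j (S k j) x * \<psi> x)"
     "integrable lborel (\<lambda>x. U k x * pd j (pd j \<psi>) x)" for j
    by (auto intro!: integrable_compact_support[OF assms(2)] continuous_on_mult cont simp: assms(4) \<psi>00)
  have lapU: "(LBINT x. pd j (pd j (U k)) x * \<psi> x) = (LBINT x. U k x * pd j (pd j \<psi>) x)" for j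
    using integral_by_parts[OF open_punctured U1 \<psi>(1) assms(2-4)]
      integral_by_parts[OF open_punctured Ck_U \<psi>(2) assms(2,3) \<psi>0] by simp
  have "(LBINT x. p x * pd k \<psi> x) = - (LBINT x. pd k p x * \<psi> x)"
    by (simp add: integral_by_parts[OF open_punctured Ck_p \<psi>(1) assms(2-4)])
  also have "(\<lambda>x. pd k p x * \<psi> x)
      = (\<lambda>x. (\<Sum>j\<in>UNIV. pd j (pd j (U k)) x * \<psi> x) - (\<Sum>j\<in>UNIV. pd j (S k j) x * \<psi> x))"
  proof
    fix x
    show "pd k p x * \<psi> x = (\<Sum>j\<in>UNIV. pd j (pd j (U k)) x * \<psi> x) - (\<Sum>j\<in>UNIV. pd j (S k j) x * \<psi> x)"
    proof (cases "x \<in> T")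
      case True
      then have "x \<noteq> 0" using assms(3) by auto
      then show ?thesis by (simp add: pd_p laplacian_def left_diff_distrib sum_distrib_right)
    qed (simp add: assms(4))
  qed
  also have "(LBINT x. (\<Sum>j\<in>UNIV. pd j (pd j (U k)) x * \<psi> x) - (\<Sum>j\<in>UNIV. pd j (S k j) x * \<psi> x))
      = (\<Sum>j\<in>UNIV. LBINT x. pd j (pd j (U k)) x * \<psi> x) - (\<Sum>j\<in>UNIV. LBINT x. pd j (S k j) x * \<psi> x)"
    using i1 by (simp add: Bochner_Integration.integral_sum)
  also have "(\<Sum>j\<in>UNIV. LBINT x. pd j (pd j (U k)) x * \<psi> x) = (LBINT x. U k x * laplacian \<psi> x)"
    unfolding lapU laplacian_def sum_distrib_left using i1 by (simp add: Bochner_Integration.integral_sum)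
  also have "(\<Sum>j\<in>UNIV. LBINT x. pd j (S k j) x * \<psi> x) = (\<Sum>j\<in>UNIV. - (LBINT x. S k j x * pd j \<psi> x))"
    by (intro sum.cong refl integral_by_parts[OF open_punctured Ck_S \<psi>(1) assms(2-4)])
  finally show ?thesis by (simp add: sum_negf)
qed

text \<open>The viscous term disappears when the equation is tested with a gradient.\<close>

lemma weak_pressure_laplacian:
  assumes h: "Ck_on 3 UNIV h" and T: "compact T" "T \<subseteq> - {0}" "\<And>x. x \<notin> T \<Longrightarrow> h x = 0"
  shows "(LBINT x. p x * laplacian h x) = - (\<Sum>k\<in>UNIV. \<Sum>j\<in>UNIV. LBINT x. S k j x * pd j (pd k h) x)"
proof -
  have C: "Ck_on 2 UNIV (pd k h)" "Ck_on 2 UNIV h" "Ck_on 1 UNIV (laplacian h)" for k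
    using h Ck_on_Suc_D[of 2 UNIV h] Ck_on_laplacian[OF open_UNIV, of 1 h] by (simp_all add: numeral_eq_Suc)
  have 1: "pd k h x = 0" if "x \<notin> T" for x k
    by (rule pd_eq_0[OF compact_imp_closed[OF T(1)] _ that]) (rule T(3))
  have 2: "pd k (pd k h) x = 0" if "x \<notin> T" for x k
    by (rule pd_eq_0[OF compact_imp_closed[OF T(1)] _ that]) (rule 1)
  have lap0: "laplacian h x = 0" if "x \<notin> T" for x
    using 2[OF that] by (simp add: laplacian_def)
  have com: "laplacian (pd k h) x = pd k (laplacian h) x" for k x
  proof -
    have c: "pd i (pd j h) = pd j (pd i h)" for i j
      by (rule ext, rule pd_commute[OF open_UNIV]) (use C(2) in \<open>simp_all add: numeral_eq_Suc\<close>)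
    have "pd i (pd i (pd k h)) x = pd k (pd i (pd i h)) x" for i
      unfolding c[of i k] by (rule pd_commute[OF open_UNIV]) (use C(1) in \<open>simp_all add: numeral_eq_Suc\<close>)
    moreover have "pd i (pd i h) differentiable (at x)" for i
      using h by (simp add: numeral_eq_Suc)
    ultimately show ?thesis unfolding laplacian_def[abs_def] by (simp add: pd_sum)
  qed
  have int: "integrable lborel (\<lambda>x. p x * pd k (pd k h) x)" for k
    by (rule integrable_compact_support[OF T(1)])
       (use Ck_on_continuous[OF Ck_on_pd[of 1 UNIV "pd k h" k]] C(1)[of k] Ck_on_continuous[OF Ck_p] T(2) 2
         in \<open>auto intro!: continuous_on_mult intro: continuous_on_subset simp: numeral_eq_Suc\<close>)
  have "(LBINT x. p x * laplacian h x) = (\<Sum>k\<in>UNIV. LBINT x. p x * pd k (pd k h) x)"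
    unfolding laplacian_def sum_distrib_left using int by (simp add: Bochner_Integration.integral_sum)
  also have "\<dots> = (\<Sum>k\<in>UNIV. - (LBINT x. U k x * laplacian (pd k h) x)
      - (\<Sum>j\<in>UNIV. LBINT x. S k j x * pd j (pd k h) x))"
    by (intro sum.cong refl weak_pressure[OF Ck_on_subset[OF C(1)] T(1,2) 1]) auto
  also have "\<dots> = - (\<Sum>k\<in>UNIV. LBINT x. U k x * pd k (laplacian h) x)
      - (\<Sum>k\<in>UNIV. \<Sum>j\<in>UNIV. LBINT x. S k j x * pd j (pd k h) x)"
    by (simp add: com sum_subtractf sum_negf)
  \<comment> \<open>The viscous terms add up to U against the gradient of
    \<open>laplacian h\<close>, to which incompressibility applies. This asks for h of class C^3
    with support away from the origin.\<close>
  also have "(\<Sum>k\<in>UNIV. LBINT x. U k x * pd k (laplacian h) x) = 0"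
    by (rule weak_div_free[OF Ck_on_subset[OF C(3)] T(1,2) lap0]) auto
  finally show ?thesis by simp
qed

end

lemma integral_abs_mult_le:
  fixes f g :: "'a::euclidean_space \<Rightarrow> real"
  assumes "integrable lborel (\<lambda>x. f x * g x)" "integrable lborel g" "\<And>x. g x \<noteq> 0 \<Longrightarrow> \<bar>f x\<bar> \<le> B"
  shows "\<bar>LBINT x. f x * g x\<bar> \<le> B * (LBINT x. \<bar>g x\<bar>)"
proof -
  have "\<bar>LBINT x. f x * g x\<bar> \<le> (LBINT x. \<bar>f x * g x\<bar>)" by (rule integral_abs_bound)
  also have "\<dots> \<le> (LBINT x. B * \<bar>g x\<bar>)"
  proof (rule integral_mono)
    show "\<bar>f x * g x\<bar> \<le> B * \<bar>g x\<bar>" for x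
      using assms(3)[of x] by (cases "g x = 0") (auto simp: abs_mult intro!: mult_right_mono)
  qed (use assms in auto)
  finally show ?thesis by simp
qed

text \<open>Its integral is, up to sign, the flux of U through spheres, averaged over the radii on
  which \<open>eta\<close> decreases.\<close>

definition flux :: "(4 \<Rightarrow> real ^ 4 \<Rightarrow> real) \<Rightarrow> real ^ 4 \<Rightarrow> real"
  where "flux U x = (\<Sum>i\<in>UNIV. U i x * pd i eta x)"

text \<open>An L^1 bound for the Laplacian of \<open>newton e\<close> that is uniform in e, whereas
  its sup norm grows like e^(-2).\<close>

definition kernel_mass :: real
  where "kernel_mass = mass + (LBINT x. \<bar>far x\<bar>)"

text \<open>The weights come from |U| <= 8C and |S| <= 64C at distance at least 1/8 from the
  origin.\<close>

definition far_mass :: real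
  where "far_mass = 8 * (LBINT x. \<bar>laplacian far x\<bar>) + 64 * (\<Sum>j\<in>UNIV. LBINT x. \<bar>pd j far x\<bar>)"

lemma laplacian_newton_L1: "0 < e \<Longrightarrow> e \<le> 1 / 32 \<Longrightarrow> (LBINT x. \<bar>laplacian (newton e) x\<bar>) \<le> kernel_mass"
proof -
  assume e: "0 < e" "e \<le> 1 / 32"
  have "(LBINT x. \<bar>laplacian (newton e) x\<bar>) \<le> (LBINT x. \<bar>far x\<bar> + bump e x)"
  proof (rule integral_mono)
    show "integrable lborel (\<lambda>x. \<bar>laplacian (newton e) x\<bar>)"
      unfolding laplacian_newton[OF e] using integrable_far integrable_bump[OF e] by simp
    show "integrable lborel (\<lambda>x. \<bar>far x\<bar> + bump e x)"
      using integrable_far integrable_bump[OF e] by simp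
    show "\<bar>laplacian (newton e) x\<bar> \<le> \<bar>far x\<bar> + bump e x" for x
      unfolding laplacian_newton[OF e] using bump_nonneg[of e x] by linarith
  qed
  also have "\<dots> = kernel_mass"
    using integrable_far integrable_bump[OF e] integral_bump[OF e] by (simp add: kernel_mass_def)
  finally show ?thesis .
qed

lemma continuous_far_derivatives: "continuous_on UNIV (pd j far)" "continuous_on UNIV (laplacian far)" "continuous_on UNIV far"
  using Ck_on_far Ck_on_continuous[OF Ck_on_far] Ck_on_continuous[OF Ck_on_laplacian[OF open_UNIV, of 0 far]]
    Ck_on_continuous[OF Ck_on_pd[of 1 UNIV far j]]
  by (simp_all add: numeral_eq_Suc)

lemma far_derivative_support:
  assumes "x \<notin> cball 0 (1 / 2)"
  shows "pd j far x = 0" "laplacian far x = 0"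
  by (rule pd_eq_0[OF closed_cball far_support assms], assumption,
      rule laplacian_support[OF closed_cball far_support assms])

context stokes_field
begin

lemma flux_support: "x \<notin> shell 1 2 \<Longrightarrow> flux U x = 0"
  by (simp add: flux_def pd_eta_eq_0)

lemma continuous_flux: "continuous_on UNIV (flux U)"
proof -
  have "Ck_on 0 (- {0}) (pd i eta)" for i
    using Ck_on_pd[of 3 "- {0}" eta i] Ck_on_eta Ck_on_continuous by fastforce
  then have "Ck_on 0 (- {0}) (flux U)"
    unfolding flux_def[abs_def] by (intro Ck_on_sum Ck_on_mult Ck_U) auto
  from Ck_on_extend[OF open_punctured closed_shell[of 1 2] shell_subset flux_support this] show ?thesis by simp
qed

lemma integrable_flux: "integrable lborel (flux U)"
  by (rule integrable_compact_support[OF compact_shell continuous_on_subset[OF continuous_flux] flux_support]) auto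

lemma U_le_shell: "x \<in> shell 1 2 \<Longrightarrow> \<bar>U i x\<bar> \<le> C"
proof -
  assume x: "x \<in> shell 1 2"
  then have n: "1 \<le> norm x" using shell_1_2_norm by blast
  then have "\<bar>U i x\<bar> \<le> C / norm x" by (intro U_le) auto
  also have "\<dots> \<le> C / 1" using n C_nonneg by (intro divide_left_mono) auto
  finally show ?thesis by simp
qed

lemma flux_le:
  assumes E: "\<And>i x. \<bar>pd i eta x\<bar> \<le> E"
  shows "\<bar>flux U x\<bar> \<le> 4 * C * E"
proof (cases "x \<in> shell 1 2")
  case True
  have "\<bar>flux U x\<bar> \<le> (\<Sum>i\<in>(UNIV :: 4 set). \<bar>U i x * pd i eta x\<bar>)" unfolding flux_def by (rule sum_abs)
  also have "\<dots> \<le> (\<Sum>i\<in>(UNIV :: 4 set). C * E)"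
    unfolding abs_mult by (intro sum_mono mult_mono U_le_shell True E C_nonneg) auto
  finally show ?thesis by simp
next
  case False
  have "0 \<le> E" using E[of 0 0] by linarith
  then show ?thesis using flux_support[OF False] C_nonneg by simp
qed

lemma flux_integral: "(LBINT x. flux U x) = (\<Sum>i\<in>UNIV. LBINT x. U i x * pd i eta x)"
proof -
  have "integrable lborel (\<lambda>x. U i x * pd i eta x)" for i
    by (rule integrable_compact_support[OF compact_shell])
       (use Ck_on_continuous[OF Ck_U[of 0 i]] Ck_on_continuous[OF Ck_on_pd[of 3 UNIV eta i]] Ck_on_eta[of UNIV] shell_subset[of 1 2] pd_eta_eq_0
         in \<open>auto intro!: continuous_on_mult intro: continuous_on_subset\<close>)
  then show ?thesis unfolding flux_def by (simp add: Bochner_Integration.integral_sum)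
qed

text \<open>The flux through a sphere does not depend on its radius, and the bound \<open>C / |x|\<close> forces it to
  vanish as the radius tends to zero.\<close>

lemma flux_eq_0: "(LBINT x. flux U x) = 0"
proof -
  obtain E where E: "0 < E" "\<And>i x. \<bar>pd i eta x\<bar> \<le> E" using eta_bounded by metis
  define V where "V = measure lborel (shell 1 2 :: (real ^ 4) set)"
  have small: "\<bar>LBINT x. flux U x\<bar> \<le> r\<^sup>2 * (4 * (C * E * V))" if r: "0 < r" "r < 1 / 2" for r
  proof -
    \<comment> \<open>The difference of the cutoffs at scales 1 and r avoids the origin and is thus
      an admissible test function for incompressibility.\<close>
    define eta_r where "eta_r x = eta (0 + inverse r *\<^sub>R x)" for x
    define T where "T = (shell (r\<^sup>2) 2 :: (real ^ 4) set)"
    have eta4: "Ck_on 4 UNIV eta" by (rule Ck_on_eta)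
    have "Ck_on 4 (- {0}) (\<lambda>x. eta x - eta_r x)"
      unfolding eta_r_def by (intro Ck_on_diff Ck_on_eta Ck_on_affine[OF _ _ eta4]) auto
    then have "Ck_on 1 (- {0}) (\<lambda>x. eta x - eta_r x)" by (rule Ck_on_le) simp
    moreover have "T \<subseteq> - {0}" unfolding T_def using r by (intro shell_subset) simp
    moreover have "eta x - eta_r x = 0" if "x \<notin> T" for x
    proof -
      from that consider "x \<bullet> x < r\<^sup>2" | "2 < x \<bullet> x" unfolding T_def using not_shellD by blast
      then show ?thesis
      proof cases
        case 1
        moreover have "r\<^sup>2 \<le> 1" using r by (simp add: power_le_one)
        moreover have "inverse r * (inverse r * (x \<bullet> x)) \<le> 1"
          using 1 r by (simp add: field_simps power2_eq_square)
        ultimately show ?thesis by (simp add: eta_r_def eta_simps)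
      next
        case 2
        have "r * r \<le> 1" using r by (simp add: mult_le_one)
        then have "2 * (r * r) \<le> x \<bullet> x" using 2 by linarith
        then have "2 \<le> inverse r * (inverse r * (x \<bullet> x))"
          using r by (simp add: field_simps)
        then show ?thesis using 2 by (simp add: eta_r_def eta_simps)
      qed
    qed
    ultimately have "(\<Sum>i\<in>UNIV. LBINT x. U i x * pd i (\<lambda>x. eta x - eta_r x) x) = 0"
      by (intro weak_div_free[of _ T]) (auto simp: T_def)
    moreover have "(LBINT x. U i x * pd i (\<lambda>x. eta x - eta_r x) x)
        = (LBINT x. U i x * pd i eta x) - (LBINT x. U i x * pd i eta_r x)
      \<and> \<bar>LBINT x. U i x * pd i eta_r x\<bar> \<le> r\<^sup>2 * (C * E * V)" for i
    proof -
      have d: "eta differentiable (at x)" for x using eta4 by (auto intro: Ck_on_differentiable)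
      have pdr: "pd i eta_r x = inverse r * pd i eta (inverse r *\<^sub>R x)" for x
        using pd_affine(2)[OF d, of i 0 "inverse r"] by (simp add: eta_r_def[abs_def])
      have dr: "eta_r differentiable (at x)" for x
        unfolding eta_r_def by (rule pd_affine(1)[OF d])
      have cpd: "continuous_on UNIV (pd i eta)"
        using Ck_on_pd[of 3 UNIV eta i] eta4 Ck_on_continuous by fastforce
      have sh: "inverse r *\<^sub>R x \<in> shell 1 2 \<longleftrightarrow> x \<in> shell (r\<^sup>2) (2 * r\<^sup>2)" for x :: "real ^ 4"
        using r by (auto simp: shell_def field_simps power2_eq_square)
      have supp: "U i x * pd i eta_r x = 0" if "x \<notin> shell (r\<^sup>2) (2 * r\<^sup>2)" for x
        using that sh pd_eta_eq_0 by (simp add: pdr)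
      have i1: "integrable lborel (\<lambda>x. U i x * pd i eta_r x)"
      proof (rule integrable_compact_support[OF compact_shell _ supp])
        have "continuous_on (shell (r\<^sup>2) (2 * r\<^sup>2)) (U i)"
          using continuous_on_subset[OF Ck_on_continuous[OF Ck_U[of 0 i]] shell_subset] r by simp
        then show "continuous_on (shell (r\<^sup>2) (2 * r\<^sup>2)) (\<lambda>x. U i x * pd i eta_r x)"
          unfolding pdr by (intro continuous_intros continuous_on_compose2[OF cpd]) auto
      qed
      have i0: "integrable lborel (\<lambda>x. U i x * pd i eta x)"
        by (rule integrable_compact_support[OF compact_shell])
           (use Ck_on_continuous[OF Ck_U[of 0 i]] cpd shell_subset[of 1 2] pd_eta_eq_0
             in \<open>auto intro!: continuous_on_mult intro: continuous_on_subset\<close>)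
      \<comment> \<open>Volume contributes r^4, the derivative of the cutoff 1/r and the bound on U
        another 1/r; what remains is r^2.\<close>
      have "(LBINT x. U i x * pd i eta_r x)
          = r ^ 4 * (LBINT y. U i (r *\<^sub>R y) * pd i eta_r (r *\<^sub>R y))"
        using lborel_integral_affine[of "\<lambda>x. U i x * pd i eta_r x" r 0] i1 r by simp
      moreover have "\<bar>LBINT y. U i (r *\<^sub>R y) * pd i eta_r (r *\<^sub>R y)\<bar> \<le> (LBINT y. C * E / r\<^sup>2 * indicator (shell 1 2 :: (real ^ 4) set) y)"
      proof (rule order_trans[OF integral_abs_bound], rule integral_mono)
        show "integrable lborel (\<lambda>y. \<bar>U i (r *\<^sub>R y) * pd i eta_r (r *\<^sub>R y)\<bar>)"
          using lborel_integrable_affine[OF i1, of r 0] r by (simp add: integrable_abs)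
        show "integrable lborel (\<lambda>y. C * E / r\<^sup>2 * indicator (shell 1 2 :: (real ^ 4) set) y)"
          by (intro integrable_mult_right integrable_indicator_shell)
        fix y
        show "\<bar>U i (r *\<^sub>R y) * pd i eta_r (r *\<^sub>R y)\<bar> \<le> C * E / r\<^sup>2 * indicator (shell 1 2) y"
        proof (cases "y \<in> shell 1 2")
          case True
          then have n: "1 \<le> norm y" using shell_1_2_norm by blast
          then have "\<bar>U i (r *\<^sub>R y)\<bar> \<le> C / norm (r *\<^sub>R y)" using r by (intro U_le) auto
          moreover have "y \<noteq> 0" using n by auto
          moreover have "r \<le> norm (r *\<^sub>R y)" using n r by simp
          then have "C / norm (r *\<^sub>R y) \<le> C / r"
            using r C_nonneg \<open>y \<noteq> 0\<close> by (intro divide_left_mono) auto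
          ultimately have "\<bar>U i (r *\<^sub>R y)\<bar> \<le> C / r" by linarith
          then have "\<bar>U i (r *\<^sub>R y)\<bar> * \<bar>pd i eta_r (r *\<^sub>R y)\<bar> \<le> C / r * (E / r)"
            using r E(2)[of i y] C_nonneg by (intro mult_mono) (auto simp: pdr abs_mult field_simps)
          then show ?thesis using True by (simp add: abs_mult power2_eq_square)
        next
          case False
          then show ?thesis using r pd_eta_eq_0[OF False] by (simp add: pdr)
        qed
      qed
      moreover have "(LBINT y. C * E / r\<^sup>2 * indicator (shell 1 2 :: (real ^ 4) set) y) = C * E / r\<^sup>2 * V"
        by (simp add: V_def)
      ultimately have "\<bar>LBINT x. U i x * pd i eta_r x\<bar> \<le> r ^ 4 * (C * E / r\<^sup>2 * V)"
        using r by (auto simp only: abs_mult abs_of_nonneg zero_le_power less_imp_le intro!: mult_left_mono)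
      also have "\<dots> = r\<^sup>2 * (C * E * V)" using r by (simp add: power_numeral_reduce)
      finally show ?thesis
        using i0 i1 by (simp add: pd_diff[OF d dr] right_diff_distrib)
    qed
    then have *: "(LBINT x. U i x * pd i (\<lambda>x. eta x - eta_r x) x)
        = (LBINT x. U i x * pd i eta x) - (LBINT x. U i x * pd i eta_r x)"
        "\<bar>LBINT x. U i x * pd i eta_r x\<bar> \<le> r\<^sup>2 * (C * E * V)" for i
      by blast+
    ultimately have "(LBINT x. flux U x) = (\<Sum>i\<in>UNIV. LBINT x. U i x * pd i eta_r x)"
      by (simp add: flux_integral sum_subtractf)
    also have "\<bar>\<dots>\<bar> \<le> (\<Sum>i\<in>(UNIV :: 4 set). r\<^sup>2 * (C * E * V))"
      by (rule order_trans[OF sum_abs]) (intro sum_mono *(2))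
    finally show ?thesis by simp
  qed
  have "((\<lambda>r. r\<^sup>2 * (4 * (C * E * V))) \<longlongrightarrow> 0) (at_right 0)"
    by (auto intro!: tendsto_eq_intros)
  moreover have "\<forall>\<^sub>F r in at_right 0. \<bar>LBINT x. flux U x\<bar> \<le> r\<^sup>2 * (4 * (C * E * V))"
    unfolding eventually_at_right_field by (rule exI[of _ "1 / 2"]) (use small in auto)
  ultimately have "\<bar>LBINT x. flux U x\<bar> \<le> 0"
    by (rule tendsto_lowerbound) simp
  then show ?thesis by simp
qed

lemma conv_flux_support:
  assumes "\<And>z. z \<notin> cball 0 (1 / 2) \<Longrightarrow> K z = 0" "x \<notin> shell (1 / 4) 4"
  shows "conv K (flux U) x = 0"
proof (rule conv_eq_0[of "1 / 2"])
  fix y assume "flux U y \<noteq> 0"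
  then have y: "1 \<le> norm y" "norm y \<le> 3 / 2" using flux_support shell_1_2_norm by blast+
  have "norm x < 1 / 2 \<or> 2 < norm x" using assms(2) shell_memI not_le by blast
  then show "1 / 2 < norm (x - y)"
    using norm_triangle_ineq2[of x y] norm_triangle_ineq2[of y x] y by (auto simp: norm_minus_commute)
qed (use assms(1) in auto)

lemma shell_norm: "x \<in> shell (1 / 4) 4 \<Longrightarrow> 1 / 2 \<le> norm x"
  using shell_bounds[of x "1 / 2" 4] by (simp add: power_divide)

text \<open>S need not be small with U, so S times the Hessian is split by Young's inequality: a
  multiple of \<open>\<mu>\<close> plus the squared L^2 norm of the Hessian. The latter equals that
  of the Laplacian and costs just one power of the L^1 norm of the flux.\<close>

lemma potential_bound:
  assumes E: "\<And>i x. \<bar>pd i eta x\<bar> \<le> E" and e: "0 < e" "e \<le> 1 / 32" and \<mu>: "0 < \<mu>"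
  defines "V \<equiv> measure lborel (shell (1 / 4) 4 :: (real ^ 4) set)"
  shows "\<bar>LBINT x. p x * laplacian (conv (newton e) (flux U)) x\<bar>
    \<le> 16 * \<mu> * V + 16 * C ^ 3 * E * kernel_mass\<^sup>2 / \<mu> * (LBINT x. \<bar>flux U x\<bar>)"
proof -
  let ?T = "shell (1 / 4) 4 :: (real ^ 4) set"
  define h where "h = conv (newton e) (flux U)"
  note flux = continuous_flux compact_shell[of 1 2] flux_support
  have h4: "Ck_on 4 UNIV h"
    unfolding h_def by (rule Ck_on_conv[OF flux Ck_on_newton[OF e(1)]])
  have h3: "Ck_on 3 UNIV h" using Ck_on_le[OF h4] by simp
  have h0: "h x = 0" if "x \<notin> ?T" for x
    unfolding h_def by (rule conv_flux_support[OF newton_support that])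
  have h1: "pd k h x = 0" if "x \<notin> ?T" for x k
    by (rule pd_eq_0[OF closed_shell _ that]) (rule h0)
  have h2: "pd j (pd k h) x = 0" if "x \<notin> ?T" for x j k
    by (rule pd_eq_0[OF closed_shell _ that]) (rule h1)
  have ch: "continuous_on UNIV (pd j (pd k h))" for j k
    using h3 by (simp add: numeral_eq_Suc Ck_on_continuous[where k = 1])
  have int2: "integrable lborel (\<lambda>x. (pd j (pd k h) x)\<^sup>2)" for j k
    by (rule integrable_compact_support[OF compact_shell])
       (use h2 ch[of j k] in \<open>auto intro!: continuous_on_power intro: continuous_on_subset\<close>)
  have intT: "integrable lborel (\<lambda>x. \<mu> * indicator ?T x)"
    by (intro integrable_mult_right integrable_indicator_shell)
  have lapn: "continuous_on UNIV (laplacian (newton e))"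
    using Ck_on_continuous[OF Ck_on_laplacian[OF open_UNIV, of 2]] Ck_on_newton[OF e(1)] by simp
  have "Ck_on 2 UNIV (newton e)" using Ck_on_le[OF Ck_on_newton[OF e(1)]] by simp
  from laplacian_conv[OF this flux] have lap: "laplacian h = conv (laplacian (newton e)) (flux U)"
    by (auto simp: h_def)
  have bnd: "\<bar>LBINT x. S k j x * pd j (pd k h) x\<bar>
      \<le> \<mu> * V + 4 * C\<^sup>2 / \<mu> * (LBINT x. (pd j (pd k h) x)\<^sup>2)" for k j
  proof -
    have "\<bar>LBINT x. S k j x * pd j (pd k h) x\<bar>
        \<le> (LBINT x. \<mu> * indicator ?T x + 4 * C\<^sup>2 / \<mu> * (pd j (pd k h) x)\<^sup>2)"
    proof (rule order_trans[OF integral_abs_bound], rule integral_mono)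
      show "integrable lborel (\<lambda>x. \<bar>S k j x * pd j (pd k h) x\<bar>)"
        by (intro integrable_abs integrable_compact_support[OF compact_shell[of "1 / 4" 4]])
           (use Ck_on_continuous[OF Ck_S[of 0 k j]] ch[of j k] h2 shell_subset[of "1 / 4" 4]
             in \<open>auto intro!: continuous_on_mult intro: continuous_on_subset\<close>)
      show "integrable lborel (\<lambda>x. \<mu> * indicator ?T x + 4 * C\<^sup>2 / \<mu> * (pd j (pd k h) x)\<^sup>2)"
        using intT int2 by simp
      fix x
      show "\<bar>S k j x * pd j (pd k h) x\<bar> \<le> \<mu> * indicator ?T x + 4 * C\<^sup>2 / \<mu> * (pd j (pd k h) x)\<^sup>2"
      proof (cases "x \<in> ?T")
        case True
        define a where "a = \<bar>pd j (pd k h) x\<bar>"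
        have n: "1 / 2 \<le> norm x" using shell_norm[OF True] .
        then have "(1 / 2)\<^sup>2 \<le> (norm x)\<^sup>2" by (intro power_mono) auto
        then have n2: "1 / 4 \<le> (norm x)\<^sup>2" by (simp add: power_divide)
        have "x \<noteq> 0" using n by auto
        from S_le[OF this] have "\<bar>S k j x\<bar> \<le> C / (norm x)\<^sup>2" .
        also have "\<dots> \<le> C / (1 / 4)" using n2 C_nonneg by (intro divide_left_mono) auto
        finally have "\<bar>S k j x\<bar> * a \<le> 4 * C * a" by (intro mult_right_mono) (auto simp: a_def)
        moreover have "4 * C * a \<le> \<mu> + 4 * C\<^sup>2 / \<mu> * a\<^sup>2"
        proof -
          have "0 \<le> (\<mu> - 2 * C * a)\<^sup>2 / \<mu>" using \<mu> by simp
          also have "\<dots> = \<mu> + 4 * C\<^sup>2 / \<mu> * a\<^sup>2 - 4 * C * a"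
            using \<mu> by (simp add: field_simps power2_eq_square)
          finally show ?thesis by simp
        qed
        ultimately show ?thesis using True by (simp add: a_def abs_mult)
      next
        case False
        then show ?thesis using h2[OF False] by simp
      qed
    qed
    also have "\<dots> = \<mu> * V + 4 * C\<^sup>2 / \<mu> * (LBINT x. (pd j (pd k h) x)\<^sup>2)"
      using intT int2 by (simp add: V_def)
    finally show ?thesis .
  qed
  have "\<bar>LBINT x. p x * laplacian h x\<bar> = \<bar>\<Sum>k\<in>UNIV. \<Sum>j\<in>UNIV. LBINT x. S k j x * pd j (pd k h) x\<bar>"
    by (subst weak_pressure_laplacian[OF h3 compact_shell shell_subset h0]) auto
  also have "\<dots> \<le> (\<Sum>k\<in>UNIV. \<Sum>j\<in>UNIV. \<mu> * V + 4 * C\<^sup>2 / \<mu> * (LBINT x. (pd j (pd k h) x)\<^sup>2))"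
    by (rule order_trans[OF sum_abs], rule sum_mono, rule order_trans[OF sum_abs], rule sum_mono, rule bnd)
  also have "\<dots> = 16 * \<mu> * V + 4 * C\<^sup>2 / \<mu> * (\<Sum>k\<in>UNIV. \<Sum>j\<in>UNIV. LBINT x. (pd j (pd k h) x)\<^sup>2)"
    by (simp add: sum.distrib sum_distrib_left)
  also have "(\<Sum>k\<in>UNIV. \<Sum>j\<in>UNIV. LBINT x. (pd j (pd k h) x)\<^sup>2) = (LBINT x. (laplacian h x)\<^sup>2)"
    by (subst sum.swap) (rule integral_hessian[OF h3 compact_shell h0])
  also have "16 * \<mu> * V + 4 * C\<^sup>2 / \<mu> * (LBINT x. (laplacian h x)\<^sup>2)
      \<le> 16 * \<mu> * V + 4 * C\<^sup>2 / \<mu> * (4 * C * E * kernel_mass\<^sup>2 * (LBINT x. \<bar>flux U x\<bar>))"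
  proof (intro add_left_mono mult_left_mono)
    have E0: "0 \<le> E" using E[of 0 0] by linarith
    have "(LBINT x. (laplacian h x)\<^sup>2)
        \<le> 4 * C * E * (LBINT x. \<bar>laplacian (newton e) x\<bar>)\<^sup>2 * (LBINT x. \<bar>flux U x\<bar>)"
      unfolding lap
    proof (rule conv_square_bound[OF lapn compact_cball[of 0 "1 / 2"] _ flux flux_le[OF E] compact_shell[of "1 / 4" 4]])
      show *: "laplacian (newton e) x = 0" if "x \<notin> cball 0 (1 / 2)" for x
        by (rule laplacian_support[OF closed_cball newton_support that])
      show "conv (laplacian (newton e)) (flux U) x = 0" if "x \<notin> shell (1 / 4) 4" for x
        by (rule conv_flux_support[OF * that])
    qed
    also have "\<dots> \<le> 4 * C * E * kernel_mass\<^sup>2 * (LBINT x. \<bar>flux U x\<bar>)"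
      using laplacian_newton_L1[OF e] C_nonneg E0 by (intro mult_right_mono mult_left_mono power_mono) auto
    finally show "(LBINT x. (laplacian h x)\<^sup>2) \<le> 4 * C * E * kernel_mass\<^sup>2 * (LBINT x. \<bar>flux U x\<bar>)" .
  qed (use \<mu> in auto)
  finally show ?thesis by (simp add: h_def power3_eq_cube power2_eq_square mult_ac)
qed

text \<open>With the kernel moved onto the pressure, the smoothed pressure q has a gradient
  controlled by \<open>weak_pressure\<close>. That controls its oscillation on the shell, and mean
  zero of the flux makes oscillation enough.\<close>

lemma far_bound: "\<bar>LBINT x. p x * conv far (flux U) x\<bar> \<le> 24 * C * far_mass * (LBINT x. \<bar>flux U x\<bar>)"
proof -
  \<comment> \<open>The pressure may be non-integrable at the origin. This cutoff equals 1 for 1/8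
    <= |y| <= 2, since 128/64 = 2 and 4/4 = 1 are the thresholds of \<open>plateau\<close>.\<close>
  define \<zeta> :: "real ^ 4 \<Rightarrow> real" where "\<zeta> = (\<lambda>y. plateau (1 / 4 * (y \<bullet> y)) * (1 - plateau (128 * (y \<bullet> y))))"
  define T where "T = (shell (1 / 128) 8 :: (real ^ 4) set)"
  define q where "q = conv far (\<lambda>y. p y * \<zeta> y)"
  have T: "compact T" "T \<subseteq> - {0}" unfolding T_def by (rule compact_shell, rule shell_subset) simp
  have \<zeta>0: "\<zeta> y = 0" if "y \<notin> T" for y
    using not_shellD[OF that[unfolded T_def]] by (auto simp: \<zeta>_def plateau_simps)
  have \<zeta>1: "\<zeta> y = 1" if "1 / 8 \<le> norm y" "norm y \<le> 2" for y
  proof -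
    have "(1 / 8)\<^sup>2 \<le> (norm y)\<^sup>2" "(norm y)\<^sup>2 \<le> 2\<^sup>2" using that by (intro power_mono; simp)+
    then show ?thesis by (simp add: \<zeta>_def plateau_simps power2_norm_eq_inner power_divide)
  qed
  have "Ck_on 4 UNIV \<zeta>" unfolding \<zeta>_def
    by (intro Ck_on_mult Ck_on_diff Ck_on_plateau Ck_on_const Ck_on_inner_self) auto
  then have "Ck_on 4 (- {0}) \<zeta>" by (rule Ck_on_subset) simp
  then have "Ck_on 4 (- {0}) (\<lambda>y. p y * \<zeta> y)"
    by (intro Ck_on_mult Ck_p) auto
  then have "Ck_on 4 UNIV (\<lambda>y. p y * \<zeta> y)"
    by (rule Ck_on_extend[OF open_punctured compact_imp_closed[OF T(1)] T(2), rotated]) (simp add: \<zeta>0)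
  then have pt: "continuous_on UNIV (\<lambda>y. p y * \<zeta> y)" by (rule Ck_on_continuous)
  have pt0: "p y * \<zeta> y = 0" if "y \<notin> T" for y using \<zeta>0[OF that] by simp
  have far1: "Ck_on (Suc 0) UNIV far" by (rule Ck_on_le[OF Ck_on_far]) simp
  have fd: "far differentiable (at x)" for x using far1 by simp
  \<comment> \<open>The range extends inwards to |x|^2 = 1/2 because the segments used below leave
    the shell. A kernel of radius 1/2 still keeps distance 7/10 - 1/2 > 1/8 from the origin.\<close>
  have grad: "\<bar>pd i q x\<bar> \<le> C * far_mass" if x: "1 / 2 \<le> x \<bullet> x" "x \<bullet> x \<le> 2" for i x
  proof -
    have "(7 / 10)\<^sup>2 \<le> (norm x)\<^sup>2" "(norm x)\<^sup>2 \<le> (3 / 2)\<^sup>2"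
      using x by (auto simp: power2_norm_eq_inner power_divide)
    then have nx: "7 / 10 \<le> norm x" "norm x \<le> 3 / 2" by (auto intro: power2_le_imp_le)
    have ny: "1 / 8 \<le> norm y" "norm y \<le> 2" if "y \<in> cball x (1 / 2)" for y
      using that nx norm_triangle_ineq2[of x y] norm_triangle_ineq2[of y x]
      by (auto simp: dist_norm norm_minus_commute)
    have sub: "cball x (1 / 2) \<subseteq> - {0}" using ny(1)[of 0] by auto
    \<comment> \<open>As a function of y, the kernel at x - y turns the derivative of q into a
      pressure test with a gradient; \<open>\<zeta>\<close> is 1 on its support.\<close>
    define \<psi> where "\<psi> = (\<lambda>y. far (x + (- 1) *\<^sub>R y))"
    have C\<psi>: "Ck_on 2 UNIV \<psi>" unfolding \<psi>_def by (rule Ck_on_affine[OF _ _ Ck_on_far]) auto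
    have in_ball: "x + (- 1) *\<^sub>R y \<notin> cball 0 (1 / 2)" if "y \<notin> cball x (1 / 2)" for y
      using that by (simp add: dist_norm norm_minus_commute)
    have \<psi>0: "\<psi> y = 0" if "y \<notin> cball x (1 / 2)" for y
      unfolding \<psi>_def by (rule far_support[OF in_ball[OF that]])
    have pd\<psi>: "pd j \<psi> y = - pd j far (x + (- 1) *\<^sub>R y)" for j y
      unfolding \<psi>_def by (subst pd_affine(2)[OF fd]) simp
    have lap\<psi>: "laplacian \<psi> y = laplacian far (x + (- 1) *\<^sub>R y)" for y
      unfolding \<psi>_def by (subst laplacian_affine[OF open_UNIV Ck_on_far]) auto
    have \<psi>1: "pd j \<psi> y = 0" "laplacian \<psi> y = 0" if "y \<notin> cball x (1 / 2)" for y j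
      using far_derivative_support[OF in_ball[OF that]] by (simp_all add: pd\<psi> lap\<psi>)
    have cont: "continuous_on UNIV (pd j \<psi>)" "continuous_on UNIV (laplacian \<psi>)" for j
      using C\<psi> Ck_on_continuous[OF Ck_on_laplacian[OF open_UNIV, of 0 \<psi>]]
        Ck_on_continuous[OF Ck_on_pd[of 1 UNIV \<psi> j]] by (simp_all add: numeral_eq_Suc)
    have int: "integrable lborel (pd j \<psi>)" "integrable lborel (laplacian \<psi>)"
      "integrable lborel (\<lambda>y. S i j y * pd j \<psi> y)" "integrable lborel (\<lambda>y. U i y * laplacian \<psi> y)" for j
      using cont \<psi>1 Ck_on_continuous[OF Ck_S[of 0 i j]] Ck_on_continuous[OF Ck_U[of 0 i]] sub
      by (auto intro!: integrable_compact_support[OF compact_cball[of x "1 / 2"]] continuous_on_mult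
          intro: continuous_on_subset)
    have "pd i q = conv (pd i far) (\<lambda>y. p y * \<zeta> y)"
      unfolding q_def by (rule pd_conv[OF far1 pt T(1)]) (rule pt0)
    then have "pd i q x = (LBINT y. pd i far (x - y) * (p y * \<zeta> y))"
      by (simp add: conv_def)
    also have "\<dots> = (LBINT y. - (p y * pd i \<psi> y))"
    proof (rule Bochner_Integration.integral_cong)
      fix y
      show "pd i far (x - y) * (p y * \<zeta> y) = - (p y * pd i \<psi> y)"
      proof (cases "y \<in> cball x (1 / 2)")
        case True
        then show ?thesis using \<zeta>1[OF ny[OF True]] by (simp add: pd\<psi>)
      next
        case False
        then show ?thesis using far_derivative_support(1)[OF in_ball[OF False]] by (simp add: pd\<psi>)
      qed
    qed simp
    also have "\<dots> = (LBINT y. U i y * laplacian \<psi> y) + (\<Sum>j\<in>UNIV. LBINT y. S i j y * pd j \<psi> y)"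
      using weak_pressure[OF Ck_on_subset[OF C\<psi>] compact_cball sub \<psi>0, where k = i] by simp
    finally have q: "pd i q x = (LBINT y. U i y * laplacian \<psi> y) + (\<Sum>j\<in>UNIV. LBINT y. S i j y * pd j \<psi> y)" .
    have UB: "\<bar>U i y\<bar> \<le> 8 * C" "\<bar>S i j y\<bar> \<le> 64 * C" if "y \<in> cball x (1 / 2)" for y j
    proof -
      have "1 / 8 \<le> norm y" using ny that by blast
      then have y: "0 < norm y" "y \<noteq> 0" "(1 / 8)\<^sup>2 \<le> (norm y)\<^sup>2" by (auto intro!: power_mono)
      have "C / norm y \<le> C / (1 / 8)"
        using y \<open>1 / 8 \<le> norm y\<close> C_nonneg by (intro divide_left_mono) auto
      then show "\<bar>U i y\<bar> \<le> 8 * C" using U_le[OF y(2), of i] by simp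
      have "C / (norm y)\<^sup>2 \<le> C / (1 / 8)\<^sup>2"
        using y C_nonneg by (intro divide_left_mono) auto
      then show "\<bar>S i j y\<bar> \<le> 64 * C" using S_le[OF y(2), of i j] by (simp add: power_divide)
    qed
    have "\<bar>LBINT y. U i y * laplacian \<psi> y\<bar> \<le> 8 * C * (LBINT y. \<bar>laplacian \<psi> y\<bar>)"
      by (rule integral_abs_mult_le[OF int(4) int(2) UB(1)]) (use \<psi>1 in blast)
    also have "(LBINT y. \<bar>laplacian \<psi> y\<bar>) = (LBINT y. \<bar>laplacian far y\<bar>)"
      using lborel_integral_reflect[of "\<lambda>y. \<bar>laplacian far y\<bar>" x] continuous_far_derivatives(2)
      by (simp add: lap\<psi> borel_measurable_continuous_onI continuous_on_rabs)
    finally have 1: "\<bar>LBINT y. U i y * laplacian \<psi> y\<bar> \<le> 8 * C * (LBINT y. \<bar>laplacian far y\<bar>)" .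
    have 2: "\<bar>LBINT y. S i j y * pd j \<psi> y\<bar> \<le> 64 * C * (LBINT y. \<bar>pd j far y\<bar>)" for j
    proof -
      have "\<bar>LBINT y. S i j y * pd j \<psi> y\<bar> \<le> 64 * C * (LBINT y. \<bar>pd j \<psi> y\<bar>)"
        by (rule integral_abs_mult_le[OF int(3) int(1) UB(2)]) (use \<psi>1 in blast)
      also have "(LBINT y. \<bar>pd j \<psi> y\<bar>) = (LBINT y. \<bar>pd j far y\<bar>)"
        using lborel_integral_reflect[of "\<lambda>y. \<bar>pd j far y\<bar>" x] continuous_far_derivatives(1)
        by (simp add: pd\<psi> borel_measurable_continuous_onI continuous_on_rabs)
      finally show ?thesis .
    qed
    have "\<bar>pd i q x\<bar> \<le> 8 * C * (LBINT y. \<bar>laplacian far y\<bar>) + (\<Sum>j\<in>UNIV. 64 * C * (LBINT y. \<bar>pd j far y\<bar>))"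
      unfolding q by (rule order_trans[OF abs_triangle_ineq add_mono[OF 1 order_trans[OF sum_abs sum_mono[OF 2]]]])
    then show ?thesis by (simp add: far_mass_def algebra_simps sum_distrib_left)
  qed
  have dq: "q differentiable (at x)" for x
    using conv_has_derivative[OF far1 pt T(1) pt0] unfolding q_def differentiable_def by blast
  \<comment> \<open>For e orthogonal to x, the segment point has squared norm (1 - t)^2 |x|^2 + t^2,
    which stays between 1/2 and 2. The 12 is four components times |e - x| <= 3.\<close>
  have seg: "\<bar>q x - q e\<bar> \<le> 12 * C * far_mass"
    if x: "1 \<le> x \<bullet> x" "x \<bullet> x \<le> 2" and e: "e \<bullet> e = 1" "x \<bullet> e = 0" for x e
  proof -
    have "\<exists>t>0. t < 1 \<and> q (x + 1 *\<^sub>R (e - x)) - q (x + 0 *\<^sub>R (e - x))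
        = (1 - 0) * (\<Sum>i\<in>UNIV. (e - x) $ i * pd i q (x + t *\<^sub>R (e - x)))"
      by (rule MVT2, simp) (rule line_derivative[OF dq])
    then obtain t where t: "0 < t" "t < 1"
      "q e - q x = (\<Sum>i\<in>UNIV. (e - x) $ i * pd i q (x + t *\<^sub>R (e - x)))" by auto
    have "(x + t *\<^sub>R (e - x)) \<bullet> (x + t *\<^sub>R (e - x)) = (1 - t)\<^sup>2 * (x \<bullet> x) + t\<^sup>2"
      using e by (simp add: inner_simps inner_commute[of e x] power2_eq_square algebra_simps)
    moreover have "(1 - t)\<^sup>2 * 1 \<le> (1 - t)\<^sup>2 * (x \<bullet> x)" "(1 - t)\<^sup>2 * (x \<bullet> x) \<le> (1 - t)\<^sup>2 * 2"
      by (rule mult_left_mono[OF x(1)], simp, rule mult_left_mono[OF x(2)], simp)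
    moreover have "1 / 2 \<le> (1 - t)\<^sup>2 + t\<^sup>2" "(1 - t)\<^sup>2 * 2 + t\<^sup>2 \<le> 2"
    proof -
      have "0 \<le> (2 * t - 1)\<^sup>2" by simp
      then show "1 / 2 \<le> (1 - t)\<^sup>2 + t\<^sup>2" by (simp add: power2_eq_square algebra_simps)
      have "0 \<le> t * (4 - 3 * t)" using t by (intro mult_nonneg_nonneg) auto
      then show "(1 - t)\<^sup>2 * 2 + t\<^sup>2 \<le> 2" by (simp add: power2_eq_square algebra_simps)
    qed
    ultimately have g: "\<bar>pd i q (x + t *\<^sub>R (e - x))\<bar> \<le> C * far_mass" for i
      by (intro grad) linarith+
    have "(norm x)\<^sup>2 \<le> 2\<^sup>2" using x by (simp add: power2_norm_eq_inner)
    then have "norm x \<le> 2" by (rule power2_le_imp_le) simp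
    moreover have "norm e = 1" using e by (simp add: norm_eq_sqrt_inner)
    ultimately have w: "\<bar>(e - x) $ i\<bar> \<le> 3" for i
      using component_le_norm_cart[of "e - x" i] norm_triangle_ineq4[of e x] by linarith
    have "\<bar>q e - q x\<bar> \<le> (\<Sum>i\<in>(UNIV :: 4 set). 3 * (C * far_mass))"
      unfolding t(3) by (rule order_trans[OF sum_abs], unfold abs_mult, intro sum_mono mult_mono w g) auto
    then show ?thesis by (simp add: abs_minus_commute)
  qed
  \<comment> \<open>The segment from x to y may hit the origin. A unit vector orthogonal to both,
    available since two vectors cannot span dimension four, serves as a relay.\<close>
  have osc: "\<bar>q x - q y\<bar> \<le> 24 * C * far_mass" if "x \<in> shell 1 2" "y \<in> shell 1 2" for x y
  proof -
    have "dim {x, y} \<le> card {x, y}" by (rule dim_le_card') simp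
    also have "\<dots> \<le> 2" by (simp add: card_insert_if)
    finally have "dim {x, y} < DIM(real ^ 4)" by simp
    then obtain z where z: "z \<noteq> 0" "\<And>w. w \<in> span {x, y} \<Longrightarrow> orthogonal z w"
      using orthogonal_to_subspace_exists by blast
    define e where "e = z /\<^sub>R norm z"
    have "z \<bullet> z \<noteq> 0" using z(1) by simp
    have "e \<bullet> e = 1"
      using z(1) by (simp add: e_def dot_square_norm power2_eq_square)
    moreover have "x \<bullet> e = 0" "y \<bullet> e = 0"
      using z(2)[of x] z(2)[of y] by (auto simp: e_def orthogonal_def inner_commute span_base)
    ultimately have "\<bar>q x - q e\<bar> \<le> 12 * C * far_mass" "\<bar>q y - q e\<bar> \<le> 12 * C * far_mass"
      using that by (auto simp: shell_def intro!: seg)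
    then show ?thesis by linarith
  qed
  note flux = continuous_flux compact_shell[of 1 2] flux_support
  define x0 :: "real ^ 4" where "x0 = axis 1 1"
  have x0: "x0 \<in> shell 1 2" by (simp add: x0_def shell_def inner_axis_axis)
  have cq: "continuous_on UNIV q"
    unfolding q_def by (rule continuous_on_conv[OF Ck_on_continuous[OF Ck_on_far] pt T(1) pt0])
  have iq: "integrable lborel (\<lambda>x. q x * flux U x)" "integrable lborel (\<lambda>x. (q x - q x0) * flux U x)"
    using cq flux by (auto intro!: integrable_compact_support[OF compact_shell[of 1 2]] continuous_intros intro: continuous_on_subset)
  have "(LBINT x. p x * conv far (flux U) x) = (LBINT x. (p x * \<zeta> x) * conv far (flux U) x)"
  proof (rule Bochner_Integration.integral_cong)
    fix x
    show "p x * conv far (flux U) x = (p x * \<zeta> x) * conv far (flux U) x"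
    proof (cases "x \<in> shell (1 / 4) 4")
      case True
      have "(norm x)\<^sup>2 \<le> 2\<^sup>2" using True by (simp add: shell_def power2_norm_eq_inner)
      then have "norm x \<le> 2" by (rule power2_le_imp_le) simp
      then show ?thesis using \<zeta>1[of x] shell_norm[OF True] by simp
    next
      case False
      then show ?thesis using conv_flux_support[OF far_support False] by simp
    qed
  qed simp
  also have "\<dots> = (LBINT x. (LBINT y. (p y * \<zeta> y) * far (y - x)) * flux U x)"
    by (rule integral_mult_conv[OF pt continuous_far_derivatives(3) flux(1) compact_cball far_support flux(2,3)])
  also have "\<dots> = (LBINT x. q x * flux U x)"
  proof -
    have "far (y - x) = far (x - y)" for x y using far_even[of "x - y"] by simp
    then show ?thesis by (simp add: q_def conv_def mult.commute)
  qed
  \<comment> \<open>Mean zero of the flux permits subtracting the constant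
    \<open>q x0\<close>.\<close>
  also have "\<dots> = (LBINT x. (q x - q x0) * flux U x)"
    using iq integrable_flux flux_eq_0 by (simp add: left_diff_distrib)
  also have "\<bar>\<dots>\<bar> \<le> 24 * C * far_mass * (LBINT x. \<bar>flux U x\<bar>)"
    by (rule integral_abs_mult_le[OF iq(2) integrable_flux osc[OF _ x0]]) (use flux_support in blast)
  finally show ?thesis .
qed

text \<open>Here e depends on the modulus of continuity of the flux, which has no uniform control.
  This is harmless because \<open>potential_bound\<close> is uniform in e.\<close>

lemma mollified_flux:
  assumes "0 < \<omega>"
  obtains e where "0 < e" "e \<le> 1 / 32" "\<And>x. \<bar>conv (bump e) (flux U) x - mass * flux U x\<bar> \<le> \<omega> * mass"
proof -
  have "uniformly_continuous_on (cball 0 3) (flux U)"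
    by (rule compact_uniformly_continuous) (auto intro: continuous_on_subset[OF continuous_flux])
  then obtain \<delta> where \<delta>: "0 < \<delta>" "\<And>x y. x \<in> cball 0 3 \<Longrightarrow> y \<in> cball 0 3 \<Longrightarrow> dist y x < \<delta> \<Longrightarrow> dist (flux U y) (flux U x) < \<omega>"
    using assms unfolding uniformly_continuous_on_def by metis
  define e where "e = min (1 / 32) (\<delta>\<^sup>2)"
  have e: "0 < e" "e \<le> 1 / 32" "e \<le> \<delta>\<^sup>2" using \<delta>(1) by (auto simp: e_def)
  have "\<bar>conv (bump e) (flux U) x - mass * flux U x\<bar> \<le> \<omega> * mass" for x
  proof (cases "x \<in> cball 0 2")
    case True
    have ib: "integrable lborel (\<lambda>y. bump e (x - y))"
      using lborel_integrable_affine[OF integrable_bump[OF e(1,2)], of "-1" x] by simp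
    have ic: "integrable lborel (\<lambda>y. bump e (x - y) * flux U y)"
      by (rule conv_integrable[OF continuous_on_bump continuous_flux compact_shell flux_support])
    have m: "(LBINT y. bump e (x - y)) = mass"
      using lborel_integral_reflect[of "bump e" x] integral_bump[OF e(1,2)] continuous_on_bump
      by (simp add: borel_measurable_continuous_onI)
    have eq: "conv (bump e) (flux U) x - mass * flux U x = (LBINT y. bump e (x - y) * (flux U y - flux U x))"
      using ib ic m by (simp add: conv_def right_diff_distrib)
    have "\<bar>\<dots>\<bar> \<le> (LBINT y. \<omega> * bump e (x - y))"
    proof (rule order_trans[OF integral_abs_bound], rule integral_mono)
      show "integrable lborel (\<lambda>y. \<bar>bump e (x - y) * (flux U y - flux U x)\<bar>)"
        using ib ic by (simp add: right_diff_distrib)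
      show "integrable lborel (\<lambda>y. \<omega> * bump e (x - y))" using ib by simp
      fix y
      show "\<bar>bump e (x - y) * (flux U y - flux U x)\<bar> \<le> \<omega> * bump e (x - y)"
      proof (cases "bump e (x - y) = 0")
        case False
        then have lt: "(x - y) \<bullet> (x - y) < e" using bump_eq_0[OF e(1)] by (meson not_le)
        then have "(norm (x - y))\<^sup>2 < \<delta>\<^sup>2" "(norm (x - y))\<^sup>2 < 1\<^sup>2"
          using e by (auto simp: power2_norm_eq_inner)
        then have d: "norm (x - y) < \<delta>" "norm (x - y) < 1" using \<delta>(1) by (auto intro: power2_less_imp_less)
        then have "y \<in> cball 0 3" "x \<in> cball 0 3"
          using True norm_triangle_ineq2[of y x] by (auto simp: norm_minus_commute)
        then have "\<bar>flux U y - flux U x\<bar> \<le> \<omega>"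
          using \<delta>(2)[of x y] d by (simp add: dist_norm norm_minus_commute less_imp_le)
        then show ?thesis using bump_nonneg[of e "x - y"] by (simp add: abs_mult mult.commute[of \<omega>] mult_left_mono)
      qed simp
    qed
    also have "\<dots> = \<omega> * mass" using m by simp
    finally show ?thesis unfolding eq .
  next
    case False
    then have "x \<notin> shell (1 / 4) 4"
      using power2_le_imp_le[of "norm x" 2] by (auto simp: shell_def power2_norm_eq_inner)
    moreover have "x \<notin> shell 1 2" using False shell_1_2_norm by force
    ultimately show ?thesis
      using conv_flux_support[OF bump_support[OF e(1,2)]] flux_support assms mass_pos by simp
  qed
  then show thesis using that e(1,2) by blast
qed

text \<open>Up to a small error, \<open>mass\<close> times the flux is its convolution with
  \<open>bump e\<close>, hence its convolution with \<open>far\<close> minus the Laplacian of its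
  potential. The two preceding bounds treat these pieces.\<close>

lemma pressure_bound:
  assumes E: "\<And>i x. \<bar>pd i eta x\<bar> \<le> E" and \<mu>: "0 < \<mu>"
  defines "V \<equiv> measure lborel (shell (1 / 4) 4 :: (real ^ 4) set)"
  shows "mass * \<bar>LBINT x. p x * flux U x\<bar>
    \<le> 16 * \<mu> * V + (16 * C ^ 3 * E * kernel_mass\<^sup>2 / \<mu> + 24 * C * far_mass) * (LBINT x. \<bar>flux U x\<bar>)"
    (is "_ \<le> ?B")
proof (rule field_le_epsilon)
  fix \<delta> :: real assume \<delta>: "0 < \<delta>"
  let ?T = "shell (1 / 4) 4 :: (real ^ 4) set"
  note flux = continuous_flux compact_shell[of 1 2] flux_support
  have sub: "?T \<subseteq> - {0}" by (rule shell_subset) simp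
  have pT: "continuous_on ?T p" using continuous_on_subset[OF Ck_on_continuous[OF Ck_p[of 0]] sub] .
  have ip: "integrable lborel (\<lambda>x. indicator ?T x * \<bar>p x\<bar>)"
    using borel_integrable_compact[OF compact_shell[of "1 / 4" 4], of "\<lambda>x. \<bar>p x\<bar>"] pT by (simp add: continuous_on_rabs)
  define P where "P = (LBINT x. indicator ?T x * \<bar>p x\<bar>)"
  have P: "0 \<le> P" by (simp add: P_def)
  \<comment> \<open>The approximation error is weighted by the L^1 norm P of the pressure on the
    shell. P has no uniform bound, but it is known before e is chosen; the 1 prevents division by
    zero.\<close>
  define \<omega> where "\<omega> = \<delta> / (mass * (P + 1))"
  have \<omega>: "0 < \<omega>" using \<delta> P mass_pos by (simp add: \<omega>_def)
  obtain e where e: "0 < e" "e \<le> 1 / 32" and ap: "\<And>x. \<bar>conv (bump e) (flux U) x - mass * flux U x\<bar> \<le> \<omega> * mass"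
    using mollified_flux[OF \<omega>] by metis
  have cb: "continuous_on UNIV (conv (bump e) (flux U))" "continuous_on UNIV (conv far (flux U))"
    using continuous_on_conv[OF continuous_on_bump flux] continuous_on_conv[OF continuous_far_derivatives(3) flux] by auto
  have iT: "integrable lborel (\<lambda>x. p x * f x)" if "continuous_on UNIV f" "\<And>x. x \<notin> ?T \<Longrightarrow> f x = 0" for f
    by (rule integrable_compact_support[OF compact_shell[of "1 / 4" 4]])
       (use that pT in \<open>auto intro!: continuous_on_mult intro: continuous_on_subset\<close>)
  have f0: "flux U x = 0" if "x \<notin> ?T" for x
    using that flux_support[of x] by (auto simp: shell_def)
  have i: "integrable lborel (\<lambda>x. p x * conv (bump e) (flux U) x)"
    "integrable lborel (\<lambda>x. p x * conv far (flux U) x)" "integrable lborel (\<lambda>x. p x * flux U x)"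
    by (rule iT[OF cb(1) conv_flux_support[OF bump_support[OF e]]], assumption+,
        rule iT[OF cb(2) conv_flux_support[OF far_support]], assumption+, rule iT[OF continuous_flux f0])
  have n: "Ck_on 2 UNIV (newton e)" using Ck_on_le[OF Ck_on_newton[OF e(1)]] by simp
  have lap: "laplacian (conv (newton e) (flux U)) x = conv far (flux U) x - conv (bump e) (flux U) x" for x
  proof -
    have "laplacian (newton e) = (\<lambda>x. far x - bump e x)" using laplacian_newton[OF e] by blast
    then show ?thesis
      using laplacian_conv[OF n flux] conv_diff[OF continuous_far_derivatives(3) continuous_on_bump flux] by simp
  qed
  have "\<bar>LBINT x. p x * (conv (bump e) (flux U) x - mass * flux U x)\<bar> \<le> (LBINT x. \<omega> * mass * (indicator ?T x * \<bar>p x\<bar>))"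
  proof (rule order_trans[OF integral_abs_bound], rule integral_mono)
    show "integrable lborel (\<lambda>x. \<bar>p x * (conv (bump e) (flux U) x - mass * flux U x)\<bar>)"
      using i by (simp add: right_diff_distrib mult.left_commute[of _ mass])
    show "integrable lborel (\<lambda>x. \<omega> * mass * (indicator ?T x * \<bar>p x\<bar>))" using ip by simp
    fix x
    show "\<bar>p x * (conv (bump e) (flux U) x - mass * flux U x)\<bar> \<le> \<omega> * mass * (indicator ?T x * \<bar>p x\<bar>)"
    proof (cases "x \<in> ?T")
      case True
      then show ?thesis using mult_left_mono[OF ap[of x] abs_ge_zero[of "p x"]] by (simp add: abs_mult mult_ac)
    next
      case False
      then have "x \<notin> shell 1 2" by (auto simp: shell_def)
      then show ?thesis using False conv_flux_support[OF bump_support[OF e] False] flux_support by simp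
    qed
  qed
  also have "\<dots> = \<omega> * mass * P" by (simp add: P_def)
  also have "\<dots> = \<delta> * (P / (P + 1))" using mass_pos by (simp add: \<omega>_def)
  also have "\<dots> \<le> \<delta>" using P \<delta> by (intro mult_left_le) auto
  finally have "\<bar>(LBINT x. p x * conv (bump e) (flux U) x) - mass * (LBINT x. p x * flux U x)\<bar> \<le> \<delta>"
    using i by (simp add: right_diff_distrib mult.left_commute[of _ mass])
  moreover have "(LBINT x. p x * conv (bump e) (flux U) x)
      = (LBINT x. p x * conv far (flux U) x) - (LBINT x. p x * laplacian (conv (newton e) (flux U)) x)"
    unfolding lap using i by (simp add: right_diff_distrib)
  moreover note potential_bound[OF E e \<mu>, folded V_def] far_bound
  ultimately have "\<bar>mass * (LBINT x. p x * flux U x)\<bar> \<le> ?B + \<delta>"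
    unfolding distrib_right by linarith
  then show "mass * \<bar>LBINT x. p x * flux U x\<bar> \<le> ?B + \<delta>"
    using mass_pos by (simp add: abs_mult)
qed

end

section \<open>A Liouville principle for annular fluxes\<close>

definition eta_at :: "real \<Rightarrow> real ^ 4 \<Rightarrow> real"
  where "eta_at r = (\<lambda>x. eta (0 + inverse r *\<^sub>R x))"

lemma scaled_shell:
  fixes x :: "real ^ 'n"
  assumes "0 < r"
  shows "inverse r *\<^sub>R x \<in> shell 1 2 \<longleftrightarrow> x \<in> shell (r\<^sup>2) (2 * r\<^sup>2)"
  using assms by (auto simp: shell_def field_simps power2_eq_square)

lemma Ck_on_eta_at: "Ck_on 4 S (eta_at r)"
proof -
  have "Ck_on 4 UNIV (eta_at r)"
    unfolding eta_at_def by (rule Ck_on_affine[OF _ _ Ck_on_eta[of UNIV]]) auto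
  then show ?thesis by (rule Ck_on_subset) simp
qed

lemma pd_eta_at: "pd i (eta_at r) x = inverse r * pd i eta (inverse r *\<^sub>R x)"
  unfolding eta_at_def
  by (subst pd_affine(2)) (use Ck_on_differentiable[OF Ck_on_eta[of UNIV]] in auto)

lemma laplacian_eta_at: "laplacian (eta_at r) x = (inverse r)\<^sup>2 * laplacian eta (inverse r *\<^sub>R x)"
  unfolding eta_at_def
  by (subst laplacian_affine[OF open_UNIV]) (use Ck_on_le[OF Ck_on_eta[of UNIV]] in auto)

lemma eta_at_deriv_eq_0:
  assumes "0 < r" "x \<notin> shell (r\<^sup>2) (2 * r\<^sup>2)"
  shows "pd i (eta_at r) x = 0" "laplacian (eta_at r) x = 0"
  using assms pd_eta_eq_0 laplacian_eta_eq_0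
  by (simp_all add: pd_eta_at laplacian_eta_at flip: scaled_shell)

lemma eta_at_le: "0 < r \<Longrightarrow> r \<le> R \<Longrightarrow> eta_at r x \<le> eta_at R x"
proof -
  assume r: "0 < r" "r \<le> R"
  have "(inverse R)\<^sup>2 \<le> (inverse r)\<^sup>2" using r by (intro power_mono le_imp_inverse_le) auto
  then have "(inverse R)\<^sup>2 * (x \<bullet> x) \<le> (inverse r)\<^sup>2 * (x \<bullet> x)" by (rule mult_right_mono) simp
  then show ?thesis by (simp add: eta_at_def eta_def power2_eq_square mult.assoc plateau_antimono)
qed

lemma eta_at_values:
  assumes "0 < r"
  shows "x \<bullet> x \<le> r\<^sup>2 \<Longrightarrow> eta_at r x = 1" "2 * r\<^sup>2 \<le> x \<bullet> x \<Longrightarrow> eta_at r x = 0"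
  using assms by (auto simp: eta_at_def field_simps power2_eq_square intro!: eta_simps)

text \<open>A scale invariant quantity when W behaves like |x|^(-2), and a tail of the integral of
  W/|x|^2 at either end; it dominates the cutoff errors at scale r.\<close>

definition annular :: "(real ^ 4 \<Rightarrow> real) \<Rightarrow> real \<Rightarrow> real"
  where "annular W r = (LBINT x. indicator (shell (r\<^sup>2) (2 * r\<^sup>2)) x * (W x / (x \<bullet> x)))"

text \<open>Collects the terms in which a derivative falls on the cutoff: Green's identity,
  transport, and the Hardy field.\<close>

definition boundary_density ::
    "(real ^ 4 \<Rightarrow> real) \<Rightarrow> (4 \<Rightarrow> real ^ 4 \<Rightarrow> real) \<Rightarrow> (real ^ 4 \<Rightarrow> real) \<Rightarrow> (real ^ 4 \<Rightarrow> real) \<Rightarrow> real ^ 4 \<Rightarrow> real"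
  where "boundary_density W U Q \<phi> x = W x / 2 * laplacian \<phi> x + (\<Sum>i\<in>UNIV. Q x * U i x * pd i \<phi> x)
    - (\<Sum>i\<in>UNIV. x $ i * pd i \<phi> x) * (W x / (x \<bullet> x))"

lemma Ck_on_coord_field: "Ck_on k (- {0}) (\<lambda>x :: real ^ 'n. x $ j * inverse (x \<bullet> x))"
  by (intro Ck_on_mult Ck_on_coord Ck_on_inverse[OF _ _ Ck_on_inner_self]) auto

text \<open>The numerator is n - 2 for n = 4. It exceeds the coefficient 3/2 allowed in
  \<open>energy_hardy\<close>, and the excess is what makes the method work.\<close>

lemma div_coord_field:
  fixes x :: "real ^ 4"
  assumes "x \<noteq> 0"
  shows "(\<Sum>j\<in>UNIV. pd j (\<lambda>x. x $ j * inverse (x \<bullet> x)) x) = 2 / (x \<bullet> x)"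
proof -
  have s: "x \<bullet> x \<noteq> 0" using assms by simp
  have "pd j (\<lambda>x. x $ j * inverse (x \<bullet> x)) x = x $ j * (2 * x $ j * (- (inverse (x \<bullet> x) ^ 2))) + inverse (x \<bullet> x)" for j
  proof (subst pd_mult)
    have D: "(inverse has_real_derivative - (inverse (x \<bullet> x) ^ 2)) (at (x \<bullet> x))"
      using DERIV_inverse[OF s, of UNIV] by (simp add: numeral_eq_Suc)
    show "(\<lambda>x. inverse (x \<bullet> x)) differentiable at x"
      by (rule differentiable_chain_real[OF differentiable_inner_self D])
    show "x $ j * pd j (\<lambda>x. inverse (x \<bullet> x)) x + pd j (\<lambda>x. x $ j) x * inverse (x \<bullet> x)
       = x $ j * (2 * x $ j * (- (inverse (x \<bullet> x) ^ 2))) + inverse (x \<bullet> x)"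
      using pd_radial[OF D, of j] by (simp add: pd_coord)
    show "(\<lambda>x. x $ j) differentiable at x" by (rule Ck_on_differentiable[OF Ck_on_coord[of 1 UNIV]]) auto
  qed
  then have "(\<Sum>j\<in>UNIV. pd j (\<lambda>x. x $ j * inverse (x \<bullet> x)) x)
      = - 2 * inverse (x \<bullet> x) ^ 2 * (\<Sum>j\<in>UNIV. x $ j * x $ j) + 4 * inverse (x \<bullet> x)"
    by (simp add: sum.distrib sum_subtractf sum_distrib_left mult_ac sum_negf)
  also have "(\<Sum>j\<in>UNIV. x $ j * x $ j) = x \<bullet> x" by (simp add: inner_vec_def)
  finally show ?thesis using s by (simp add: field_simps power2_eq_square)
qed

lemma pd_mult3:
  fixes f g h :: "real ^ 'n \<Rightarrow> real"
  assumes "f differentiable (at x)" "g differentiable (at x)" "h differentiable (at x)"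
  shows "pd i (\<lambda>x. f x * g x * h x) x = pd i f x * g x * h x + f x * pd i g x * h x + f x * g x * pd i h x"
  using assms by (simp add: pd_mult algebra_simps)

text \<open>Green's identity for \<open>W / 2\<close>, the transport term, and the Hardy vector field \<open>x / |x|\<^sup>2\<close> are
  combined in a single divergence.\<close>

lemma energy_hardy:
  fixes W Q \<phi> :: "real ^ 4 \<Rightarrow> real" and U :: "4 \<Rightarrow> real ^ 4 \<Rightarrow> real"
  assumes W: "Ck_on 2 (- {0}) W" and Q: "Ck_on 1 (- {0}) Q" and U: "\<And>i. Ck_on 1 (- {0}) (U i)"
    and div: "\<And>x. x \<noteq> 0 \<Longrightarrow> (\<Sum>i\<in>UNIV. pd i (U i) x) = 0"
    and sub: "\<And>x. x \<noteq> 0 \<Longrightarrow> - (\<Sum>i\<in>UNIV. x $ i * pd i W x) / (x \<bullet> x)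
      \<le> 3 / 2 * (W x / (x \<bullet> x)) + (laplacian W x / 2 - (\<Sum>i\<in>UNIV. U i x * pd i Q x))"
    and \<phi>: "Ck_on 2 (- {0}) \<phi>" "\<And>x. 0 \<le> \<phi> x" and T: "compact T" "T \<subseteq> - {0}" "\<And>x. x \<notin> T \<Longrightarrow> \<phi> x = 0"
  shows "(LBINT x. \<phi> x * (W x / (x \<bullet> x))) \<le> 2 * (LBINT x. boundary_density W U Q \<phi> x)"
proof -
  define N where "N j = (\<lambda>x :: real ^ 4. x $ j * inverse (x \<bullet> x))" for j
  \<comment> \<open>The vector field is (phi grad W - W grad phi)/2 - phi Q U + phi W x/|x|^2; its
    divergence integrates to zero.\<close>
  define J where "J j = (\<lambda>x. 1 / 2 * (\<phi> x * pd j W x) - 1 / 2 * (W x * pd j \<phi> x) - \<phi> x * Q x * U j x + \<phi> x * W x * N j x)" for j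
  define Jd where "Jd j x = 1 / 2 * (\<phi> x * pd j (pd j W) x + pd j \<phi> x * pd j W x)
      - 1 / 2 * (W x * pd j (pd j \<phi>) x + pd j W x * pd j \<phi> x)
      - (pd j \<phi> x * Q x * U j x + \<phi> x * pd j Q x * U j x + \<phi> x * Q x * pd j (U j) x)
      + (pd j \<phi> x * W x * N j x + \<phi> x * pd j W x * N j x + \<phi> x * W x * pd j (N j) x)" for j x
  have C1: "Ck_on 1 (- {0}) W" "Ck_on 1 (- {0}) \<phi>" "Ck_on 1 (- {0}) (pd j W)" "Ck_on 1 (- {0}) (pd j \<phi>)"
    "Ck_on 1 (- {0}) (N j)" for j
    using W \<phi>(1) Ck_on_le[OF W, of 1] Ck_on_le[OF \<phi>(1), of 1] Ck_on_coord_field[where k = 1]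
    by (simp_all add: numeral_2_eq_2 N_def)
  note diff = C1[THEN Ck_on_differentiable] Q[THEN Ck_on_differentiable] U[THEN Ck_on_differentiable]
  have Jd: "pd j (J j) x = Jd j x" if "x \<noteq> 0" for j x
  proof -
    have x: "x \<in> - {0}" using that by simp
    note d = diff[OF zero_less_one x]
    have d12: "(\<lambda>x. \<phi> x * pd j W x) differentiable (at x)" "(\<lambda>x. W x * pd j \<phi> x) differentiable (at x)"
      "(\<lambda>x. \<phi> x * Q x * U j x) differentiable (at x)" "(\<lambda>x. \<phi> x * W x * N j x) differentiable (at x)"
      by (intro differentiable_mult d)+
    have d34: "(\<lambda>x. 1 / 2 * (\<phi> x * pd j W x)) differentiable (at x)" "(\<lambda>x. 1 / 2 * (W x * pd j \<phi> x)) differentiable (at x)"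
      by (intro differentiable_mult differentiable_const d)+
    show ?thesis
      unfolding J_def Jd_def
      by (subst pd_add pd_diff pd_cmult pd_mult3 pd_mult; (intro differentiable_diff d12 d34 d)?)+ simp
  qed
  have J1: "Ck_on (Suc 0) (- {0}) (J j)" for j
    unfolding J_def using C1 Q U by (intro Ck_on_add Ck_on_diff Ck_on_mult Ck_on_const) auto
  have J0: "J j x = 0" if "x \<notin> T" for j x
    using T(3)[OF that] pd_eq_0[OF compact_imp_closed[OF T(1)] T(3) that] by (simp add: J_def)
  have pJ0: "pd j (J j) x = 0" if "x \<notin> T" for j x
    by (rule pd_eq_0[OF compact_imp_closed[OF T(1)] _ that]) (rule J0)
  have iJ: "integrable lborel (pd j (J j))" for j
    by (rule integrable_compact_support[OF T(1) _ pJ0])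
       (use J1[of j] T(2) in \<open>auto intro: continuous_on_subset\<close>)
  have "(LBINT x. (\<Sum>j\<in>UNIV. pd j (J j) x)) = (\<Sum>j\<in>UNIV. LBINT x. pd j (J j) x)"
    using iJ by (intro Bochner_Integration.integral_sum) auto
  also have "\<dots> = 0"
    by (intro sum.neutral ballI integral_pd_eq_0[OF open_punctured J1 T(1,2) J0])
  finally have zero: "(LBINT x. (\<Sum>j\<in>UNIV. pd j (J j) x)) = 0" .
  have cT: "continuous_on T W" "continuous_on T Q" "continuous_on T (U j)" "continuous_on T \<phi>" "continuous_on T (pd j \<phi>)"
     "continuous_on T (pd j (pd j \<phi>))" "continuous_on T (N j)" for j
    by (rule continuous_on_subset[OF _ T(2)], use C1 Q U C1[THEN Ck_on_continuous] Q[THEN Ck_on_continuous] U[THEN Ck_on_continuous] in auto)+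
  have \<phi>1: "pd j \<phi> x = 0" "laplacian \<phi> x = 0" if "x \<notin> T" for j x
    by (rule pd_eq_0[OF compact_imp_closed[OF T(1)] T(3) that], assumption,
        rule laplacian_support[OF compact_imp_closed[OF T(1)] T(3) that])
  have cl: "continuous_on T (laplacian \<phi>)" unfolding laplacian_def[abs_def] by (intro continuous_intros cT)
  have nz: "x \<bullet> x \<noteq> 0" if "x \<in> T" for x using that T(2) by auto
  have ib: "integrable lborel (boundary_density W U Q \<phi>)"
    by (rule integrable_compact_support[OF T(1)])
       (auto simp: boundary_density_def[abs_def] \<phi>1 intro!: continuous_intros cT cl nz)
  have ih: "integrable lborel (\<lambda>x. \<phi> x * (W x / (x \<bullet> x)))"
    by (rule integrable_compact_support[OF T(1)]) (auto simp: T(3) intro!: continuous_intros cT nz)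
  have "(LBINT x. 1 / 2 * (\<phi> x * (W x / (x \<bullet> x))) - boundary_density W U Q \<phi> x) \<le> (LBINT x. (\<Sum>j\<in>UNIV. pd j (J j) x))"
  proof (rule integral_mono)
    show "integrable lborel (\<lambda>x. 1 / 2 * (\<phi> x * (W x / (x \<bullet> x))) - boundary_density W U Q \<phi> x)"
      by (intro Bochner_Integration.integrable_diff integrable_mult_right ib ih)
    show "integrable lborel (\<lambda>x. \<Sum>j\<in>UNIV. pd j (J j) x)" using iJ by simp
    fix x
    show "1 / 2 * (\<phi> x * (W x / (x \<bullet> x))) - boundary_density W U Q \<phi> x \<le> (\<Sum>j\<in>UNIV. pd j (J j) x)"
    proof (cases "x \<in> T")
      case False
      then show ?thesis using T(3) \<phi>1 pJ0 by (simp add: boundary_density_def)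
    next
      case True
      then have x: "x \<noteq> 0" "x \<bullet> x \<noteq> 0" using T(2) by auto
      have "(\<Sum>j\<in>UNIV. pd j (J j) x) = (\<Sum>j\<in>UNIV. Jd j x)" using Jd[OF x(1)] by simp
      also have "\<dots> = \<phi> x * (\<Sum>j\<in>UNIV. pd j (pd j W) x) / 2 - W x / 2 * (\<Sum>j\<in>UNIV. pd j (pd j \<phi>) x)
          - (\<Sum>j\<in>UNIV. Q x * U j x * pd j \<phi> x) - \<phi> x * (\<Sum>j\<in>UNIV. U j x * pd j Q x)
          - \<phi> x * Q x * (\<Sum>j\<in>UNIV. pd j (U j) x)
          + W x * (\<Sum>j\<in>UNIV. N j x * pd j \<phi> x) + \<phi> x * (\<Sum>j\<in>UNIV. N j x * pd j W x)
          + \<phi> x * W x * (\<Sum>j\<in>UNIV. pd j (N j) x)"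
        unfolding sum_distrib_left sum_divide_distrib sum_subtractf[symmetric] sum.distrib[symmetric] Jd_def
        by (rule sum.cong) (simp_all add: algebra_simps)
      also have "(\<Sum>j\<in>UNIV. pd j (N j) x) = 2 / (x \<bullet> x)" unfolding N_def by (rule div_coord_field[OF x(1)])
      also have "(\<Sum>j\<in>UNIV. N j x * pd j \<phi> x) = (\<Sum>j\<in>UNIV. x $ j * pd j \<phi> x) / (x \<bullet> x)"
        by (simp add: N_def sum_distrib_left divide_inverse mult_ac)
      also have "(\<Sum>j\<in>UNIV. N j x * pd j W x) = (\<Sum>j\<in>UNIV. x $ j * pd j W x) / (x \<bullet> x)"
        by (simp add: N_def sum_distrib_left divide_inverse mult_ac)
      also have "(\<Sum>j\<in>UNIV. pd j (U j) x) = 0" by (rule div[OF x(1)])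
      finally have eq: "(\<Sum>j\<in>UNIV. pd j (J j) x) = - boundary_density W U Q \<phi> x
          + \<phi> x * ((laplacian W x / 2 - (\<Sum>j\<in>UNIV. U j x * pd j Q x)) + (\<Sum>j\<in>UNIV. x $ j * pd j W x) / (x \<bullet> x)
            + 2 * (W x / (x \<bullet> x)))"
        by (simp add: boundary_density_def laplacian_def algebra_simps)
      \<comment> \<open>The Hardy field supplies 2 and the hypothesis \<open>sub\<close> takes 3/2;
        the remaining 1/2 accounts for the factor 2 in the conclusion.\<close>
      have "1 / 2 * (W x / (x \<bullet> x)) \<le> (laplacian W x / 2 - (\<Sum>j\<in>UNIV. U j x * pd j Q x)) + (\<Sum>j\<in>UNIV. x $ j * pd j W x) / (x \<bullet> x)
            + 2 * (W x / (x \<bullet> x))"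
        using sub[OF x(1)] by (simp add: minus_divide_left[symmetric] del: minus_divide_left) 
      from mult_left_mono[OF this \<phi>(2)[of x]] show ?thesis unfolding eq by simp
    qed
  qed
  also have "(LBINT x. 1 / 2 * (\<phi> x * (W x / (x \<bullet> x))) - boundary_density W U Q \<phi> x)
      = 1 / 2 * (LBINT x. \<phi> x * (W x / (x \<bullet> x))) - (LBINT x. boundary_density W U Q \<phi> x)"
    by (subst Bochner_Integration.integral_diff) (intro integrable_mult_right ib ih | simp only: integral_mult_right_zero)+
  finally show ?thesis using zero by simp
qed


lemma measure_scaled_shell:
  assumes "0 < r"
  shows "measure lborel (shell (r\<^sup>2) (2 * r\<^sup>2) :: (real ^ 4) set) = r ^ 4 * measure lborel (shell 1 2 :: (real ^ 4) set)"
proof -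
  have "indicator (shell (r\<^sup>2) (2 * r\<^sup>2)) (0 + r *\<^sub>R x) = (indicator (shell 1 2) x :: real)" for x :: "real ^ 4"
    using assms scaled_shell[of r "r *\<^sub>R x"] by (auto simp: indicator_def)
  then show ?thesis
    using lborel_integral_affine[of "indicator (shell (r\<^sup>2) (2 * r\<^sup>2) :: (real ^ 4) set)" r 0] assms by simp
qed

text \<open>The integrand is at most B/r^4 and the annulus has volume proportional to r^4, so the
  bound is the same at every scale.\<close>

lemma annular_bounds:
  assumes W: "continuous_on (- {0}) W" "\<And>x. x \<noteq> 0 \<Longrightarrow> 0 \<le> W x" "\<And>x. x \<noteq> 0 \<Longrightarrow> W x \<le> B / (x \<bullet> x)"
    and r: "0 < r"
  shows "0 \<le> annular W r \<and> annular W r \<le> B * measure lborel (shell 1 2 :: (real ^ 4) set)"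
proof -
  have r2: "0 < r\<^sup>2" using r by simp
  let ?A = "shell (r\<^sup>2) (2 * r\<^sup>2) :: (real ^ 4) set"
  have B: "0 \<le> B" using W(2,3)[of "axis 1 1"] by (simp add: inner_axis_axis axis_eq_0_iff)
  have "0 \<le> annular W r"
    unfolding annular_def
  proof (intro integral_nonneg_AE AE_I2)
    show "0 \<le> indicator ?A x * (W x / (x \<bullet> x))" for x
      using W(2)[of x] by (cases "x = 0") auto
  qed
  moreover have "annular W r \<le> (LBINT x. B / r ^ 4 * indicator ?A x)"
    unfolding annular_def
  proof (rule integral_mono[OF integrable_shell_quotient[OF W(1) r2]])
    show "integrable lborel (\<lambda>x. B / r ^ 4 * indicator ?A x)"
      by (intro integrable_mult_right integrable_indicator_shell)
    fix x :: "real ^ 4"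
    show "indicator ?A x * (W x / (x \<bullet> x)) \<le> B / r ^ 4 * indicator ?A x"
    proof (cases "x \<in> ?A")
      case True
      then have s: "r\<^sup>2 \<le> x \<bullet> x" by (simp add: shell_def)
      then have x: "0 < x \<bullet> x" "x \<noteq> 0" using r2 by auto
      have "W x / (x \<bullet> x) \<le> B / (x \<bullet> x) / (x \<bullet> x)" using W(3)[OF x(2)] x(1) by (intro divide_right_mono) auto
      also have "\<dots> = B / (x \<bullet> x)\<^sup>2" by (simp add: power2_eq_square)
      also have "\<dots> \<le> B / (r\<^sup>2)\<^sup>2" using s r2 B x by (intro divide_left_mono power_mono mult_pos_pos) auto
      finally show ?thesis using True by simp
    qed simp
  qed
  moreover have "(LBINT x. B / r ^ 4 * indicator ?A x) = B * measure lborel (shell 1 2 :: (real ^ 4) set)"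
    using r measure_scaled_shell[OF r] by simp
  ultimately show "0 \<le> annular W r \<and> annular W r \<le> B * measure lborel (shell 1 2 :: (real ^ 4) set)" by simp
qed

text \<open>Each derivative of the cutoff costs 1/r, comparable to 1/|x| on the annulus, so the
  terms with W reduce to \<open>annular\<close>: E from the Laplacian and 8E from the Hardy field.
  The transport term is carried along.\<close>

lemma boundary_bound:
  assumes W: "continuous_on (- {0}) W" "\<And>x. x \<noteq> 0 \<Longrightarrow> 0 \<le> W x"
    and Q: "continuous_on (- {0}) Q" and U: "\<And>i. continuous_on (- {0}) (U i)"
    and E: "\<And>i x. \<bar>pd i eta x\<bar> \<le> E" "\<And>x. \<bar>laplacian eta x\<bar> \<le> E" and r: "0 < r"
  shows "integrable lborel (boundary_density W U Q (eta_at r))"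
    and "\<bar>LBINT x. boundary_density W U Q (eta_at r) x\<bar>
      \<le> \<bar>LBINT x. (\<Sum>i\<in>UNIV. Q x * U i x * pd i (eta_at r) x)\<bar> + 9 * E * annular W r"
proof -
  let ?A = "shell (r\<^sup>2) (2 * r\<^sup>2) :: (real ^ 4) set"
  define b1 where "b1 x = W x / 2 * laplacian (eta_at r) x" for x
  define b2 where "b2 x = (\<Sum>i\<in>UNIV. Q x * U i x * pd i (eta_at r) x)" for x
  define b3 where "b3 x = (\<Sum>i\<in>UNIV. x $ i * pd i (eta_at r) x) * (W x / (x \<bullet> x))" for x
  have A: "?A \<subseteq> - {0}" using r by (intro shell_subset) simp
  have nz: "x \<bullet> x \<noteq> 0" if "x \<in> ?A" for x using that A by auto
  have c: "continuous_on ?A W" "continuous_on ?A Q" "continuous_on ?A (U i)" "continuous_on ?A (pd i (eta_at r))"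
    "continuous_on ?A (laplacian (eta_at r))" for i
    using W(1) Q U[of i] Ck_on_continuous[OF Ck_on_pd[of 3 UNIV "eta_at r" i]]
      Ck_on_continuous[OF Ck_on_laplacian[OF open_UNIV, of 2 "eta_at r"]] Ck_on_eta_at[of UNIV r]
    by (auto intro: continuous_on_subset[OF _ A] continuous_on_subset[OF _ subset_UNIV])
  have i: "integrable lborel b1" "integrable lborel b2" "integrable lborel b3"
    by (rule integrable_compact_support[of ?A];
        auto simp: b1_def[abs_def] b2_def[abs_def] b3_def[abs_def] eta_at_deriv_eq_0[OF r] intro!: continuous_intros c nz)+
  have bd: "boundary_density W U Q (eta_at r) x = b1 x + b2 x - b3 x" for x
    by (simp add: boundary_density_def b1_def b2_def b3_def)
  then show "integrable lborel (boundary_density W U Q (eta_at r))"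
    using i by (simp add: bd[abs_def] ext)
  have iA: "integrable lborel (\<lambda>x. indicator ?A x * (W x / (x \<bullet> x)))"
    by (rule integrable_shell_quotient[OF W(1)]) (use r in simp)
  have E0: "0 \<le> E" using E(1)[of 0 0] by linarith
  have 1: "\<bar>LBINT x. b1 x\<bar> \<le> E * annular W r"
  proof -
    have "\<bar>LBINT x. b1 x\<bar> \<le> (LBINT x. E * (indicator ?A x * (W x / (x \<bullet> x))))"
    proof (rule order_trans[OF integral_abs_bound], rule integral_mono)
      fix x
      show "\<bar>b1 x\<bar> \<le> E * (indicator ?A x * (W x / (x \<bullet> x)))"
      proof (cases "x \<in> ?A")
        case True
        then have x: "x \<noteq> 0" "0 < x \<bullet> x" "x \<bullet> x \<le> 2 * r\<^sup>2" using A by (auto simp: shell_def)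
        have "\<bar>laplacian (eta_at r) x\<bar> \<le> (inverse r)\<^sup>2 * E"
          unfolding laplacian_eta_at abs_mult using E(2) by (intro mult_mono) auto
        also have "\<dots> \<le> 2 * E / (x \<bullet> x)"
          using x r E0 mult_left_mono[OF x(3) E0] by (simp add: field_simps)
        finally have "\<bar>b1 x\<bar> \<le> W x / 2 * (2 * E / (x \<bullet> x))"
          unfolding b1_def abs_mult using W(2)[OF x(1)] by (intro mult_mono) auto
        then show ?thesis using True by (simp add: mult_ac)
      qed (simp add: b1_def eta_at_deriv_eq_0[OF r])
    qed (intro integrable_abs i integrable_mult_right iA)+
    then show ?thesis by (simp only: annular_def integral_mult_right_zero)
  qed
  have 3: "\<bar>LBINT x. b3 x\<bar> \<le> 8 * E * annular W r"
  proof -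
    have "\<bar>LBINT x. b3 x\<bar> \<le> (LBINT x. 8 * E * (indicator ?A x * (W x / (x \<bullet> x))))"
    proof (rule order_trans[OF integral_abs_bound], rule integral_mono)
      fix x
      show "\<bar>b3 x\<bar> \<le> 8 * E * (indicator ?A x * (W x / (x \<bullet> x)))"
      proof (cases "x \<in> ?A")
        case True
        then have x: "x \<noteq> 0" "x \<bullet> x \<le> 2 * r\<^sup>2" using A by (auto simp: shell_def)
        have "x \<bullet> x \<le> 4 * r\<^sup>2" using x(2) zero_le_power2[of r] by linarith
        then have "(norm x)\<^sup>2 \<le> (2 * r)\<^sup>2" by (simp add: power2_norm_eq_inner power_mult_distrib)
        then have n: "norm x \<le> 2 * r" by (rule power2_le_imp_le) (use r in simp)
        have "\<bar>\<Sum>i\<in>UNIV. x $ i * pd i (eta_at r) x\<bar> \<le> (\<Sum>i\<in>(UNIV :: 4 set). (2 * r) * (inverse r * E))"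
        proof (rule order_trans[OF sum_abs], rule sum_mono)
          fix i
          have "\<bar>x $ i\<bar> \<le> 2 * r" using component_le_norm_cart[of x i] n by linarith
          moreover have "\<bar>pd i (eta_at r) x\<bar> \<le> inverse r * E"
            unfolding pd_eta_at abs_mult using E(1) r by (intro mult_mono) auto
          ultimately show "\<bar>x $ i * pd i (eta_at r) x\<bar> \<le> (2 * r) * (inverse r * E)"
            unfolding abs_mult using r by (intro mult_mono) auto
        qed
        also have "\<dots> = 8 * E" using r by simp
        finally have "\<bar>b3 x\<bar> \<le> 8 * E * (W x / (x \<bullet> x))"
          unfolding b3_def abs_mult using W(2)[OF x(1)] by (intro mult_mono) auto
        then show ?thesis using True by simp
      qed (simp add: b3_def eta_at_deriv_eq_0[OF r])
    qed (intro integrable_abs i integrable_mult_right iA)+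
    then show ?thesis by (simp only: annular_def integral_mult_right_zero)
  qed
  have "(LBINT x. boundary_density W U Q (eta_at r) x) = (LBINT x. b1 x) + (LBINT x. b2 x) - (LBINT x. b3 x)"
    unfolding bd using i by simp
  then show "\<bar>LBINT x. boundary_density W U Q (eta_at r) x\<bar>
      \<le> \<bar>LBINT x. (\<Sum>i\<in>UNIV. Q x * U i x * pd i (eta_at r) x)\<bar> + 9 * E * annular W r"
    using 1 3 unfolding b2_def by linarith
qed

text \<open>The bound \<open>flux\<close> is exploited twice. For one fixed \<open>\<kappa>\<close>
  it gives integrability of W/|x|^2, which makes the annular integrals vanish in the limit. M may
  grow as \<open>\<kappa>\<close> shrinks, so \<open>\<kappa>\<close> is kept fixed during that
  limit.\<close>

lemma liouville:
  fixes W Q :: "real ^ 4 \<Rightarrow> real" and U :: "4 \<Rightarrow> real ^ 4 \<Rightarrow> real"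
  assumes W: "Ck_on 2 (- {0}) W" "\<And>x. x \<noteq> 0 \<Longrightarrow> 0 \<le> W x" "\<And>x. x \<noteq> 0 \<Longrightarrow> W x \<le> B / (x \<bullet> x)"
    and Q: "Ck_on 1 (- {0}) Q" and U: "\<And>i. Ck_on 1 (- {0}) (U i)"
    and div: "\<And>x. x \<noteq> 0 \<Longrightarrow> (\<Sum>i\<in>UNIV. pd i (U i) x) = 0"
    and sub: "\<And>x. x \<noteq> 0 \<Longrightarrow> - (\<Sum>i\<in>UNIV. x $ i * pd i W x) / (x \<bullet> x)
      \<le> 3 / 2 * (W x / (x \<bullet> x)) + (laplacian W x / 2 - (\<Sum>i\<in>UNIV. U i x * pd i Q x))"
    and flux: "\<And>\<kappa>. 0 < \<kappa> \<Longrightarrow> \<exists>M. \<forall>r>0. \<bar>LBINT x. (\<Sum>i\<in>UNIV. Q x * U i x * pd i (eta_at r) x)\<bar> \<le> \<kappa> + M * annular W r"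
    and "x \<noteq> 0"
  shows "W x = 0"
proof -
  note cont = Ck_on_continuous[OF W(1)] Ck_on_continuous[OF Q] Ck_on_continuous[OF U]
  obtain E where E: "0 < E" "\<And>i x. \<bar>pd i eta x\<bar> \<le> E" "\<And>x. \<bar>laplacian eta x\<bar> \<le> E" using eta_bounded by metis
  define V where "V = B * measure lborel (shell 1 2 :: (real ^ 4) set)"
  have ann: "0 \<le> annular W r" "annular W r \<le> V" if "0 < r" for r
    using annular_bounds[OF cont(1) W(2,3) that] by (simp_all add: V_def)
  have iS: "integrable lborel (\<lambda>x. indicator (shell a b) x * (W x / (x \<bullet> x)))" if "0 < a" for a b
    by (rule integrable_shell_quotient[OF cont(1) that])
  have main: "\<exists>M\<ge>0. \<forall>r R. 0 < r \<longrightarrow> r \<le> R \<longrightarrow>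
      (LBINT x. indicator (shell (2 * r\<^sup>2) (R\<^sup>2)) x * (W x / (x \<bullet> x))) \<le> \<kappa> + M * (annular W r + annular W R)"
    if \<kappa>: "0 < \<kappa>" for \<kappa>
  proof -
    \<comment> \<open>A quarter, because two boundary terms enter and \<open>energy_hardy\<close>
      doubles them.\<close>
    obtain M where M: "\<And>r. 0 < r \<Longrightarrow> \<bar>LBINT x. (\<Sum>i\<in>UNIV. Q x * U i x * pd i (eta_at r) x)\<bar> \<le> \<kappa> / 4 + M * annular W r"
      using flux[of "\<kappa> / 4"] \<kappa> by auto
    have bb: "\<bar>LBINT x. boundary_density W U Q (eta_at r) x\<bar> \<le> \<kappa> / 4 + (\<bar>M\<bar> + 9 * E) * annular W r" if "0 < r" for r
      using boundary_bound(2)[where U = U, OF cont(1) W(2) cont(2,3) E(2,3) that] M[OF that]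
        mult_right_mono[OF abs_ge_self[of M] ann(1)[OF that]] by (simp add: distrib_right)
    have "(LBINT x. indicator (shell (2 * r\<^sup>2) (R\<^sup>2)) x * (W x / (x \<bullet> x)))
        \<le> \<kappa> + 2 * (\<bar>M\<bar> + 9 * E) * (annular W r + annular W R)" if r: "0 < r" "r \<le> R" for r R
    proof -
      have R: "0 < R" using r by simp
      define \<phi> where "\<phi> x = eta_at R x - eta_at r x" for x
      have "r\<^sup>2 \<le> R\<^sup>2" using r by (intro power_mono) auto
      have \<phi>0: "\<phi> x = 0" if "x \<notin> shell (r\<^sup>2) (2 * R\<^sup>2)" for x
        using not_shellD[OF that] eta_at_values[OF r(1), of x] eta_at_values[OF R, of x] \<open>r\<^sup>2 \<le> R\<^sup>2\<close>
        by (auto simp: \<phi>_def)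
      have C\<phi>: "Ck_on 4 UNIV \<phi>" unfolding \<phi>_def by (intro Ck_on_diff Ck_on_eta_at) auto
      have \<phi>2: "Ck_on 2 (- {0}) \<phi>" by (rule Ck_on_subset[OF Ck_on_le[OF C\<phi>]]) auto
      have \<phi>_nonneg: "0 \<le> \<phi> x" for x using eta_at_le[OF r] by (simp add: \<phi>_def)
      have sub0: "shell (r\<^sup>2) (2 * R\<^sup>2) \<subseteq> - {0 :: real ^ 4}" using r by (intro shell_subset) simp
      have "continuous_on (shell (r\<^sup>2) (2 * R\<^sup>2)) (\<lambda>x. \<phi> x * (W x / (x \<bullet> x)))"
        using sub0 by (intro continuous_intros continuous_on_subset[OF cont(1)] continuous_on_subset[OF Ck_on_continuous[OF C\<phi>]]) auto
      then have i\<phi>: "integrable lborel (\<lambda>x. \<phi> x * (W x / (x \<bullet> x)))"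
        by (rule integrable_compact_support[OF compact_shell]) (simp add: \<phi>0)
      have "(LBINT x. indicator (shell (2 * r\<^sup>2) (R\<^sup>2)) x * (W x / (x \<bullet> x))) \<le> (LBINT x. \<phi> x * (W x / (x \<bullet> x)))"
      proof (rule integral_mono[OF iS i\<phi>])
        show "indicator (shell (2 * r\<^sup>2) (R\<^sup>2)) x * (W x / (x \<bullet> x)) \<le> \<phi> x * (W x / (x \<bullet> x))" for x
        proof (cases "x = 0")
          case False
          have "\<phi> x = 1" if "x \<in> shell (2 * r\<^sup>2) (R\<^sup>2)"
            using that eta_at_values[OF r(1), of x] eta_at_values[OF R, of x] by (simp add: \<phi>_def shell_def)
          then have "indicator (shell (2 * r\<^sup>2) (R\<^sup>2)) x \<le> \<phi> x" using \<phi>_nonneg by (simp add: indicator_def)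
          then show ?thesis using W(2)[OF False] by (intro mult_right_mono) auto
        qed simp
      qed (use r in simp)
      also have "\<dots> \<le> 2 * (LBINT x. boundary_density W U Q \<phi> x)"
        by (rule energy_hardy[OF W(1) Q U div sub \<phi>2 \<phi>_nonneg compact_shell sub0 \<phi>0])
      also have "(LBINT x. boundary_density W U Q \<phi> x)
          = (LBINT x. boundary_density W U Q (eta_at R) x) - (LBINT x. boundary_density W U Q (eta_at r) x)"
      proof -
        have d: "eta_at s differentiable (at x)" "pd i (eta_at s) differentiable (at x)" for s x i
          using Ck_on_eta_at[of UNIV s] by (simp_all add: numeral_eq_Suc)
        have p: "pd i \<phi> = (\<lambda>x. pd i (eta_at R) x - pd i (eta_at r) x)" for i
          unfolding \<phi>_def[abs_def] by (rule ext) (rule pd_diff[OF d(1) d(1)])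
        have l: "laplacian \<phi> x = laplacian (eta_at R) x - laplacian (eta_at r) x" for x
          unfolding laplacian_def p pd_diff[OF d(2) d(2)] by (rule sum_subtractf)
        have "boundary_density W U Q \<phi> x = boundary_density W U Q (eta_at R) x - boundary_density W U Q (eta_at r) x" for x
          unfolding boundary_density_def l p by (simp add: algebra_simps sum_subtractf)
        then show ?thesis
          using boundary_bound(1)[where U = U, OF cont(1) W(2) cont(2,3) E(2,3)] r R by simp
      qed
      finally show ?thesis using bb[OF r(1)] bb[OF R] by (simp add: algebra_simps abs_le_iff) 
    qed
    then show ?thesis using E(1) by (intro exI[of _ "2 * (\<bar>M\<bar> + 9 * E)"]) auto
  qed
  define F where "F x = (if x = 0 then 0 else W x / (x \<bullet> x))" for x
  have F_nonneg: "0 \<le> F x" for x using W(2) by (simp add: F_def)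
  \<comment> \<open>The shells \<open>D n\<close> below increase to the punctured space, while the
    annuli at scales r n and R n escape to the origin and to infinity.\<close>
  define R where "R n = real (Suc n)" for n
  define r where "r n = 1 / (2 * real (Suc n))" for n
  have rR: "0 < r n" "r n \<le> R n" "0 < R n" for n
  proof -
    have "1 \<le> 2 * real (Suc n) * real (Suc n)" using mult_mono[of 1 "2 * real (Suc n)" 1 "real (Suc n)"] by simp
    then show "0 < r n" "r n \<le> R n" "0 < R n" by (simp_all add: r_def R_def field_simps)
  qed
  define D where "D n = (shell (2 * (r n)\<^sup>2) ((R n)\<^sup>2) :: (real ^ 4) set)" for n
  have r2: "0 < 2 * (r n)\<^sup>2" for n using rR(1)[of n] by simp
  have inDF: "indicator (shell a b) x * (W x / (x \<bullet> x)) = indicator (shell a b) x * F x" if "0 < a" for x a b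
    using that by (auto simp: F_def indicator_def shell_def)
  have r0: "r \<longlonglongrightarrow> 0" unfolding r_def by real_asymp
  have Rinf: "filterlim R at_top sequentially" unfolding R_def by real_asymp
  have mono_D: "D m \<subseteq> D n" if "m \<le> n" for m n
  proof -
    have "r n \<le> r m" "R m \<le> R n" using that by (auto simp: r_def R_def field_simps)
    then have "(r n)\<^sup>2 \<le> (r m)\<^sup>2" "(R m)\<^sup>2 \<le> (R n)\<^sup>2" using rR by (intro power_mono; simp add: less_imp_le)+
    then show ?thesis by (auto simp: D_def shell_def)
  qed
  have ev_D: "\<forall>\<^sub>F n in sequentially. x \<in> D n" if "x \<noteq> 0" for x
  proof -
    have "(\<lambda>n. 2 * (r n)\<^sup>2) \<longlonglongrightarrow> 2 * 0\<^sup>2" by (intro tendsto_intros r0)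
    from order_tendstoD(2)[OF this, of "x \<bullet> x"]
    have "\<forall>\<^sub>F n in sequentially. 2 * (r n)\<^sup>2 < x \<bullet> x" using that by simp
    moreover have "\<forall>\<^sub>F n in sequentially. x \<bullet> x \<le> (R n)\<^sup>2"
    proof -
      have "\<forall>\<^sub>F n in sequentially. norm x \<le> R n" using Rinf by (simp add: filterlim_at_top)
      then show ?thesis by eventually_elim (use power_mono[of "norm x" _ 2] in \<open>simp add: power2_norm_eq_inner\<close>)
    qed
    ultimately show ?thesis by eventually_elim (simp add: D_def shell_def)
  qed
  have lim: "(\<lambda>n. indicator (D n) x * F x) \<longlonglongrightarrow> F x" for x
  proof (cases "x = 0")
    case False
    from ev_D[OF this] have "\<forall>\<^sub>F n in sequentially. indicator (D n) x * F x = F x" by eventually_elim simp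
    then show ?thesis by (rule tendsto_eventually)
  qed (simp add: F_def)
  have iD: "integrable lborel (\<lambda>x. indicator (D n) x * F x)" for n
    using iS[OF r2, of n "(R n)\<^sup>2"] unfolding D_def inDF[OF r2] .
  have up: "\<exists>M\<ge>0. \<forall>n. (LBINT x. indicator (D n) x * F x) \<le> \<kappa> + M * (annular W (r n) + annular W (R n))" if "0 < \<kappa>" for \<kappa>
    using main[OF that] rR unfolding D_def inDF[OF r2, symmetric] by blast
  have inc: "incseq (\<lambda>n. LBINT x. indicator (D n) x * F x)"
  proof (rule incseq_SucI, rule integral_mono[OF iD iD])
    show "indicator (D n) x * F x \<le> indicator (D (Suc n)) x * F x" for n x
      using mono_D[of n "Suc n"] F_nonneg[of x] by (auto simp: indicator_def)
  qed
  \<comment> \<open>The first use, with \<open>\<kappa>\<close> = 1: the annular integrals are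
    merely bounded, and monotone convergence gives integrability.\<close>
  obtain M1 where M1: "0 \<le> M1" "\<And>n. (LBINT x. indicator (D n) x * F x) \<le> 1 + M1 * (annular W (r n) + annular W (R n))"
    using up[of 1] by auto
  have "(LBINT x. indicator (D n) x * F x) \<le> 1 + M1 * (V + V)" for n
    by (rule order_trans[OF M1(2)]) (intro add_left_mono mult_left_mono add_mono ann rR M1(1))
  then obtain L where L: "(\<lambda>n. LBINT x. indicator (D n) x * F x) \<longlonglongrightarrow> L"
    using incseq_convergent[OF inc] by blast
  have mF: "F \<in> borel_measurable lborel"
    by (rule borel_measurable_LIMSEQ_real[OF lim]) (use iD in auto)
  have iF: "integrable lborel F"
  proof (rule integrable_monotone_convergence[OF iD _ _ L mF])
    show "AE x in lborel. mono (\<lambda>n. indicator (D n) x * F x)"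
      using mono_D F_nonneg by (intro AE_I2 monoI mult_right_mono) (auto simp: indicator_def)
    show "AE x in lborel. (\<lambda>n. indicator (D n) x * F x) \<longlonglongrightarrow> F x" using lim by simp
  qed
  have LF: "(\<lambda>n. LBINT x. indicator (D n) x * F x) \<longlonglongrightarrow> (LBINT x. F x)"
    by (rule integral_dominated_convergence[OF mF _ iF])
       (use iD lim F_nonneg in \<open>auto simp: indicator_def\<close>)
  have ann0: "(\<lambda>n. annular W (s n)) \<longlonglongrightarrow> 0"
    if s: "\<And>n. 0 < s n" and ev: "\<And>x :: real ^ 4. x \<noteq> 0 \<Longrightarrow> \<forall>\<^sub>F n in sequentially. x \<notin> shell ((s n)\<^sup>2) (2 * (s n)\<^sup>2)" for s
  proof -
    have s2: "0 < (s n)\<^sup>2" for n using s[of n] by simp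
    have "(\<lambda>n. LBINT x. indicator (shell ((s n)\<^sup>2) (2 * (s n)\<^sup>2)) x * F x) \<longlonglongrightarrow> (\<integral>x. 0 \<partial>(lborel :: (real ^ 4) measure))"
    proof (rule integral_dominated_convergence[OF _ _ iF])
      show "(\<lambda>x. indicator (shell ((s n)\<^sup>2) (2 * (s n)\<^sup>2)) x * F x) \<in> borel_measurable lborel" for n
        using iS[OF s2, of n "2 * (s n)\<^sup>2"] unfolding inDF[OF s2] by simp
      have "(\<lambda>n. indicator (shell ((s n)\<^sup>2) (2 * (s n)\<^sup>2)) x * F x) \<longlonglongrightarrow> 0" for x
      proof (cases "x = 0")
        case False
        from ev[OF this] have "\<forall>\<^sub>F n in sequentially. indicator (shell ((s n)\<^sup>2) (2 * (s n)\<^sup>2)) x * F x = 0" by eventually_elim simp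
        then show ?thesis by (rule tendsto_eventually)
      qed (simp add: F_def)
      then show "AE x in lborel. (\<lambda>n. indicator (shell ((s n)\<^sup>2) (2 * (s n)\<^sup>2)) x * F x) \<longlonglongrightarrow> 0" by simp
    qed (use F_nonneg in \<open>auto simp: indicator_def\<close>)
    then show ?thesis unfolding annular_def inDF[OF s2] by simp
  qed
  have a1: "(\<lambda>n. annular W (r n)) \<longlonglongrightarrow> 0"
  proof (rule ann0[OF rR(1)])
    fix x :: "real ^ 4" assume "x \<noteq> 0"
    have "(\<lambda>n. 2 * (r n)\<^sup>2) \<longlonglongrightarrow> 2 * 0\<^sup>2" by (intro tendsto_intros r0)
    from order_tendstoD(2)[OF this, of "x \<bullet> x"]
    have "\<forall>\<^sub>F n in sequentially. 2 * (r n)\<^sup>2 < x \<bullet> x" using \<open>x \<noteq> 0\<close> by simp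
    then show "\<forall>\<^sub>F n in sequentially. x \<notin> shell ((r n)\<^sup>2) (2 * (r n)\<^sup>2)" by eventually_elim (simp add: shell_def)
  qed
  have a2: "(\<lambda>n. annular W (R n)) \<longlonglongrightarrow> 0"
  proof (rule ann0[OF rR(3)])
    fix x :: "real ^ 4"
    have "\<forall>\<^sub>F n in sequentially. norm x < R n" using Rinf by (simp add: filterlim_at_top_dense)
    then show "\<forall>\<^sub>F n in sequentially. x \<notin> shell ((R n)\<^sup>2) (2 * (R n)\<^sup>2)"
      by eventually_elim (use power_strict_mono[of "norm x" _ 2] in \<open>force simp: shell_def power2_norm_eq_inner\<close>)
  qed
  \<comment> \<open>The second use: the annular integrals now tend to zero, so M disappears in the
    limit and only \<open>\<kappa>\<close> is left.\<close>
  have "(LBINT x. F x) \<le> \<kappa>" if \<kappa>: "0 < \<kappa>" for \<kappa>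
  proof -
    obtain M where "\<And>n. (LBINT x. indicator (D n) x * F x) \<le> \<kappa> + M * (annular W (r n) + annular W (R n))"
      using up[OF \<kappa>] by auto
    moreover have "(\<lambda>n. \<kappa> + M * (annular W (r n) + annular W (R n))) \<longlonglongrightarrow> \<kappa> + M * (0 + 0)"
      by (intro tendsto_intros a1 a2)
    ultimately have "(LBINT x. F x) \<le> \<kappa> + M * (0 + 0)"
      by (intro LIMSEQ_le[OF LF]) auto
    then show ?thesis by simp
  qed
  then have "(LBINT x. F x) \<le> 0" by (rule field_le_epsilon[of _ 0, simplified])
  moreover have "0 \<le> (LBINT x. F x)" using F_nonneg by (intro integral_nonneg_AE AE_I2)
  ultimately have "(LBINT x. F x) = 0" by simp
  moreover have "continuous_on (- {0}) F"
  proof -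
    have "continuous_on (- {0}) (\<lambda>x. W x / (x \<bullet> x))" by (intro continuous_intros cont) auto
    then show ?thesis by (rule continuous_on_eq) (simp add: F_def)
  qed
  ultimately have "F x = 0"
    by (intro integral_0_imp_0[OF iF F_nonneg _ open_punctured]) (use assms in auto)
  then show ?thesis using \<open>x \<noteq> 0\<close> by (simp add: F_def)
qed

section \<open>Sums of squares and their radial derivatives\<close>

lemma smooth_on_pd: "smooth_on S f \<Longrightarrow> smooth_on S (pd i f)"
  unfolding smooth_on_def using Ck_on_pd by blast

lemma smooth_on_Ck: "smooth_on S f \<Longrightarrow> Ck_on k S f"
  by (simp add: smooth_on_def)

lemma smooth_on_differentiable: "smooth_on S f \<Longrightarrow> x \<in> S \<Longrightarrow> f differentiable (at x)"
  by (rule Ck_on_differentiable[OF smooth_on_Ck zero_less_one])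

text \<open>The index type is left general: it is instantiated with the components of u and d, and
  with pairs of derivative and component for the gradient of d.\<close>

lemma laplacian_sum_squares:
  fixes f :: "'k::finite \<Rightarrow> real ^ 'n \<Rightarrow> real"
  assumes "open S" "\<And>k. smooth_on S (f k)" "x \<in> S"
  shows "pd i (\<lambda>x. \<Sum>k\<in>UNIV. (f k x)\<^sup>2) x = 2 * (\<Sum>k\<in>UNIV. f k x * pd i (f k) x)"
    and "laplacian (\<lambda>x. \<Sum>k\<in>UNIV. (f k x)\<^sup>2) x
      = 2 * (\<Sum>k\<in>UNIV. \<Sum>i\<in>UNIV. (pd i (f k) x)\<^sup>2) + 2 * (\<Sum>k\<in>UNIV. f k x * laplacian (f k) x)"
proof -
  have d: "f k differentiable (at y)" "pd i (f k) differentiable (at y)" if "y \<in> S" for k i y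
    using assms(2) that smooth_on_differentiable smooth_on_pd by blast+
  have p: "pd i (\<lambda>x. \<Sum>k\<in>UNIV. (f k x)\<^sup>2) y = 2 * (\<Sum>k\<in>UNIV. f k y * pd i (f k) y)" if "y \<in> S" for y i
    by (subst pd_sum) (auto simp: power2_eq_square sum_distrib_left mult_ac pd_mult d[OF that] intro!: differentiable_mult d[OF that])
  then show "pd i (\<lambda>x. \<Sum>k\<in>UNIV. (f k x)\<^sup>2) x = 2 * (\<Sum>k\<in>UNIV. f k x * pd i (f k) x)"
    using assms(3) by blast
  have "pd i (pd i (\<lambda>x. \<Sum>k\<in>UNIV. (f k x)\<^sup>2)) x
      = 2 * (\<Sum>k\<in>UNIV. (pd i (f k) x)\<^sup>2) + 2 * (\<Sum>k\<in>UNIV. f k x * pd i (pd i (f k)) x)" for i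
  proof -
    have "pd i (pd i (\<lambda>x. \<Sum>k\<in>UNIV. (f k x)\<^sup>2)) x = pd i (\<lambda>y. 2 * (\<Sum>k\<in>UNIV. f k y * pd i (f k) y)) x"
      by (rule pd_cong_open[OF assms(1,3) p])
    also have "\<dots> = 2 * (\<Sum>k\<in>UNIV. pd i (\<lambda>y. f k y * pd i (f k) y) x)"
      by (subst pd_cmult, force intro!: differentiable_sum differentiable_mult d assms(3))
         (subst pd_sum, auto intro!: differentiable_mult d assms(3))
    also have "\<dots> = 2 * (\<Sum>k\<in>UNIV. (pd i (f k) x)\<^sup>2 + f k x * pd i (pd i (f k)) x)"
      by (simp add: pd_mult d[OF assms(3)] power2_eq_square add.commute)
    finally show ?thesis by (simp add: sum.distrib)
  qed
  then show "laplacian (\<lambda>x. \<Sum>k\<in>UNIV. (f k x)\<^sup>2) x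
      = 2 * (\<Sum>k\<in>UNIV. \<Sum>i\<in>UNIV. (pd i (f k) x)\<^sup>2) + 2 * (\<Sum>k\<in>UNIV. f k x * laplacian (f k) x)"
    unfolding laplacian_def
    by (simp add: sum.distrib sum_distrib_left sum.swap[of _ "UNIV :: 'n set" "UNIV :: 'k set"])
qed

text \<open>From -2fa <= f^2 + a^2 with a = x . grad f, and Cauchy-Schwarz for a. The squared
  gradient appears with coefficient 1, as in half the Laplacian of the sum of squares, so the
  dissipation absorbs it exactly.\<close>

lemma radial_derivative_bound:
  fixes f :: "'k::finite \<Rightarrow> real ^ 'n \<Rightarrow> real"
  assumes "open S" "\<And>k. smooth_on S (f k)" "x \<in> S" "x \<noteq> 0"
  shows "- (\<Sum>i\<in>UNIV. x $ i * pd i (\<lambda>x. \<Sum>k\<in>UNIV. (f k x)\<^sup>2) x) / (x \<bullet> x)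
    \<le> (\<Sum>k\<in>UNIV. (f k x)\<^sup>2) / (x \<bullet> x) + (\<Sum>k\<in>UNIV. \<Sum>i\<in>UNIV. (pd i (f k) x)\<^sup>2)"
proof -
  have s: "0 < x \<bullet> x" using assms(4) by simp
  define a where "a k = (\<Sum>i\<in>UNIV. x $ i * pd i (f k) x)" for k
  have "(\<Sum>i\<in>UNIV. x $ i * pd i (\<lambda>x. \<Sum>k\<in>UNIV. (f k x)\<^sup>2) x) = (\<Sum>i\<in>UNIV. \<Sum>k\<in>UNIV. 2 * f k x * (x $ i * pd i (f k) x))"
    by (simp add: laplacian_sum_squares(1)[OF assms(1-3)] sum_distrib_left mult_ac)
  also have "\<dots> = (\<Sum>k\<in>UNIV. 2 * f k x * a k)"
    by (subst sum.swap) (simp add: a_def sum_distrib_left)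
  finally have eq: "(\<Sum>i\<in>UNIV. x $ i * pd i (\<lambda>x. \<Sum>k\<in>UNIV. (f k x)\<^sup>2) x) = (\<Sum>k\<in>UNIV. 2 * f k x * a k)" .
  have "- (\<Sum>k\<in>UNIV. 2 * f k x * a k) \<le> (\<Sum>k\<in>UNIV. (f k x)\<^sup>2 + (x \<bullet> x) * (\<Sum>i\<in>UNIV. (pd i (f k) x)\<^sup>2))"
    unfolding sum_negf[symmetric]
  proof (rule sum_mono)
    fix k
    have "(a k)\<^sup>2 \<le> (\<Sum>i\<in>UNIV. (x $ i)\<^sup>2) * (\<Sum>i\<in>UNIV. (pd i (f k) x)\<^sup>2)"
      unfolding a_def by (rule Cauchy_Schwarz_ineq_sum)
    also have "(\<Sum>i\<in>UNIV. (x $ i)\<^sup>2) = x \<bullet> x" by (simp add: inner_vec_def power2_eq_square)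
    finally have "(a k)\<^sup>2 \<le> (x \<bullet> x) * (\<Sum>i\<in>UNIV. (pd i (f k) x)\<^sup>2)" .
    moreover have "0 \<le> (f k x + a k)\<^sup>2" by simp
    then have "- (2 * f k x * a k) \<le> (f k x)\<^sup>2 + (a k)\<^sup>2" by (simp add: power2_sum)
    ultimately show "- (2 * f k x * a k) \<le> (f k x)\<^sup>2 + (x \<bullet> x) * (\<Sum>i\<in>UNIV. (pd i (f k) x)\<^sup>2)" by linarith
  qed
  from divide_right_mono[OF this less_imp_le[OF s]] show ?thesis
    unfolding eq using s by (simp add: sum.distrib add_divide_distrib flip: sum_distrib_left)
qed

section \<open>From unit scale to all scales\<close>

lemma smooth_on_scaled:
  fixes f :: "real ^ 'n \<Rightarrow> real"
  assumes "smooth_on (- {0}) f" "0 < r"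
  shows "smooth_on (- {0}) (\<lambda>x. c * f (0 + r *\<^sub>R x))"
  unfolding smooth_on_def
  by (intro allI Ck_on_mult Ck_on_const Ck_on_affine[of _ 0 r "- {0}"] smooth_on_Ck[OF assms(1)])
     (use assms(2) in auto)

lemma pd_scaled:
  fixes f :: "real ^ 'n \<Rightarrow> real"
  assumes "smooth_on (- {0}) f" "0 < r" "x \<noteq> 0"
  shows "pd i (\<lambda>x. c * f (0 + r *\<^sub>R x)) x = c * r * pd i f (r *\<^sub>R x)"
    and "laplacian (\<lambda>x. c * f (0 + r *\<^sub>R x)) x = c * r\<^sup>2 * laplacian f (r *\<^sub>R x)"
proof -
  have r: "0 + r *\<^sub>R y \<in> - {0}" if "y \<noteq> 0" for y :: "real ^ 'n" using assms(2) that by auto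
  have d: "f differentiable (at (0 + r *\<^sub>R y))" "pd i f differentiable (at (0 + r *\<^sub>R y))" if "y \<noteq> 0" for y i
    using smooth_on_differentiable[OF assms(1) r[OF that]] smooth_on_differentiable[OF smooth_on_pd[OF assms(1)] r[OF that]] by blast+
  have p: "pd i (\<lambda>x. c * f (0 + r *\<^sub>R x)) y = c * r * pd i f (r *\<^sub>R y)" if "y \<noteq> 0" for y i
    using pd_cmult[OF pd_affine(1)[OF d(1)[OF that]], of i c] pd_affine(2)[OF d(1)[OF that], of i] by simp
  then show "pd i (\<lambda>x. c * f (0 + r *\<^sub>R x)) x = c * r * pd i f (r *\<^sub>R x)" using assms(3) by blast
  have "pd i (pd i (\<lambda>x. c * f (0 + r *\<^sub>R x))) x = c * r\<^sup>2 * pd i (pd i f) (r *\<^sub>R x)" for i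
  proof -
    have "pd i (pd i (\<lambda>x. c * f (0 + r *\<^sub>R x))) x = pd i (\<lambda>y. c * r * pd i f (0 + r *\<^sub>R y)) x"
      by (rule pd_cong_open[OF open_punctured]) (use assms(3) p in auto)
    then show ?thesis
      using pd_cmult[OF pd_affine(1)[OF d(2)[OF assms(3)]], of i "c * r"] pd_affine(2)[OF d(2)[OF assms(3)], of i]
      by (simp add: power2_eq_square)
  qed
  then show "laplacian (\<lambda>x. c * f (0 + r *\<^sub>R x)) x = c * r\<^sup>2 * laplacian f (r *\<^sub>R x)"
    by (simp add: laplacian_def sum_distrib_left)
qed

text \<open>The natural scaling of the stationary Navier-Stokes equations. C does not change, so the
  unit scale pressure bound holds at every radius with the same constants.\<close>

lemma (in stokes_field) scaled:
  assumes r: "0 < r"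
  shows "stokes_field C (\<lambda>i x. r * U i (0 + r *\<^sub>R x)) (\<lambda>i j x. r\<^sup>2 * S i j (0 + r *\<^sub>R x)) (\<lambda>x. r\<^sup>2 * p (0 + r *\<^sub>R x))"
proof
  fix i j
  show "smooth_on (- {0}) (\<lambda>x. r * U i (0 + r *\<^sub>R x))" "smooth_on (- {0}) (\<lambda>x. r\<^sup>2 * S i j (0 + r *\<^sub>R x))"
    "smooth_on (- {0}) (\<lambda>x. r\<^sup>2 * p (0 + r *\<^sub>R x))"
    by (rule smooth_on_scaled[OF smooth_U r] smooth_on_scaled[OF smooth_S r] smooth_on_scaled[OF smooth_p r])+
next
  fix x :: "real ^ 4" and i j assume x: "x \<noteq> 0"
  then have rx: "r *\<^sub>R x \<noteq> 0" "norm (r *\<^sub>R x) = r * norm x" using r by auto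
  show "\<bar>r * U i (0 + r *\<^sub>R x)\<bar> \<le> C / norm x"
    using U_le[OF rx(1), of i] r x by (simp add: abs_mult field_simps)
  show "\<bar>r\<^sup>2 * S i j (0 + r *\<^sub>R x)\<bar> \<le> C / (norm x)\<^sup>2"
    using S_le[OF rx(1), of i j] r x by (simp add: abs_mult field_simps power_mult_distrib)
  show "(\<Sum>i\<in>UNIV. pd i (\<lambda>x. r * U i (0 + r *\<^sub>R x)) x) = 0"
    by (simp only: pd_scaled(1)[OF smooth_U r x]) (simp add: div_U[OF rx(1)] flip: sum_distrib_left)
  show "pd i (\<lambda>x. r\<^sup>2 * p (0 + r *\<^sub>R x)) x
      = laplacian (\<lambda>x. r * U i (0 + r *\<^sub>R x)) x - (\<Sum>j\<in>UNIV. pd j (\<lambda>x. r\<^sup>2 * S i j (0 + r *\<^sub>R x)) x)"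
    by (simp only: pd_scaled[OF smooth_U r x] pd_scaled[OF smooth_p r x] pd_scaled[OF smooth_S r x] pd_p[OF rx(1)])
       (simp add: right_diff_distrib power2_eq_square sum_distrib_left mult_ac)
qed

text \<open>The flux is linear in U but \<open>annular\<close> is quadratic; w <= nu + w^2/nu
  bridges the gap at the cost of a small constant. The factor 2 is the bound of |y|^2 on the
  shell.\<close>

lemma (in stokes_field) flux_L1:
  assumes E: "\<And>i x. \<bar>pd i eta x\<bar> \<le> E" and r: "0 < r" and \<nu>: "0 < \<nu>"
  shows "(LBINT x. \<bar>flux (\<lambda>i x. r * U i (0 + r *\<^sub>R x)) x\<bar>)
    \<le> 4 * E * \<nu> * measure lborel (shell 1 2 :: (real ^ 4) set)
      + 2 * E / \<nu> * annular (\<lambda>x. \<Sum>i\<in>UNIV. (U i x)\<^sup>2) r"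
proof -
  interpret R: stokes_field C "\<lambda>i x. r * U i (0 + r *\<^sub>R x)" "\<lambda>i j x. r\<^sup>2 * S i j (0 + r *\<^sub>R x)" "\<lambda>x. r\<^sup>2 * p (0 + r *\<^sub>R x)"
    by (rule scaled[OF r])
  let ?W = "\<lambda>x. \<Sum>i\<in>UNIV. (U i x)\<^sup>2"
  let ?A = "shell 1 2 :: (real ^ 4) set"
  have E0: "0 \<le> E" using E[of 0 0] by linarith
  have "Ck_on 0 (- {0}) ?W" by (intro Ck_on_sum Ck_on_power2 Ck_U) auto
  then have cW: "continuous_on (- {0}) ?W" by simp
  have iW: "integrable lborel (\<lambda>x. indicator (shell (r\<^sup>2) (2 * r\<^sup>2)) x * (?W x / (x \<bullet> x)))"
    by (rule integrable_shell_quotient[OF cW]) (use r in simp)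
  define g where "g y = indicator ?A y * (\<Sum>i\<in>UNIV. (r * U i (0 + r *\<^sub>R y))\<^sup>2) / (y \<bullet> y)" for y
  define F where "F x = indicator (shell (r\<^sup>2) (2 * r\<^sup>2)) x * (?W x / (x \<bullet> x))" for x
  have g: "r ^ 4 * F (0 + r *\<^sub>R y) = g y" for y
  proof -
    have "indicator (shell (r\<^sup>2) (2 * r\<^sup>2)) (r *\<^sub>R y) = (indicator ?A y :: real)"
      using r scaled_shell[of r "r *\<^sub>R y"] by (auto simp: indicator_def)
    moreover have "(\<Sum>i\<in>UNIV. (r * U i (0 + r *\<^sub>R y))\<^sup>2) = r\<^sup>2 * ?W (0 + r *\<^sub>R y)"
      by (simp add: power_mult_distrib sum_distrib_left)
    ultimately show ?thesis using r
      by (simp add: F_def g_def power2_eq_square power4_eq_xxxx)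
  qed
  have ann: "annular ?W r = (LBINT y. g y)"
  proof -
    have "annular ?W r = (LBINT x. F x)" by (simp add: annular_def F_def)
    also have "\<dots> = \<bar>r\<bar> ^ DIM(real ^ 4) * (LBINT y. F (0 + r *\<^sub>R y))"
      by (rule lborel_integral_affine) (use iW r in \<open>auto simp: F_def\<close>)
    also have "\<dots> = (LBINT y. r ^ 4 * F (0 + r *\<^sub>R y))" using r by simp
    finally show ?thesis unfolding g .
  qed
  have ig: "integrable lborel g"
    using integrable_mult_right[OF lborel_integrable_affine[OF iW[folded F_def], of r 0], of "r ^ 4"] r unfolding g by simp
  have iA: "integrable lborel (indicator ?A :: real ^ 4 \<Rightarrow> real)" by (rule integrable_indicator_shell)
  have "(LBINT x. \<bar>flux (\<lambda>i x. r * U i (0 + r *\<^sub>R x)) x\<bar>) \<le> (LBINT y. 4 * E * \<nu> * indicator ?A y + 2 * E / \<nu> * g y)"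
  proof (rule integral_mono)
    show "integrable lborel (\<lambda>x. \<bar>flux (\<lambda>i x. r * U i (0 + r *\<^sub>R x)) x\<bar>)" by (intro integrable_abs R.integrable_flux)
    show "integrable lborel (\<lambda>y. 4 * E * \<nu> * indicator ?A y + 2 * E / \<nu> * g y)"
      by (intro Bochner_Integration.integrable_add integrable_mult_right ig iA)
    fix y
    show "\<bar>flux (\<lambda>i x. r * U i (0 + r *\<^sub>R x)) y\<bar> \<le> 4 * E * \<nu> * indicator ?A y + 2 * E / \<nu> * g y"
    proof (cases "y \<in> ?A")
      case True
      define w where "w i = \<bar>r * U i (0 + r *\<^sub>R y)\<bar>" for i
      have "\<bar>flux (\<lambda>i x. r * U i (0 + r *\<^sub>R x)) y\<bar> \<le> (\<Sum>i\<in>(UNIV :: 4 set). (\<nu> + (w i)\<^sup>2 / \<nu>) * E)"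
        unfolding flux_def
      proof (rule order_trans[OF sum_abs], rule sum_mono)
        fix i
        have "w i \<le> \<nu> + (w i)\<^sup>2 / \<nu>"
        proof -
          have "0 \<le> (w i - \<nu>)\<^sup>2 / \<nu>" using \<nu> by simp
          also have "\<dots> = (w i)\<^sup>2 / \<nu> - 2 * w i + \<nu>" using \<nu> by (simp add: field_simps power2_eq_square)
          finally show ?thesis unfolding w_def by linarith
        qed
        then show "\<bar>r * U i (0 + r *\<^sub>R y) * pd i eta y\<bar> \<le> (\<nu> + (w i)\<^sup>2 / \<nu>) * E"
          unfolding abs_mult[of "r * U i (0 + r *\<^sub>R y)"] w_def[symmetric] using \<nu> by (intro mult_mono E) auto
      qed
      also have "\<dots> = 4 * E * \<nu> + E / \<nu> * (\<Sum>i\<in>UNIV. (w i)\<^sup>2)"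
        by (simp add: sum.distrib distrib_right sum_distrib_left mult.commute[of _ E] distrib_left)
      finally have "\<bar>flux (\<lambda>i x. r * U i (0 + r *\<^sub>R x)) y\<bar> \<le> 4 * E * \<nu> + E / \<nu> * (\<Sum>i\<in>UNIV. (w i)\<^sup>2)" .
      also have "E / \<nu> * (\<Sum>i\<in>UNIV. (w i)\<^sup>2) \<le> E / \<nu> * (2 * g y)"
      proof -
        have y: "0 < y \<bullet> y" "y \<bullet> y \<le> 2" using True by (auto simp: shell_def)
        have "(\<Sum>i\<in>UNIV. (w i)\<^sup>2) * (y \<bullet> y) \<le> (\<Sum>i\<in>UNIV. (w i)\<^sup>2) * 2"
          by (intro mult_left_mono y sum_nonneg) auto
        then have "(\<Sum>i\<in>UNIV. (w i)\<^sup>2) \<le> 2 * g y" using True y by (simp add: g_def w_def field_simps)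
        then show ?thesis using E0 \<nu> by (intro mult_left_mono) auto
      qed
      finally show ?thesis using True by (simp add: mult_ac)
    next
      case False
      then show ?thesis using R.flux_support[OF False] by (simp add: g_def)
    qed
  qed
  also have "\<dots> = 4 * E * \<nu> * measure lborel ?A + 2 * E / \<nu> * annular ?W r"
    unfolding ann using iA ig by simp
  finally show ?thesis .
qed

text \<open>The choices are nested: \<open>\<mu>\<close> makes the constant in the pressure bound
  small and thereby fixes K, then \<open>\<nu>\<close> is taken small relative to K. Each
  contributes half of \<open>\<kappa>\<close>. The part q of the head is bounded pointwise.\<close>

lemma (in stokes_field) flux_bound:
  assumes q: "continuous_on (- {0}) q" "\<And>x. x \<noteq> 0 \<Longrightarrow> \<bar>q x\<bar> \<le> B / (x \<bullet> x)" and \<kappa>: "0 < \<kappa>"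
  shows "\<exists>M. \<forall>r>0. \<bar>LBINT x. (\<Sum>i\<in>UNIV. (q x + p x) * U i x * pd i (eta_at r) x)\<bar>
    \<le> \<kappa> + M * annular (\<lambda>x. \<Sum>i\<in>UNIV. (U i x)\<^sup>2) r"
proof -
  obtain E where E: "0 < E" "\<And>i x. \<bar>pd i eta x\<bar> \<le> E" using eta_bounded by metis
  let ?W = "\<lambda>x. \<Sum>i\<in>UNIV. (U i x)\<^sup>2"
  define V where "V = measure lborel (shell (1 / 4) 4 :: (real ^ 4) set)"
  define V1 where "V1 = measure lborel (shell 1 2 :: (real ^ 4) set)"
  have V: "0 \<le> V" "0 \<le> V1" by (simp_all add: V_def V1_def)
  have B0: "0 \<le> B" using q(2)[of "axis 1 1"] by (simp add: inner_axis_axis axis_eq_0_iff)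
  \<comment> \<open>Chosen so that 16 \<open>\<mu>\<close> V is at most half of
    \<open>\<kappa>\<close> times \<open>mass\<close>.\<close>
  define \<mu> where "\<mu> = \<kappa> * mass / (32 * (V + 1))"
  have \<mu>: "0 < \<mu>" using \<kappa> mass_pos V by (simp add: \<mu>_def)
  define K where "K = (16 * C ^ 3 * E * kernel_mass\<^sup>2 / \<mu> + 24 * C * far_mass) / mass"
  have K0: "0 \<le> K"
    unfolding K_def using C_nonneg E(1) \<mu> mass_pos
    by (intro divide_nonneg_pos add_nonneg_nonneg mult_nonneg_nonneg)
       (auto simp: far_mass_def intro!: add_nonneg_nonneg mult_nonneg_nonneg sum_nonneg)
  \<comment> \<open>Chosen so that (B + K) * 4 E \<open>\<nu>\<close> V1 is at most half of
    \<open>\<kappa>\<close>; the added ones keep the denominator positive.\<close>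
  define \<nu> where "\<nu> = \<kappa> / (8 * (B + K + 1) * E * (V1 + 1))"
  have \<nu>: "0 < \<nu>" using \<kappa> B0 K0 E V by (simp add: \<nu>_def)
  have "\<bar>LBINT x. (\<Sum>i\<in>UNIV. (q x + p x) * U i x * pd i (eta_at r) x)\<bar>
      \<le> \<kappa> + (B + K) * (2 * E / \<nu>) * annular ?W r" if r: "0 < r" for r
  proof -
    define Ur where "Ur i x = r * U i (0 + r *\<^sub>R x)" for i x
    define pr where "pr x = r\<^sup>2 * p (0 + r *\<^sub>R x)" for x
    define qr where "qr x = r\<^sup>2 * q (0 + r *\<^sub>R x)" for x
    interpret R: stokes_field C Ur "\<lambda>i j x. r\<^sup>2 * S i j (0 + r *\<^sub>R x)" pr
      using scaled[OF r] unfolding Ur_def pr_def .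
    define N where "N = (LBINT x. \<bar>flux Ur x\<bar>)"
    have sub: "shell 1 2 \<subseteq> - {0 :: real ^ 4}" by (rule shell_subset) simp
    have "continuous_on (- {0}) qr"
      unfolding qr_def using r by (intro continuous_intros continuous_on_compose2[OF q(1)]) auto
    then have iq: "integrable lborel (\<lambda>x. qr x * flux Ur x)"
      by (intro integrable_compact_support[OF compact_shell[of 1 2]] continuous_on_mult continuous_on_subset[OF R.continuous_flux])
         (auto simp: R.flux_support intro: continuous_on_subset[OF _ sub])
    have ip: "integrable lborel (\<lambda>x. pr x * flux Ur x)"
      by (intro integrable_compact_support[OF compact_shell[of 1 2]] continuous_on_mult
          continuous_on_subset[OF R.continuous_flux] continuous_on_subset[OF Ck_on_continuous[OF R.Ck_p[of 0]] sub])
         (auto simp: R.flux_support)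
    let ?f = "\<lambda>x. \<Sum>i\<in>UNIV. (q x + p x) * U i x * pd i (eta_at r) x"
    have "integrable lborel ?f"
    proof (rule integrable_compact_support[of "shell (r\<^sup>2) (2 * r\<^sup>2)"])
      have sub: "shell (r\<^sup>2) (2 * r\<^sup>2) \<subseteq> - {0 :: real ^ 4}" using r by (intro shell_subset) simp
      show "continuous_on (shell (r\<^sup>2) (2 * r\<^sup>2)) ?f"
        by (intro continuous_intros continuous_on_subset[OF q(1) sub]
            continuous_on_subset[OF Ck_on_continuous[OF Ck_p[of 0]] sub] continuous_on_subset[OF Ck_on_continuous[OF Ck_U[of 0]] sub]
            continuous_on_subset[OF Ck_on_continuous[OF Ck_on_pd[of 3 UNIV]]]) (use Ck_on_eta_at[of UNIV r] in auto)
    qed (simp_all add: eta_at_deriv_eq_0[OF r])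
    then have "(LBINT x. ?f x) = r ^ 4 * (LBINT y. ?f (0 + r *\<^sub>R y))"
      using lborel_integral_affine[of ?f r 0] r by simp
    also have "\<dots> = (LBINT y. r ^ 4 * ?f (0 + r *\<^sub>R y))" by simp
    also have "\<dots> = (LBINT y. qr y * flux Ur y + pr y * flux Ur y)"
    proof (intro Bochner_Integration.integral_cong refl)
      fix y
      have "r ^ 4 * ?f (0 + r *\<^sub>R y) = (qr y + pr y) * flux Ur y"
        unfolding flux_def sum_distrib_left
        by (intro sum.cong refl) (use r in \<open>simp add: Ur_def qr_def pr_def pd_eta_at power4_eq_xxxx power2_eq_square field_simps\<close>)
      then show "r ^ 4 * ?f (0 + r *\<^sub>R y) = qr y * flux Ur y + pr y * flux Ur y" by (simp only: distrib_right)
    qed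
    also have "\<dots> = (LBINT y. qr y * flux Ur y) + (LBINT y. pr y * flux Ur y)" using iq ip by simp
    finally have split: "(LBINT x. ?f x) = (LBINT y. qr y * flux Ur y) + (LBINT y. pr y * flux Ur y)" .
    have 1: "\<bar>LBINT y. qr y * flux Ur y\<bar> \<le> B * N"
      unfolding N_def
    proof (rule integral_abs_mult_le[OF iq R.integrable_flux])
      fix y assume "flux Ur y \<noteq> 0"
      then have "y \<in> shell 1 2" using R.flux_support by blast
      then have y: "y \<noteq> 0" "1 \<le> y \<bullet> y" by (auto simp: shell_def)
      have "\<bar>q (r *\<^sub>R y)\<bar> \<le> B / (r\<^sup>2 * (y \<bullet> y))" using q(2)[of "r *\<^sub>R y"] y r by (simp add: power2_eq_square mult.assoc)
      then have "\<bar>qr y\<bar> \<le> r\<^sup>2 * (B / (r\<^sup>2 * (y \<bullet> y)))" 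
        unfolding qr_def abs_mult by (intro mult_mono) auto
      also have "\<dots> = B / (y \<bullet> y)" using r by simp
      also have "\<dots> \<le> B / 1" using y B0 by (intro divide_left_mono) auto
      finally show "\<bar>qr y\<bar> \<le> B" by simp
    qed
    have "mass * \<bar>LBINT y. pr y * flux Ur y\<bar> \<le> 16 * \<mu> * V + mass * K * N"
      using R.pressure_bound[OF E(2) \<mu>] mass_pos by (simp add: N_def V_def K_def)
    also have "16 * \<mu> * V \<le> mass * (\<kappa> / 2)"
    proof -
      have "16 * \<mu> * V = mass * (\<kappa> / 2) * (V / (V + 1))"
      proof -
        have "16 * (\<kappa> * mass / (32 * w)) * V = mass * (\<kappa> / 2) * (V / w)" for w
          by (cases "w = 0") (simp_all add: field_simps)
        then show ?thesis unfolding \<mu>_def .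
      qed
      also have "\<dots> \<le> mass * (\<kappa> / 2)" using V mass_pos \<kappa> by (intro mult_left_le) auto
      finally show ?thesis .
    qed
    finally have "mass * \<bar>LBINT y. pr y * flux Ur y\<bar> \<le> mass * (\<kappa> / 2 + K * N)" by (simp add: distrib_left)
    then have 2: "\<bar>LBINT y. pr y * flux Ur y\<bar> \<le> \<kappa> / 2 + K * N" using mass_pos by simp
    have "\<bar>LBINT x. ?f x\<bar> \<le> \<kappa> / 2 + (B + K) * N" unfolding split using 1 2 by (simp add: distrib_right)
    also have "(B + K) * N \<le> (B + K) * (4 * E * \<nu> * V1 + 2 * E / \<nu> * annular ?W r)"
      using flux_L1[OF E(2) r \<nu>] B0 K0 by (intro mult_left_mono) (auto simp: N_def V1_def Ur_def[abs_def])
    also have "\<kappa> / 2 + (B + K) * (4 * E * \<nu> * V1 + 2 * E / \<nu> * annular ?W r)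
        \<le> \<kappa> + (B + K) * (2 * E / \<nu>) * annular ?W r"
    proof -
      have "(B + K) * (4 * E * \<nu> * V1) = \<kappa> / 2 * (((B + K) / (B + K + 1)) * (V1 / (V1 + 1)))"
      proof -
        have "a * (4 * E * (\<kappa> / (8 * b * E * c)) * V1) = \<kappa> / 2 * ((a / b) * (V1 / c))" for a b c
          using E(1) by (cases "b = 0"; cases "c = 0") (simp_all add: field_simps)
        then show ?thesis unfolding \<nu>_def .
      qed
      also have "\<dots> \<le> \<kappa> / 2"
        using \<kappa> B0 K0 V by (intro mult_left_le mult_le_one) auto
      finally show ?thesis by (simp add: algebra_simps)
    qed
    finally show ?thesis by simp
  qed
  then show ?thesis by blast
qed

section \<open>The Ericksen-Leslie system\<close>

text \<open>The system in scalar components, so that the real-valued calculus of \<open>pd\<close>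
  applies. The 1/4 is the square of the chosen smallness constant.\<close>

locale ericksen_leslie =
  fixes C :: real and U D :: "4 \<Rightarrow> real ^ 4 \<Rightarrow> real" and p :: "real ^ 4 \<Rightarrow> real"
  assumes smooth_U: "smooth_on (- {0}) (U i)" and smooth_D: "smooth_on (- {0}) (D a)" and smooth_p: "smooth_on (- {0}) p"
    and momentum: "x \<noteq> 0 \<Longrightarrow> - laplacian (U i) x + (\<Sum>j\<in>UNIV. U j x * pd j (U i) x) + pd i p x
      = - (\<Sum>j\<in>UNIV. pd j (\<lambda>x. \<Sum>a\<in>UNIV. pd i (D a) x * pd j (D a) x) x)"
    and div_U: "x \<noteq> 0 \<Longrightarrow> (\<Sum>i\<in>UNIV. pd i (U i) x) = 0"
    and director: "x \<noteq> 0 \<Longrightarrow> laplacian (D a) x + (\<Sum>j\<in>UNIV. \<Sum>b\<in>UNIV. (pd j (D b) x)\<^sup>2) * D a x = (\<Sum>j\<in>UNIV. U j x * pd j (D a) x)"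
    and unit: "x \<noteq> 0 \<Longrightarrow> (\<Sum>a\<in>UNIV. (D a x)\<^sup>2) = 1"
    and U_le: "x \<noteq> 0 \<Longrightarrow> \<bar>U i x\<bar> \<le> C / norm x"
    and grad_D_le: "x \<noteq> 0 \<Longrightarrow> (\<Sum>j\<in>UNIV. \<Sum>b\<in>UNIV. (pd j (D b) x)\<^sup>2) \<le> 1 / 4 / (x \<bullet> x)"
begin

definition energy :: "real ^ 4 \<Rightarrow> real"
  where "energy x = (\<Sum>j\<in>UNIV. \<Sum>b\<in>UNIV. (pd j (D b) x)\<^sup>2)"

text \<open>Derivative and component are joined into one finite index, which makes the energy a
  plain sum of squares.\<close>

definition dD :: "4 \<times> 4 \<Rightarrow> real ^ 4 \<Rightarrow> real"
  where "dD k = pd (fst k) (D (snd k))"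

lemma energy_eq: "energy = (\<lambda>x. \<Sum>k\<in>UNIV. (dD k x)\<^sup>2)"
  by (rule ext) (simp add: energy_def dD_def sum.cartesian_product split_beta flip: UNIV_Times_UNIV)

lemma sum_dD: "(\<Sum>k\<in>UNIV. f (fst k) (snd k)) = (\<Sum>j\<in>UNIV. \<Sum>b\<in>UNIV. f j b)" for f :: "4 \<Rightarrow> 4 \<Rightarrow> real"
  by (simp add: sum.cartesian_product split_beta flip: UNIV_Times_UNIV)

lemma smooth_dD: "smooth_on (- {0}) (dD k)"
  unfolding dD_def by (rule smooth_on_pd[OF smooth_D])

lemma Ck_energy: "Ck_on n (- {0}) energy"
  unfolding energy_eq by (intro Ck_on_sum Ck_on_power2 smooth_on_Ck smooth_dD) auto

lemma differentiable_fields: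
  assumes "x \<noteq> 0"
  shows "U i differentiable (at x)" "D a differentiable (at x)" "pd j (D a) differentiable (at x)"
    "p differentiable (at x)" "energy differentiable (at x)" "pd k (pd j (D a)) differentiable (at x)"
  using assms smooth_on_differentiable[OF smooth_U] smooth_on_differentiable[OF smooth_D]
    smooth_on_differentiable[OF smooth_on_pd[OF smooth_D]] smooth_on_differentiable[OF smooth_p]
    smooth_on_differentiable[OF smooth_on_pd[OF smooth_on_pd[OF smooth_D]]]
    Ck_on_differentiable[OF Ck_energy[of 1] zero_less_one]
  by auto

lemma D_orthogonal: "x \<noteq> 0 \<Longrightarrow> (\<Sum>a\<in>UNIV. D a x * pd i (D a) x) = 0"
proof -
  assume x: "x \<noteq> 0"
  have "pd i (\<lambda>x. \<Sum>a\<in>UNIV. (D a x)\<^sup>2) x = pd i (\<lambda>_. 1) x"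
    by (rule pd_cong_open[OF open_punctured]) (use x unit in auto)
  then show ?thesis
    using laplacian_sum_squares(1)[where f = D and i = i, OF open_punctured smooth_D, of x] x by simp
qed

lemma pd_commute_D: "x \<noteq> 0 \<Longrightarrow> pd i (pd j (D a)) x = pd j (pd i (D a)) x"
  by (rule pd_commute[OF open_punctured smooth_on_Ck[OF smooth_D]]) auto

text \<open>The first sum is half the gradient of the energy and can be moved into the head; the
  second, Lap d paired with grad d, is the force that does work.\<close>

lemma div_stress:
  assumes x: "x \<noteq> 0"
  shows "(\<Sum>j\<in>UNIV. pd j (\<lambda>x. \<Sum>a\<in>UNIV. pd i (D a) x * pd j (D a) x) x)
    = (\<Sum>a\<in>UNIV. \<Sum>j\<in>UNIV. pd j (D a) x * pd i (pd j (D a)) x) + (\<Sum>a\<in>UNIV. pd i (D a) x * laplacian (D a) x)"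
proof -
  note d = differentiable_fields[OF x]
  have "pd j (\<lambda>x. \<Sum>a\<in>UNIV. pd i (D a) x * pd j (D a) x) x
      = (\<Sum>a\<in>UNIV. pd i (D a) x * pd j (pd j (D a)) x + pd j (D a) x * pd i (pd j (D a)) x)" for j
    by (subst pd_sum) (auto simp: pd_mult d pd_commute_D[OF x, of j i] mult.commute intro!: differentiable_mult d)
  then show ?thesis
    by (simp add: sum.distrib laplacian_def sum_distrib_left sum.swap[of "\<lambda>j a. pd j (D a) x * pd i (pd j (D a)) x"]
        sum.swap[of "\<lambda>j a. pd i (D a) x * pd j (pd j (D a)) x"] add.commute)
qed

lemma pd_energy: "x \<noteq> 0 \<Longrightarrow> pd i energy x = 2 * (\<Sum>a\<in>UNIV. \<Sum>j\<in>UNIV. pd j (D a) x * pd i (pd j (D a)) x)"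
proof -
  assume x: "x \<noteq> 0"
  have "pd i energy x = 2 * (\<Sum>k\<in>UNIV. dD k x * pd i (dD k) x)"
    unfolding energy_eq by (rule laplacian_sum_squares(1)[OF open_punctured smooth_dD]) (use x in auto)
  also have "(\<Sum>k\<in>UNIV. dD k x * pd i (dD k) x) = (\<Sum>j\<in>UNIV. \<Sum>a\<in>UNIV. pd j (D a) x * pd i (pd j (D a)) x)"
    unfolding dD_def by (rule sum_dD)
  finally show ?thesis by (simp add: sum.swap[of "\<lambda>j a. pd j (D a) x * pd i (pd j (D a)) x"])
qed

definition speed :: "real ^ 4 \<Rightarrow> real"
  where "speed x = (\<Sum>i\<in>UNIV. (U i x)\<^sup>2)"

text \<open>The part of the head with a pointwise bound C'/|x|^2. The pressure is kept apart, as it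
  is handled by duality in \<open>flux_bound\<close>.\<close>

definition head :: "real ^ 4 \<Rightarrow> real"
  where "head x = 1 / 2 * (speed x + energy x)"

lemma Ck_speed: "Ck_on n (- {0}) speed"
  unfolding speed_def by (intro Ck_on_sum Ck_on_power2 smooth_on_Ck smooth_U) auto

lemma Ck_head: "Ck_on n (- {0}) head"
  unfolding head_def by (intro Ck_on_mult Ck_on_add Ck_on_const Ck_speed Ck_energy) auto

text \<open>The director equation makes \<open>u \<cdot> \<nabla>d\<close> orthogonal to \<open>d\<close>, so the Ericksen stress does the work
  \<open>|u \<cdot> \<nabla>d|\<^sup>2\<close>, which has the good sign.\<close>

lemma energy_identity:
  assumes x: "x \<noteq> 0"
  shows "laplacian speed x / 2 - (\<Sum>i\<in>UNIV. U i x * pd i (\<lambda>x. head x + p x) x)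
    = (\<Sum>i\<in>UNIV. \<Sum>j\<in>UNIV. (pd j (U i) x)\<^sup>2) + (\<Sum>a\<in>UNIV. (\<Sum>j\<in>UNIV. U j x * pd j (D a) x)\<^sup>2)"
proof -
  note d = differentiable_fields[OF x]
  have xi: "x \<in> - {0}" using x by simp
  define b where "b a = (\<Sum>j\<in>UNIV. U j x * pd j (D a) x)" for a
  define A where "A i = (\<Sum>a\<in>UNIV. \<Sum>j\<in>UNIV. pd j (D a) x * pd i (pd j (D a)) x)" for i
  have ds: "speed differentiable (at x)" using Ck_on_differentiable[OF Ck_speed[of 1] zero_less_one xi] .
  have ps: "pd i speed x = 2 * (\<Sum>k\<in>UNIV. U k x * pd i (U k) x)" for i
    unfolding speed_def by (rule laplacian_sum_squares(1)[OF open_punctured smooth_U xi])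
  have ls: "laplacian speed x = 2 * (\<Sum>k\<in>UNIV. \<Sum>i\<in>UNIV. (pd i (U k) x)\<^sup>2) + 2 * (\<Sum>k\<in>UNIV. U k x * laplacian (U k) x)"
    unfolding speed_def by (rule laplacian_sum_squares(2)[OF open_punctured smooth_U xi])
  have "pd i (\<lambda>x. head x + p x) x = 1 / 2 * (pd i speed x + pd i energy x) + pd i p x" for i
    unfolding head_def
    by (subst pd_add, intro differentiable_mult differentiable_const differentiable_add ds d, rule d,
        subst pd_cmult, intro differentiable_add ds d, subst pd_add, rule ds, rule d, rule refl)
  then have ph: "pd i (\<lambda>x. head x + p x) x = (\<Sum>k\<in>UNIV. U k x * pd i (U k) x) + A i + pd i p x" for i
    by (simp add: ps pd_energy[OF x] A_def)
  have mom: "A i + pd i p x = laplacian (U i) x - (\<Sum>j\<in>UNIV. U j x * pd j (U i) x) - (\<Sum>a\<in>UNIV. pd i (D a) x * laplacian (D a) x)" for i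
    using momentum[OF x, of i] unfolding div_stress[OF x] A_def by linarith
  have bD: "(\<Sum>a\<in>UNIV. b a * D a x) = 0"
  proof -
    have "(\<Sum>a\<in>UNIV. b a * D a x) = (\<Sum>j\<in>UNIV. U j x * (\<Sum>a\<in>UNIV. D a x * pd j (D a) x))"
      unfolding b_def sum_distrib_right sum_distrib_left by (subst sum.swap) (simp add: mult_ac)
    then show ?thesis by (simp add: D_orthogonal[OF x])
  qed
  have "laplacian (D a) x = b a - energy x * D a x" for a
    using director[OF x, of a] unfolding b_def energy_def by linarith
  then have "(\<Sum>a\<in>UNIV. b a * laplacian (D a) x) = (\<Sum>a\<in>UNIV. (b a)\<^sup>2) - energy x * (\<Sum>a\<in>UNIV. b a * D a x)"
    by (simp add: right_diff_distrib sum_subtractf power2_eq_square sum_distrib_left mult_ac)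
  then have work: "(\<Sum>a\<in>UNIV. b a * laplacian (D a) x) = (\<Sum>a\<in>UNIV. (b a)\<^sup>2)" using bD by simp
  have "(\<Sum>i\<in>UNIV. U i x * pd i (\<lambda>x. head x + p x) x)
      = (\<Sum>i\<in>UNIV. U i x * (\<Sum>k\<in>UNIV. U k x * pd i (U k) x)) + (\<Sum>i\<in>UNIV. U i x * (A i + pd i p x))"
    by (simp add: ph distrib_left sum.distrib)
  also have "(\<Sum>i\<in>UNIV. U i x * (A i + pd i p x)) = (\<Sum>i\<in>UNIV. U i x * laplacian (U i) x)
      - (\<Sum>i\<in>UNIV. U i x * (\<Sum>j\<in>UNIV. U j x * pd j (U i) x)) - (\<Sum>i\<in>UNIV. U i x * (\<Sum>a\<in>UNIV. pd i (D a) x * laplacian (D a) x))"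
    by (simp add: mom right_diff_distrib sum_subtractf)
  \<comment> \<open>Convection along u equals the transport of |u|^2/2 and cancels against the
    kinetic part of the head.\<close>
  also have "(\<Sum>i\<in>UNIV. U i x * (\<Sum>j\<in>UNIV. U j x * pd j (U i) x)) = (\<Sum>i\<in>UNIV. U i x * (\<Sum>k\<in>UNIV. U k x * pd i (U k) x))"
    unfolding sum_distrib_left by (subst sum.swap) (simp add: mult_ac)
  also have "(\<Sum>i\<in>UNIV. U i x * (\<Sum>a\<in>UNIV. pd i (D a) x * laplacian (D a) x)) = (\<Sum>a\<in>UNIV. b a * laplacian (D a) x)"
    unfolding sum_distrib_left b_def sum_distrib_right by (subst sum.swap) (simp add: mult_ac)
  finally show ?thesis using ls work unfolding b_def by (simp add: add_divide_distrib)
qed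

text \<open>Incompressibility puts convection into divergence form. A single constant dominates C
  for U, C^2 for the products U i * U j, and 1/4 for the director stress.\<close>

lemma stokes: "stokes_field (C + C\<^sup>2 + 1) U (\<lambda>i j x. U i x * U j x + (\<Sum>a\<in>UNIV. pd i (D a) x * pd j (D a) x)) p"
proof
  fix i j
  show "smooth_on (- {0}) (U i)" "smooth_on (- {0}) p" by (fact smooth_U smooth_p)+
  show "smooth_on (- {0}) (\<lambda>x. U i x * U j x + (\<Sum>a\<in>UNIV. pd i (D a) x * pd j (D a) x))"
    unfolding smooth_on_def
    by (intro allI Ck_on_add Ck_on_mult Ck_on_sum smooth_on_Ck smooth_U smooth_on_pd smooth_D) auto
next
  fix x :: "real ^ 4" and i j assume x: "x \<noteq> 0"
  note d = differentiable_fields[OF x]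
  have n: "0 < norm x" using x by simp
  have C: "0 \<le> C / norm x" using U_le[OF x, of i] by (meson abs_ge_zero order_trans)
  have "C / norm x \<le> (C + C\<^sup>2 + 1) / norm x" using n by (intro divide_right_mono) auto
  then show "\<bar>U i x\<bar> \<le> (C + C\<^sup>2 + 1) / norm x" using U_le[OF x, of i] by linarith
  have "\<bar>U i x * U j x\<bar> \<le> (C / norm x) * (C / norm x)"
    unfolding abs_mult by (intro mult_mono U_le x C) auto
  then have 1: "\<bar>U i x * U j x\<bar> \<le> C\<^sup>2 / (norm x)\<^sup>2" by (simp add: power2_eq_square)
  have "\<bar>\<Sum>a\<in>UNIV. pd i (D a) x * pd j (D a) x\<bar> \<le> (\<Sum>a\<in>UNIV. 1 / 2 * (pd i (D a) x)\<^sup>2 + 1 / 2 * (pd j (D a) x)\<^sup>2)"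
  proof (rule order_trans[OF sum_abs], rule sum_mono)
    fix a
    have "0 \<le> (\<bar>pd i (D a) x\<bar> - \<bar>pd j (D a) x\<bar>)\<^sup>2" by simp
    then show "\<bar>pd i (D a) x * pd j (D a) x\<bar> \<le> 1 / 2 * (pd i (D a) x)\<^sup>2 + 1 / 2 * (pd j (D a) x)\<^sup>2"
      by (simp add: power2_diff abs_mult)
  qed
  also have "\<dots> = 1 / 2 * (\<Sum>a\<in>UNIV. (pd i (D a) x)\<^sup>2) + 1 / 2 * (\<Sum>a\<in>UNIV. (pd j (D a) x)\<^sup>2)"
    by (simp add: sum.distrib sum_distrib_left)
  also have "\<dots> \<le> 1 / 2 * energy x + 1 / 2 * energy x"
    unfolding energy_def
    by (intro add_mono mult_left_mono member_le_sum[of _ _ "\<lambda>j. \<Sum>a\<in>UNIV. (pd j (D a) x)\<^sup>2"] sum_nonneg) auto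
  also have "\<dots> \<le> 1 / 4 / (x \<bullet> x)" using grad_D_le[OF x] by (simp add: energy_def)
  also have "\<dots> \<le> 1 / (norm x)\<^sup>2" 
    unfolding power2_norm_eq_inner by (intro divide_right_mono) auto
  finally have 2: "\<bar>\<Sum>a\<in>UNIV. pd i (D a) x * pd j (D a) x\<bar> \<le> 1 / (norm x)\<^sup>2" .
  have "0 \<le> C" using C n by (simp add: zero_le_divide_iff)
  then have "(C\<^sup>2 + 1) / (norm x)\<^sup>2 \<le> (C + C\<^sup>2 + 1) / (norm x)\<^sup>2" by (intro divide_right_mono) auto
  then show "\<bar>U i x * U j x + (\<Sum>a\<in>UNIV. pd i (D a) x * pd j (D a) x)\<bar> \<le> (C + C\<^sup>2 + 1) / (norm x)\<^sup>2"
    using 1 2 abs_triangle_ineq[of "U i x * U j x" "\<Sum>a\<in>UNIV. pd i (D a) x * pd j (D a) x"]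
    by (simp add: add_divide_distrib)
  show "(\<Sum>i\<in>UNIV. pd i (U i) x) = 0" by (rule div_U[OF x])
  have "pd j (\<lambda>x. U i x * U j x + (\<Sum>a\<in>UNIV. pd i (D a) x * pd j (D a) x)) x
      = U i x * pd j (U j) x + U j x * pd j (U i) x + pd j (\<lambda>x. \<Sum>a\<in>UNIV. pd i (D a) x * pd j (D a) x) x" for j
  proof -
    have "pd j (\<lambda>x. U i x * U j x + (\<Sum>a\<in>UNIV. pd i (D a) x * pd j (D a) x)) x
        = pd j (\<lambda>x. U i x * U j x) x + pd j (\<lambda>x. \<Sum>a\<in>UNIV. pd i (D a) x * pd j (D a) x) x"
      by (rule pd_add) (auto intro!: differentiable_mult differentiable_sum d)
    then show ?thesis by (simp add: pd_mult[OF d(1) d(1)] mult.commute)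
  qed
  then have "(\<Sum>j\<in>UNIV. pd j (\<lambda>x. U i x * U j x + (\<Sum>a\<in>UNIV. pd i (D a) x * pd j (D a) x)) x)
      = U i x * (\<Sum>j\<in>UNIV. pd j (U j) x) + (\<Sum>j\<in>UNIV. U j x * pd j (U i) x)
        + (\<Sum>j\<in>UNIV. pd j (\<lambda>x. \<Sum>a\<in>UNIV. pd i (D a) x * pd j (D a) x) x)"
    by (simp add: sum.distrib sum_distrib_left)
  then show "pd i p x = laplacian (U i) x
      - (\<Sum>j\<in>UNIV. pd j (\<lambda>x. U i x * U j x + (\<Sum>a\<in>UNIV. pd i (D a) x * pd j (D a) x)) x)"
    using momentum[OF x, of i] div_U[OF x] by simp
qed

lemma speed_le: "x \<noteq> 0 \<Longrightarrow> speed x \<le> 4 * C\<^sup>2 / (x \<bullet> x)"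
proof -
  assume x: "x \<noteq> 0"
  have "(U i x)\<^sup>2 \<le> (C / norm x)\<^sup>2" for i
    using power_mono[OF U_le[OF x, of i], of 2] by simp
  then have "speed x \<le> (\<Sum>i\<in>(UNIV :: 4 set). (C / norm x)\<^sup>2)" unfolding speed_def by (intro sum_mono)
  then show ?thesis by (simp add: power_divide power2_norm_eq_inner)
qed

lemma U_eq_0:
  assumes x: "x \<noteq> 0"
  shows "U i x = 0"
proof -
  interpret S: stokes_field "C + C\<^sup>2 + 1" U "\<lambda>i j x. U i x * U j x + (\<Sum>a\<in>UNIV. pd i (D a) x * pd j (D a) x)" p
    by (rule stokes)
  have "speed x = 0"
  proof (rule liouville[where B = "4 * C\<^sup>2" and U = U and Q = "\<lambda>x. head x + p x"])
    show "Ck_on 2 (- {0}) speed" by (rule Ck_speed)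
    show "Ck_on 1 (- {0}) (\<lambda>x. head x + p x)" by (intro Ck_on_add Ck_head S.Ck_p) auto
    show "Ck_on 1 (- {0}) (U i)" for i by (rule S.Ck_U)
    show "x \<noteq> 0" by (rule x)
    show "\<exists>M. \<forall>r>0. \<bar>LBINT x. (\<Sum>i\<in>UNIV. (head x + p x) * U i x * pd i (eta_at r) x)\<bar> \<le> \<kappa> + M * annular speed r"
      if "0 < \<kappa>" for \<kappa>
      unfolding speed_def
    proof (rule S.flux_bound[OF Ck_on_continuous[OF Ck_head[of 0]] _ that])
      fix x :: "real ^ 4" assume x: "x \<noteq> 0"
      have "0 \<le> speed x" "0 \<le> energy x" by (simp_all add: speed_def energy_def sum_nonneg)
      then have "\<bar>head x\<bar> = 1 / 2 * (speed x + energy x)" by (simp add: head_def)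
      also have "\<dots> \<le> 1 / 2 * (4 * C\<^sup>2 / (x \<bullet> x) + 1 / 4 / (x \<bullet> x))"
        using speed_le[OF x] grad_D_le[OF x] by (intro mult_left_mono add_mono) (auto simp: energy_def)
      also have "\<dots> = (2 * C\<^sup>2 + 1 / 8) / (x \<bullet> x)" by (simp add: add_divide_distrib)
      finally show "\<bar>head x\<bar> \<le> (2 * C\<^sup>2 + 1 / 8) / (x \<bullet> x)" .
    qed
  next
    fix x :: "real ^ 4" assume x: "x \<noteq> 0"
    then have xi: "x \<in> - {0}" by simp
    show "0 \<le> speed x" by (simp add: speed_def sum_nonneg)
    show "speed x \<le> 4 * C\<^sup>2 / (x \<bullet> x)" by (rule speed_le[OF x])
    show "(\<Sum>i\<in>UNIV. pd i (U i) x) = 0" by (rule div_U[OF x])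
    \<comment> \<open>The gradient squares on the right are the dissipation in
      \<open>energy_identity\<close>.\<close>
    have "- (\<Sum>i\<in>UNIV. x $ i * pd i speed x) / (x \<bullet> x) \<le> speed x / (x \<bullet> x) + (\<Sum>k\<in>UNIV. \<Sum>i\<in>UNIV. (pd i (U k) x)\<^sup>2)"
      unfolding speed_def[abs_def] by (rule radial_derivative_bound[OF open_punctured smooth_U xi x])
    moreover have "0 \<le> speed x / (x \<bullet> x)" by (simp add: speed_def sum_nonneg)
    moreover have "0 \<le> (\<Sum>a\<in>UNIV. (\<Sum>j\<in>UNIV. U j x * pd j (D a) x)\<^sup>2)" by (simp add: sum_nonneg)
    ultimately show "- (\<Sum>i\<in>UNIV. x $ i * pd i speed x) / (x \<bullet> x)
        \<le> 3 / 2 * (speed x / (x \<bullet> x)) + (laplacian speed x / 2 - (\<Sum>i\<in>UNIV. U i x * pd i (\<lambda>x. head x + p x) x))"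
      unfolding energy_identity[OF x] by linarith
  qed
  then have "(\<Sum>i\<in>UNIV. (U i x)\<^sup>2) = 0" by (simp add: speed_def)
  then show ?thesis by (simp add: sum_nonneg_eq_0_iff)
qed

text \<open>Once the flow vanishes, \<open>d\<close> is a harmonic map and Bochner's formula applies.\<close>

lemma bochner:
  assumes x: "x \<noteq> 0"
  shows "laplacian energy x / 2 = (\<Sum>k\<in>UNIV. \<Sum>i\<in>UNIV. (pd i (dD k) x)\<^sup>2) - (energy x)\<^sup>2"
proof -
  have xi: "x \<in> - {0}" using x by simp
  note d = differentiable_fields
  define e where "e = energy x"
  have lap_D: "laplacian (D a) y = - 1 * (energy y * D a y)" if "y \<in> - {0}" for a y
    using director[of y a] that U_eq_0 by (simp add: energy_def)
  have com: "laplacian (pd j (D a)) x = pd j (laplacian (D a)) x" for j a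
  proof -
    have "pd i (pd i (pd j (D a))) x = pd j (pd i (pd i (D a))) x" for i
    proof -
      have "pd i (pd i (pd j (D a))) x = pd i (pd j (pd i (D a))) x"
        by (rule pd_cong_open[OF open_punctured xi]) (simp add: pd_commute_D)
      also have "\<dots> = pd j (pd i (pd i (D a))) x"
        by (rule pd_commute[OF open_punctured smooth_on_Ck[OF smooth_on_pd[OF smooth_D]] xi])
      finally show ?thesis .
    qed
    then show ?thesis unfolding laplacian_def[abs_def] by (simp add: pd_sum d[OF x])
  qed
  have "laplacian (pd j (D a)) x = - 1 * (energy x * pd j (D a) x + pd j energy x * D a x)" for j a
  proof -
    have "laplacian (pd j (D a)) x = pd j (\<lambda>y. - 1 * (energy y * D a y)) x"
      unfolding com by (rule pd_cong_open[OF open_punctured xi lap_D])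
    then show ?thesis by (simp only: pd_cmult[OF differentiable_mult[OF d(5)[OF x] d(2)[OF x]]] pd_mult d[OF x])
  qed
  then have "(\<Sum>k\<in>UNIV. dD k x * laplacian (dD k) x)
      = (\<Sum>j\<in>UNIV. \<Sum>a\<in>UNIV. pd j (D a) x * (- 1 * (energy x * pd j (D a) x + pd j energy x * D a x)))"
    unfolding dD_def sum_dD[of "\<lambda>j a. pd j (D a) x * laplacian (pd j (D a)) x"] by simp
  also have "\<dots> = - (e * (\<Sum>j\<in>UNIV. \<Sum>a\<in>UNIV. (pd j (D a) x)\<^sup>2)) - (\<Sum>j\<in>UNIV. pd j energy x * (\<Sum>a\<in>UNIV. D a x * pd j (D a) x))"
    unfolding e_def[symmetric]
    by (simp add: algebra_simps sum.distrib sum_negf sum_subtractf sum_distrib_left power2_eq_square)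
  \<comment> \<open>The term with the gradient of the energy is proportional to d and drops out, as
    d is orthogonal to its derivatives.\<close>
  also have "\<dots> = - (energy x)\<^sup>2"
    by (simp add: D_orthogonal[OF x] power2_eq_square e_def energy_def)
  finally have "(\<Sum>k\<in>UNIV. dD k x * laplacian (dD k) x) = - (energy x)\<^sup>2" .
  then show ?thesis
    using laplacian_sum_squares(2)[where f = dD, OF open_punctured smooth_dD xi] unfolding energy_eq[symmetric] by simp
qed

text \<open>Smallness enters here: the quartic term of Bochner's formula is at most 1/4 of
  energy/|x|^2, and together with the 1 from the radial derivative this stays below 3/2. With zero
  velocity and head there is no transport term to estimate.\<close>

lemma energy_eq_0:
  assumes x: "x \<noteq> 0"
  shows "energy x = 0"
proof (rule liouville[where B = "1 / 4" and U = "\<lambda>_ _. 0" and Q = "\<lambda>_. 0"])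
  show "Ck_on 2 (- {0}) energy" by (rule Ck_energy)
  show "x \<noteq> 0" by (rule x)
  show "\<exists>M. \<forall>r>0. \<bar>LBINT x. (\<Sum>i\<in>(UNIV :: 4 set). 0 * 0 * pd i (eta_at r) x)\<bar> \<le> \<kappa> + M * annular energy r" if "0 < \<kappa>" for \<kappa>
    using that by (intro exI[of _ 0]) simp
next
  fix x :: "real ^ 4" assume x: "x \<noteq> 0"
  then have xi: "x \<in> - {0}" by simp
  show "0 \<le> energy x" by (simp add: energy_def sum_nonneg)
  show le: "energy x \<le> 1 / 4 / (x \<bullet> x)" using grad_D_le[OF x] by (simp add: energy_def)
  have "- (\<Sum>i\<in>UNIV. x $ i * pd i energy x) / (x \<bullet> x) \<le> energy x / (x \<bullet> x) + (\<Sum>k\<in>UNIV. \<Sum>i\<in>UNIV. (pd i (dD k) x)\<^sup>2)"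
    unfolding energy_eq by (rule radial_derivative_bound[OF open_punctured smooth_dD xi x])
  moreover have "(energy x)\<^sup>2 \<le> 1 / 4 * (energy x / (x \<bullet> x))"
    using mult_left_mono[OF le \<open>0 \<le> energy x\<close>] by (simp add: power2_eq_square)
  moreover have "0 \<le> energy x / (x \<bullet> x)" using \<open>0 \<le> energy x\<close> by simp
  ultimately show "- (\<Sum>i\<in>UNIV. x $ i * pd i energy x) / (x \<bullet> x)
      \<le> 3 / 2 * (energy x / (x \<bullet> x)) + (laplacian energy x / 2 - (\<Sum>i\<in>(UNIV :: 4 set). 0 * pd i (\<lambda>_. 0) x))"
    unfolding bochner[OF x] by simp
qed auto

lemma pd_D_eq_0: "x \<noteq> 0 \<Longrightarrow> pd j (D a) x = 0"
proof -
  assume "x \<noteq> 0"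
  then have "(\<Sum>k\<in>UNIV. (dD k x)\<^sup>2) = 0" using energy_eq_0 energy_eq by metis
  then have "dD (j, a) x = 0" by (simp add: sum_nonneg_eq_0_iff)
  then show ?thesis by (simp add: dD_def)
qed

end

section \<open>From vector fields to components, and the conclusion\<close>

lemma partial_derivative_nth:
  fixes f :: "real ^ 'n \<Rightarrow> real ^ 'm"
  assumes "f differentiable (at x)"
  shows "partial_derivative j f x $ i = pd j (\<lambda>y. f y $ i) x"
  using pd_bounded_linear[OF bounded_linear_vec_nth assms] by simp

lemma smooth_on_nth: "open S \<Longrightarrow> smooth_on S f \<Longrightarrow> smooth_on S (\<lambda>x. f x $ i)" for f :: "real ^ 'n \<Rightarrow> real ^ 'm"
  unfolding smooth_on_def using Ck_on_bounded_linear[OF _ bounded_linear_vec_nth] by blast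

lemma laplacian_nth:
  fixes f :: "real ^ 'n \<Rightarrow> real ^ 'm"
  assumes "open S" "smooth_on S f" "x \<in> S"
  shows "laplacian f x $ i = laplacian (\<lambda>y. f y $ i) x"
proof -
  have d: "f differentiable (at y)" "partial_derivative j f differentiable (at y)" if "y \<in> S" for y j
    using assms(2) that Ck_on_differentiable[of 1 S f y] Ck_on_differentiable[of 1 S "partial_derivative j f" y]
      Ck_on_pd[of 1 S f j] by (auto simp: smooth_on_def)
  have "partial_derivative j (partial_derivative j f) x $ i = pd j (pd j (\<lambda>y. f y $ i)) x" for j
    unfolding partial_derivative_nth[OF d(2)[OF assms(3)]]
    by (rule pd_cong_open[OF assms(1,3)]) (rule partial_derivative_nth[OF d(1)])
  then show ?thesis by (simp add: laplacian_def)
qed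

lemma norm_vec_power2: "(norm (v :: 'b::real_normed_vector ^ 'n))\<^sup>2 = (\<Sum>i\<in>UNIV. (norm (v $ i))\<^sup>2)"
  by (simp add: norm_vec_def L2_set_def sum_nonneg)

lemma norm_grad_power2:
  fixes f :: "real ^ 'n \<Rightarrow> real ^ 'm"
  assumes "f differentiable (at x)"
  shows "(norm (grad f x))\<^sup>2 = (\<Sum>j\<in>UNIV. \<Sum>b\<in>UNIV. (pd j (\<lambda>y. f y $ b) x)\<^sup>2)"
  by (simp add: norm_vec_power2 grad_def partial_derivative_nth[OF assms])

lemma ericksen_leslie_components:
  fixes u d :: "real ^ 4 \<Rightarrow> real ^ 4"
  assumes sol: "smooth_on (- {0}) u" "smooth_on (- {0}) d" "d ` (- {0}) \<subseteq> sphere 0 1" "smooth_on (- {0}) p"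
      "ericksen_leslie_on (- {0}) u p d"
    and u: "\<And>x. x \<noteq> 0 \<Longrightarrow> norm (u x) \<le> C / norm x"
    and d: "\<And>x. x \<noteq> 0 \<Longrightarrow> norm (grad d x) < 1 / 2 / norm x"
  shows "ericksen_leslie C (\<lambda>i x. u x $ i) (\<lambda>a x. d x $ a) p"
proof
  fix i a
  show "smooth_on (- {0}) (\<lambda>x. u x $ i)" "smooth_on (- {0}) (\<lambda>x. d x $ a)" "smooth_on (- {0}) p"
    using sol smooth_on_nth[OF open_punctured] by auto
next
  fix x :: "real ^ 4" and i a assume x: "x \<noteq> 0"
  then have xi: "x \<in> - {0}" by simp
  have diff: "u differentiable (at y)" "d differentiable (at y)" if "y \<noteq> 0" for y
    using sol(1,2) that by (auto intro!: Ck_on_differentiable[of 1 "- {0}"] simp: smooth_on_def)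
  have eqs: "- laplacian u x + advection u u x + grad p x = - matrix_divergence (ericksen_tensor d) x"
    "divergence u x = 0" "laplacian d x + (norm (grad d x))\<^sup>2 *\<^sub>R d x = advection u d x"
    using sol(5) x by (auto simp: ericksen_leslie_on_def)
  show "(\<Sum>i\<in>UNIV. pd i (\<lambda>x. u x $ i) x) = 0" using eqs(2) by (simp add: divergence_def)
  have stress: "matrix_divergence (ericksen_tensor d) x $ i
      = (\<Sum>j\<in>UNIV. pd j (\<lambda>x. \<Sum>a\<in>UNIV. pd i (\<lambda>x. d x $ a) x * pd j (\<lambda>x. d x $ a) x) x)"
  proof -
    have "pd j (\<lambda>y. ericksen_tensor d y $ i $ j) x = pd j (\<lambda>x. \<Sum>a\<in>UNIV. pd i (\<lambda>x. d x $ a) x * pd j (\<lambda>x. d x $ a) x) x" for j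
      by (rule pd_cong_open[OF open_punctured xi])
         (simp add: ericksen_tensor_def inner_vec_def partial_derivative_nth diff)
    then show ?thesis by (simp add: matrix_divergence_def divergence_def)
  qed
  have "- (laplacian u x $ i) + advection u u x $ i + grad p x $ i = - (matrix_divergence (ericksen_tensor d) x $ i)"
    using arg_cong[OF eqs(1), of "\<lambda>v. v $ i"] by simp
  then show "- laplacian (\<lambda>x. u x $ i) x + (\<Sum>j\<in>UNIV. u x $ j * pd j (\<lambda>x. u x $ i) x) + pd i p x
      = - (\<Sum>j\<in>UNIV. pd j (\<lambda>x. \<Sum>a\<in>UNIV. pd i (\<lambda>x. d x $ a) x * pd j (\<lambda>x. d x $ a) x) x)"
    unfolding stress
    by (simp add: laplacian_nth[OF open_punctured sol(1) xi] advection_def partial_derivative_nth[OF diff(1)[OF x]] grad_def)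
  have "(laplacian d x + (norm (grad d x))\<^sup>2 *\<^sub>R d x) $ a = advection u d x $ a" by (simp add: eqs(3))
  then show "laplacian (\<lambda>x. d x $ a) x + (\<Sum>j\<in>UNIV. \<Sum>b\<in>UNIV. (pd j (\<lambda>x. d x $ b) x)\<^sup>2) * d x $ a
      = (\<Sum>j\<in>UNIV. u x $ j * pd j (\<lambda>x. d x $ a) x)"
    by (simp add: laplacian_nth[OF open_punctured sol(2) xi] advection_def partial_derivative_nth[OF diff(2)[OF x]]
        norm_grad_power2[OF diff(2)[OF x]])
  have "(norm (d x))\<^sup>2 = 1" using sol(3) xi by auto
  then show "(\<Sum>a\<in>UNIV. (d x $ a)\<^sup>2) = 1" by (simp add: norm_vec_power2)
  show "\<bar>u x $ i\<bar> \<le> C / norm x" using component_le_norm_cart u[OF x] by (rule order_trans)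
  have "(norm (grad d x))\<^sup>2 \<le> (1 / 2 / norm x)\<^sup>2" using d[OF x] by (intro power_mono) auto
  then show "(\<Sum>j\<in>UNIV. \<Sum>b\<in>UNIV. (pd j (\<lambda>x. d x $ b) x)\<^sup>2) \<le> 1 / 4 / (x \<bullet> x)"
    unfolding norm_grad_power2[OF diff(2)[OF x]] by (simp add: power_divide power2_norm_eq_inner)
qed

theorem theorem1p4:
  shows "\<exists>\<epsilon>\<^sub>1::real. \<epsilon>\<^sub>1 > 0 \<and>
    (\<forall>(u :: real ^ 4 \<Rightarrow> real ^ 4) (d :: real ^ 4 \<Rightarrow> real ^ 4).
       smooth_ericksen_leslie_solution_on (- {0}) u d \<longrightarrow>
       (\<exists>C::real. C > 0 \<and> (\<forall>x\<in>- {0}. norm (u x) \<le> C / norm x)) \<longrightarrow>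
       (\<forall>x\<in>- {0}. norm (grad d x) < \<epsilon>\<^sub>1 / norm x) \<longrightarrow>
       (\<forall>x\<in>- {0}. u x = 0) \<and> d constant_on (- {0}))"
\<comment> \<open>The square of 1/2 is the 1/4 in \<open>grad_D_le\<close>; it is fixed before u, d
  and the bound C appear.\<close>
proof (intro exI[of _ "1 / 2"] conjI allI impI)
  fix u d :: "real ^ 4 \<Rightarrow> real ^ 4"
  assume sol: "smooth_ericksen_leslie_solution_on (- {0}) u d"
    and u: "\<exists>C::real. C > 0 \<and> (\<forall>x\<in>- {0}. norm (u x) \<le> C / norm x)"
    and d: "\<forall>x\<in>- {0}. norm (grad d x) < 1 / 2 / norm x"
  obtain C p where *: "smooth_on (- {0}) u" "smooth_on (- {0}) d" "d ` (- {0}) \<subseteq> sphere 0 1" "smooth_on (- {0}) p"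
      "ericksen_leslie_on (- {0}) u p d" "\<And>x. x \<noteq> 0 \<Longrightarrow> norm (u x) \<le> C / norm x"
    using sol u by (auto simp: smooth_ericksen_leslie_solution_on_def)
  interpret ericksen_leslie C "\<lambda>i x. u x $ i" "\<lambda>a x. d x $ a" p
    using ericksen_leslie_components[OF *] d by simp
  show "\<forall>x\<in>- {0}. u x = 0" using U_eq_0 by (simp add: vec_eq_iff)
  \<comment> \<open>The full derivative is assembled from the vanishing partial derivatives of the
    components; connectedness of the punctured space then gives constancy.\<close>
  have der: "(d has_derivative (\<lambda>_. 0)) (at x)" if "x \<in> - {0}" for x
  proof -
    have "((\<lambda>x. d x $ a) has_derivative (\<lambda>v. \<Sum>j\<in>UNIV. v $ j * pd j (\<lambda>x. d x $ a) x)) (at x)" for a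
      by (rule has_derivative_pd[OF differentiable_fields(2)]) (use that in simp)
    moreover have "pd j (\<lambda>x. d x $ a) x = 0" for j a using pd_D_eq_0 that by simp
    ultimately have "((\<lambda>x. d x $ a) has_derivative (\<lambda>v. 0)) (at x)" for a by simp
    then show ?thesis
      unfolding has_derivative_componentwise_within[of d] by (auto simp: Basis_vec_def inner_axis)
  qed
  have "connected (- {0 :: real ^ 4})" by (rule connected_punctured_universe) simp
  then show "d constant_on (- {0})"
    using has_derivative_zero_unique_connected[OF open_punctured _ der, where x = "axis 1 1"]
    unfolding constant_on_def by (metis Compl_iff axis_eq_0_iff singletonD zero_neq_one)
qed simp

end
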